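(* Let $(X,\omega)$ be a Kähler Cartan-Hadamard manifold, $\Lambda$ a discrete set of points in $X$, and $(L,h)\to X$ a holomorphic hermitian line bundle which is regular around $\Lambda$. If $\Lambda$ is interpolating for $\mathcal F_{\omega,h}$, then $\Lambda$ is uniformly $\omega$-separated.
   Context: A Cartan-Hadamard manifold is a simply connected complete Riemannian manifold with non-positive sectional curvature; a Kähler manifold $(X,\omega)$ is called Cartan-Hadamard if its underlying Riemannian manifold is. $d_\omega$ is the geodesic distance, $B_\omega(p,r)$ the geodesic ball of centre $p$ and radius $r$, $dV_\omega$ the Riemannian volume, and $n=\dim_{\mathbb C}X$. $\Lambda$ is uniformly $\omega$-separated if $\inf_{p,q\in\Lambda,\,p\neq q} d_\omega(p,q)>0$. Spaces: $\mathcal F_{\omega,h}=\{f\in H^0(X,L): \int_X\|f\|_h^2\,dV_\omega<+\infty\}$ and $l^2_{\Lambda,h}=\{a\in\Gamma(\Lambda,L): \sum_{p\in\Lambda}\|a(p)\|_h^2<+\infty\}$, where $\Gamma(\Lambda,L)$ is the set of all sections of $L|_\Lambda$ (a choice of $a(p)\in L_p$ for each $p\in\Lambda$). $\Lambda$ is interpolating for $\mathcal F_{\omega,h}$ if for every $a\in l^2_{\Lambda,h}$ there is $f\in\mathcal F_{\omega,h}$ with $f|_\Lambda=a$. Regular frame: for $M_2\in[0,+\infty[$, a hermitian line bundle $(L,h)\to U$ on an open set $U\subset\mathbb C^n$ has an $M_2$-regular frame $e$ on $U$ if the weight $\Phi:=-\log h(e)$ (with $h(e)=\|e\|_h^2$)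 can be written as $\sum_{1\le\alpha\le N}|\sigma_\alpha|^2+\Phi_{def}$, where the $\sigma_\alpha$ are holomorphic functions on $U$ with $\sup_{x,y\in U}|\sigma_\alpha(x)-\sigma_\alpha(y)|^2\le M_2$, and all second order real derivatives of $\Phi_{def}$ are bounded by $-M_2$ and $M_2$ on $U$. Regular around $\Lambda$: $(L,h)\to X$ is regular around $\Lambda$ if there exist positive numbers $r,\lambda,\mu$ and $M_2$ such that for all $p\in\Lambda$ there is a holomorphic coordinate chart $\Psi_p:(U,0)\subset\mathbb C^n\to(V,p)\subset X$ centered at $p$ such that (i) $\Psi_p(U)\supset B_\omega(p,r)$; (ii) $(\Psi_p^\star L,h)$ (with the pulled-back metric) has an $M_2$-regular frame $e$ on $\Psi_p^{-1}(B_\omega(p,r))$; (iii) the differential $d\Psi_p:(TU,\Psi_p^\star\omega(p))\to(TV,\omega)$ satisfies $\mu\le\|d\Psi_p\|\le\lambda$ on $\Psi_p^{-1}(B_\omega(p,r))$, i.e. $\mu|v|_{\Psi_p^\star\omega(p)}\le|d\Psi_p(v)|_\omega\le\lambda|v|_{\Psi_p^\star\omega(p)}$ for all tangent vectors $v$ there, where $TU$ carries the constant metric $\Psi_p^\star\omega(p)$, equal to $\Psi_p^\star\omega$ at $0$.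
   Formalization: In "regular around Λ", the number N of functions σ_α is taken uniform in p, and the charts Ψ_p are taken unitary at p (Ψ_p^*ω(p) is the standard metric); if N or the coordinate scaling may depend freely on p, the claim fails, e.g. for weight |z|^4 on ℂ. *)

theory Defs
  imports "HOL-Analysis.Analysis"
begin

section \<open>Smooth and holomorphic functions on open subsets of complex affine space\<close>

text \<open>Only used for open \<open>S\<close> in a finite-dimensional space, where it is the usual notion of class
  \<open>C^k\<close>: all iterated directional derivatives up to order \<open>k\<close> exist and are continuous.\<close>

primrec Ck_on :: "nat \<Rightarrow> ('b::real_normed_vector \<Rightarrow> 'c::real_normed_vector) \<Rightarrow> 'b set \<Rightarrow> bool" where
  "Ck_on 0 f S \<longleftrightarrow> continuous_on S f"
| "Ck_on (Suc k) f S \<longleftrightarrow>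
     (\<forall>x\<in>S. f differentiable (at x)) \<and> (\<forall>v. Ck_on k (\<lambda>x. frechet_derivative f (at x) v) S)"

definition smooth_on :: "('b::real_normed_vector \<Rightarrow> 'c::real_normed_vector) \<Rightarrow> 'b set \<Rightarrow> bool" where
  "smooth_on f S \<longleftrightarrow> (\<forall>k. Ck_on k f S)"

definition dir_deriv ::
  "('b::real_normed_vector \<Rightarrow> 'c::real_normed_vector) \<Rightarrow> 'b \<Rightarrow> 'b \<Rightarrow> 'c" where
  "dir_deriv f x v = frechet_derivative f (at x) v"

definition holo_on :: "(complex^'n \<Rightarrow> complex) \<Rightarrow> (complex^'n) set \<Rightarrow> bool" where
  "holo_on f S \<longleftrightarrow>
     (\<forall>x\<in>S. \<exists>f'. (f has_derivative f') (at x) \<and> (\<forall>c v. f' (c *s v) = c * f' v))"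


section \<open>Complex manifolds\<close>

text \<open>The manifold is a whole type \<open>'a\<close>, of complex dimension \<open>CARD('n)\<close>. A chart is a pair of its
  domain and its coordinate map; the value of the map outside the domain is irrelevant.\<close>

type_synonym ('a, 'n) chart = "'a set \<times> ('a \<Rightarrow> complex^'n)"

definition chart_img :: "('a, 'n) chart \<Rightarrow> (complex^'n) set" where
  "chart_img c = snd c ` fst c"

definition chart_inv :: "('a, 'n) chart \<Rightarrow> complex^'n \<Rightarrow> 'a" where
  "chart_inv c = inv_into (fst c) (snd c)"

definition is_chart :: "('a::topological_space, 'n::finite) chart \<Rightarrow> bool" where
  "is_chart c \<longleftrightarrow>
     open (fst c) \<and> open (chart_img c) \<and> homeomorphism (fst c) (chart_img c) (snd c) (chart_inv c)"

definition holo_transition :: "('a, 'n::finite) chart \<Rightarrow> ('a, 'n) chart \<Rightarrow> bool" where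
  "holo_transition c d \<longleftrightarrow>
     (\<forall>i. holo_on (\<lambda>x. snd d (chart_inv c x) $ i) (snd c ` (fst c \<inter> fst d)))"

text \<open>\<open>M\<close> is the maximal holomorphic atlas, i.e. the set of all holomorphic coordinate charts.\<close>

definition complex_structure ::
  "('a::{t2_space,second_countable_topology}, 'n::finite) chart set \<Rightarrow> bool" where
  "complex_structure M \<longleftrightarrow>
     (\<forall>c\<in>M. is_chart c) \<and>
     (\<Union>c\<in>M. fst c) = UNIV \<and>
     (\<forall>c\<in>M. \<forall>d\<in>M. holo_transition c d) \<and>
     (\<forall>c. is_chart c \<and> (\<forall>d\<in>M. holo_transition c d \<and> holo_transition d c) \<longrightarrow> c \<in> M)"


section \<open>Kaehler forms and their Riemannian metrics\<close>

text \<open>A differential 2-form is represented by its coordinate expressions: \<open>\<omega> c x\<close> is the bilinear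
  form at \<open>x\<close> of the pullback of \<open>\<omega>\<close> to \<open>chart_img c\<close> under \<open>chart_inv c\<close>. The last clause is
  the transformation rule. Complex structure \<open>J\<close> on tangent vectors is \<open>(*s) \<i>\<close>.\<close>

type_synonym ('a, 'n) form2 =
  "('a, 'n) chart \<Rightarrow> complex^'n \<Rightarrow> complex^'n \<Rightarrow> complex^'n \<Rightarrow> real"

definition kaehler_form ::
  "('a::{t2_space,second_countable_topology}, 'n::finite) chart set \<Rightarrow> ('a, 'n) form2 \<Rightarrow> bool" where
  "kaehler_form M \<omega> \<longleftrightarrow>
     (\<forall>c\<in>M. \<forall>u v. smooth_on (\<lambda>x. \<omega> c x u v) (chart_img c)) \<and>
     (\<forall>c\<in>M. \<forall>x\<in>chart_img c.
        bilinear (\<omega> c x) \<and>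
        (\<forall>u v. \<omega> c x v u = - \<omega> c x u v) \<and>
        (\<forall>u v. \<omega> c x (\<i> *s u) (\<i> *s v) = \<omega> c x u v) \<and>
        (\<forall>u. u \<noteq> 0 \<longrightarrow> \<omega> c x u (\<i> *s u) > 0) \<and>
        \<comment> \<open>closedness, evaluated on constant vector fields\<close>
        (\<forall>u v w. dir_deriv (\<lambda>y. \<omega> c y v w) x u - dir_deriv (\<lambda>y. \<omega> c y u w) x v
                 + dir_deriv (\<lambda>y. \<omega> c y u v) x w = 0)) \<and>
     (\<forall>c\<in>M. \<forall>d\<in>M. \<forall>p \<in> fst c \<inter> fst d. \<forall>u v.
        \<omega> c (snd c p) u v =
        (let A = dir_deriv (\<lambda>x. snd d (chart_inv c x)) (snd c p)
         in \<omega> d (snd d p) (A u) (A v)))"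

definition metric :: "('a, 'n::finite) form2 \<Rightarrow> ('a, 'n) form2" where
  "metric \<omega> c x u v = \<omega> c x u (\<i> *s v)"

text \<open>Length, in the metric of \<open>\<omega>\<close> at \<open>chart_inv c x\<close>, of the image of \<open>v\<close> under the differential of
  \<open>chart_inv c\<close> at \<open>x\<close>.\<close>

definition tnorm :: "('a, 'n::finite) form2 \<Rightarrow> ('a, 'n) chart \<Rightarrow> complex^'n \<Rightarrow> complex^'n \<Rightarrow> real" where
  "tnorm \<omega> c x v = sqrt (metric \<omega> c x v v)"


subsection \<open>Geodesic distance and completeness\<close>

text \<open>As in \<^const>\<open>piecewise_C1_differentiable_on\<close>, finitely many parameters are exempt, which may
  include the end points.\<close>

definition pw_C1_curve ::
  "('a::topological_space, 'n::finite) chart set \<Rightarrow> (real \<Rightarrow> 'a) \<Rightarrow> bool" where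
  "pw_C1_curve M \<gamma> \<longleftrightarrow>
     path \<gamma> \<and>
     (\<exists>T. finite T \<and>
        (\<forall>c\<in>M. (snd c \<circ> \<gamma>) C1_differentiable_on ({t \<in> {0..1}. \<gamma> t \<in> fst c} - T)))"

definition speed ::
  "('a, 'n::finite) chart set \<Rightarrow> ('a, 'n) form2 \<Rightarrow> (real \<Rightarrow> 'a) \<Rightarrow> real \<Rightarrow> real" where
  "speed M \<omega> \<gamma> t =
     (let c = (SOME c. c \<in> M \<and> \<gamma> t \<in> fst c)
      in tnorm \<omega> c (snd c (\<gamma> t)) (vector_derivative (snd c \<circ> \<gamma>) (at t)))"

definition curve_length ::
  "('a, 'n::finite) chart set \<Rightarrow> ('a, 'n) form2 \<Rightarrow> (real \<Rightarrow> 'a) \<Rightarrow> ennreal" where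
  "curve_length M \<omega> \<gamma> = (\<integral>\<^sup>+ t \<in> {0..1}. ennreal (speed M \<omega> \<gamma> t) \<partial>lborel)"

definition geodist ::
  "('a::topological_space, 'n::finite) chart set \<Rightarrow> ('a, 'n) form2 \<Rightarrow> 'a \<Rightarrow> 'a \<Rightarrow> ennreal" where
  "geodist M \<omega> p q =
     (INF \<gamma> \<in> {\<gamma>. pw_C1_curve M \<gamma> \<and> pathstart \<gamma> = p \<and> pathfinish \<gamma> = q}. curve_length M \<omega> \<gamma>)"

definition geoball ::
  "('a::topological_space, 'n::finite) chart set \<Rightarrow> ('a, 'n) form2 \<Rightarrow> 'a \<Rightarrow> real \<Rightarrow> 'a set" where
  "geoball M \<omega> p r = {q. geodist M \<omega> p q < ennreal r}"

definition complete_metric ::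
  "('a::topological_space, 'n::finite) chart set \<Rightarrow> ('a, 'n) form2 \<Rightarrow> bool" where
  "complete_metric M \<omega> \<longleftrightarrow>
     (\<forall>s :: nat \<Rightarrow> 'a.
        (\<forall>e>0. \<exists>N. \<forall>i\<ge>N. \<forall>j\<ge>N. geodist M \<omega> (s i) (s j) < e) \<longrightarrow>
        (\<exists>x. (\<lambda>i. geodist M \<omega> (s i) x) \<longlonglongrightarrow> 0))"


subsection \<open>Sectional curvature\<close>

text \<open>In what follows \<open>g\<close> is a Riemannian metric on an open subset of a Euclidean space.
  \<open>levi_civita g x u v\<close> is the covariant derivative at \<open>x\<close> of the constant field \<open>v\<close> in direction
  \<open>u\<close> (Koszul formula), \<open>curvature g x u v w\<close> is \<open>R(u,v)w\<close>.\<close>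

definition levi_civita ::
  "('b::euclidean_space \<Rightarrow> 'b \<Rightarrow> 'b \<Rightarrow> real) \<Rightarrow> 'b \<Rightarrow> 'b \<Rightarrow> 'b \<Rightarrow> 'b" where
  "levi_civita g x u v =
     (THE w. \<forall>z. g x w z =
        (dir_deriv (\<lambda>y. g y v z) x u + dir_deriv (\<lambda>y. g y u z) x v
         - dir_deriv (\<lambda>y. g y u v) x z) / 2)"

definition curvature ::
  "('b::euclidean_space \<Rightarrow> 'b \<Rightarrow> 'b \<Rightarrow> real) \<Rightarrow> 'b \<Rightarrow> 'b \<Rightarrow> 'b \<Rightarrow> 'b \<Rightarrow> 'b" where
  "curvature g x u v w =
     dir_deriv (\<lambda>y. levi_civita g y v w) x u - dir_deriv (\<lambda>y. levi_civita g y u w) x v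
     + levi_civita g x u (levi_civita g x v w) - levi_civita g x v (levi_civita g x u w)"

definition sectional_curvature ::
  "('b::euclidean_space \<Rightarrow> 'b \<Rightarrow> 'b \<Rightarrow> real) \<Rightarrow> 'b \<Rightarrow> 'b \<Rightarrow> 'b \<Rightarrow> real" where
  "sectional_curvature g x u v =
     g x (curvature g x u v v) u / (g x u u * g x v v - (g x u v)\<^sup>2)"

definition kaehler_cartan_hadamard ::
  "('a::{t2_space,second_countable_topology}, 'n::finite) chart set \<Rightarrow> ('a, 'n) form2 \<Rightarrow> bool" where
  "kaehler_cartan_hadamard M \<omega> \<longleftrightarrow>
     complex_structure M \<and> kaehler_form M \<omega> \<and>
     simply_connected (UNIV :: 'a set) \<and>
     complete_metric M \<omega> \<and>
     (\<forall>c\<in>M. \<forall>x\<in>chart_img c. \<forall>u v. u \<noteq> v \<and> independent {u, v} \<longrightarrow>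
        sectional_curvature (metric \<omega> c) x u v \<le> 0)"


subsection \<open>Riemannian volume\<close>

text \<open>The vectors \<open>real_frame a\<close> are the coordinate vectors of the real coordinates
  \<open>x_1, \<dots>, x_n, y_1, \<dots>, y_n\<close>.\<close>

definition real_frame :: "'n::finite + 'n \<Rightarrow> complex^'n" where
  "real_frame a = (case a of Inl i \<Rightarrow> axis i 1 | Inr i \<Rightarrow> axis i \<i>)"

definition vol_density :: "('a, 'n::finite) form2 \<Rightarrow> ('a, 'n) chart \<Rightarrow> complex^'n \<Rightarrow> real" where
  "vol_density \<omega> c x =
     sqrt (det ((\<chi> a b. metric \<omega> c x (real_frame a) (real_frame b)) :: real^('n + 'n)^('n + 'n)))"

definition chart_volume ::
  "('a::topological_space, 'n::finite) form2 \<Rightarrow> ('a, 'n) chart \<Rightarrow> 'a measure" where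
  "chart_volume \<omega> c =
     distr (density (restrict_space lborel (chart_img c)) (\<lambda>x. ennreal (vol_density \<omega> c x)))
       borel (chart_inv c)"

text \<open>The volume measures of the charts, extended by zero outside the chart domains, agree on
  overlaps. Their least upper bound in the complete lattice of measures is therefore the Borel
  measure which restricts to \<open>chart_volume \<omega> c\<close> on the domain of each chart \<open>c\<close>.\<close>

definition volume ::
  "('a::topological_space, 'n::finite) chart set \<Rightarrow> ('a, 'n) form2 \<Rightarrow> 'a measure" where
  "volume M \<omega> = (SUP c\<in>M. chart_volume \<omega> c)"


section \<open>Holomorphic hermitian line bundles\<close>

text \<open>\<open>\<pi>\<close> is the projection of the total space \<open>'l\<close>. A local trivialization is a pair \<open>(W, \<tau>)\<close>,
  where \<open>\<tau>\<close> is the fibre coordinate of \<open>L\<close> over \<open>W\<close>. Since the transition functions are fibrewise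
  linear, the trivializations determine the vector space structure of the fibres.\<close>

definition manifold_holo_on ::
  "('a, 'n::finite) chart set \<Rightarrow> ('a \<Rightarrow> complex) \<Rightarrow> 'a set \<Rightarrow> bool" where
  "manifold_holo_on M f W \<longleftrightarrow>
     (\<forall>c\<in>M. holo_on (\<lambda>x. f (chart_inv c x)) (snd c ` (fst c \<inter> W)))"

definition holo_line_bundle ::
  "('a::topological_space, 'n::finite) chart set \<Rightarrow> ('l \<Rightarrow> 'a) \<Rightarrow> ('a set \<times> ('l \<Rightarrow> complex)) set \<Rightarrow> bool"
  where
  "holo_line_bundle M \<pi> T \<longleftrightarrow>
     (\<forall>(W, \<tau>)\<in>T. open W \<and> (\<forall>p\<in>W. bij_betw \<tau> {v. \<pi> v = p} UNIV)) \<and>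
     (\<Union>(W, \<tau>)\<in>T. W) = UNIV \<and>
     (\<forall>(W, \<tau>)\<in>T. \<forall>(W', \<tau>')\<in>T. \<exists>k.
        manifold_holo_on M k (W \<inter> W') \<and> (\<forall>p \<in> W \<inter> W'. k p \<noteq> 0) \<and>
        (\<forall>v. \<pi> v \<in> W \<inter> W' \<longrightarrow> \<tau>' v = k (\<pi> v) * \<tau> v))"

text \<open>A hermitian metric is given by the squared norm \<open>h v\<close> of the elements \<open>v\<close> of \<open>L\<close>.\<close>

definition hermitian_metric ::
  "('a, 'n::finite) chart set \<Rightarrow> ('l \<Rightarrow> 'a) \<Rightarrow> ('a set \<times> ('l \<Rightarrow> complex)) set \<Rightarrow> ('l \<Rightarrow> real) \<Rightarrow> bool"
  where
  "hermitian_metric M \<pi> T h \<longleftrightarrow>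
     (\<forall>(W, \<tau>)\<in>T. \<exists>\<phi>.
        (\<forall>c\<in>M. smooth_on (\<lambda>x. \<phi> (chart_inv c x)) (snd c ` (fst c \<inter> W))) \<and>
        (\<forall>v. \<pi> v \<in> W \<longrightarrow> h v = (cmod (\<tau> v))\<^sup>2 * exp (- \<phi> (\<pi> v))))"

definition holo_section ::
  "('a, 'n::finite) chart set \<Rightarrow> ('l \<Rightarrow> 'a) \<Rightarrow> ('a set \<times> ('l \<Rightarrow> complex)) set \<Rightarrow> ('a \<Rightarrow> 'l) \<Rightarrow> bool"
  where
  "holo_section M \<pi> T f \<longleftrightarrow>
     (\<forall>p. \<pi> (f p) = p) \<and> (\<forall>(W, \<tau>)\<in>T. manifold_holo_on M (\<lambda>p. \<tau> (f p)) W)"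


subsection \<open>Interpolation\<close>

definition fock_space ::
  "('a::topological_space, 'n::finite) chart set \<Rightarrow> ('a, 'n) form2 \<Rightarrow>
   ('l \<Rightarrow> 'a) \<Rightarrow> ('a set \<times> ('l \<Rightarrow> complex)) set \<Rightarrow> ('l \<Rightarrow> real) \<Rightarrow> ('a \<Rightarrow> 'l) set" where
  "fock_space M \<omega> \<pi> T h =
     {f. holo_section M \<pi> T f \<and> (\<integral>\<^sup>+ x. ennreal (h (f x)) \<partial>volume M \<omega>) < \<infinity>}"

definition l2_sections :: "('l \<Rightarrow> 'a) \<Rightarrow> ('l \<Rightarrow> real) \<Rightarrow> 'a set \<Rightarrow> ('a \<Rightarrow> 'l) set" where
  "l2_sections \<pi> h \<Lambda> = {a. (\<forall>p\<in>\<Lambda>. \<pi> (a p) = p) \<and> (\<lambda>p. h (a p)) summable_on \<Lambda>}"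

definition interpolating ::
  "('a::topological_space, 'n::finite) chart set \<Rightarrow> ('a, 'n) form2 \<Rightarrow>
   ('l \<Rightarrow> 'a) \<Rightarrow> ('a set \<times> ('l \<Rightarrow> complex)) set \<Rightarrow> ('l \<Rightarrow> real) \<Rightarrow> 'a set \<Rightarrow> bool" where
  "interpolating M \<omega> \<pi> T h \<Lambda> \<longleftrightarrow>
     (\<forall>a \<in> l2_sections \<pi> h \<Lambda>. \<exists>f \<in> fock_space M \<omega> \<pi> T h. \<forall>p\<in>\<Lambda>. f p = a p)"

definition uniformly_separated ::
  "('a::topological_space, 'n::finite) chart set \<Rightarrow> ('a, 'n) form2 \<Rightarrow> 'a set \<Rightarrow> bool" where
  "uniformly_separated M \<omega> \<Lambda> \<longleftrightarrow>
     (INF (p, q) \<in> {(p, q). p \<in> \<Lambda> \<and> q \<in> \<Lambda> \<and> p \<noteq> q}. geodist M \<omega> p q) > 0"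


subsection \<open>Regularity of the metric around a set\<close>

text \<open>A holomorphic frame of the pullback of \<open>L\<close> by \<open>\<Psi>\<close> over \<open>U\<close>, as a holomorphic map into \<open>L\<close>
  lifting \<open>\<Psi>\<close> and avoiding the zero section.\<close>

definition pullback_frame ::
  "('l \<Rightarrow> 'a) \<Rightarrow> ('a set \<times> ('l \<Rightarrow> complex)) set \<Rightarrow> (complex^'n::finite \<Rightarrow> 'a) \<Rightarrow>
   (complex^'n) set \<Rightarrow> (complex^'n \<Rightarrow> 'l) \<Rightarrow> bool" where
  "pullback_frame \<pi> T \<Psi> U e \<longleftrightarrow>
     (\<forall>z\<in>U. \<pi> (e z) = \<Psi> z) \<and>
     (\<forall>(W, \<tau>)\<in>T. holo_on (\<lambda>z. \<tau> (e z)) {z\<in>U. \<Psi> z \<in> W} \<and>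
                 (\<forall>z\<in>U. \<Psi> z \<in> W \<longrightarrow> \<tau> (e z) \<noteq> 0))"

text \<open>The \<open>C\<^sup>2\<close> clause is no restriction: it holds automatically because \<open>\<Phi>\<close> is smooth and the
  functions \<open>\<sigma> \<alpha>\<close> are holomorphic. The basis \<^const>\<open>Basis\<close> consists of the real coordinate
  directions.\<close>

definition regular_weight ::
  "real \<Rightarrow> nat \<Rightarrow> (complex^'n::finite) set \<Rightarrow> (complex^'n \<Rightarrow> real) \<Rightarrow> bool" where
  "regular_weight M2 N U \<Phi> \<longleftrightarrow>
     (\<exists>(\<sigma> :: nat \<Rightarrow> complex^'n \<Rightarrow> complex) \<Phi>def.
        (\<forall>z\<in>U. \<Phi> z = (\<Sum>\<alpha>=1..N. (cmod (\<sigma> \<alpha> z))\<^sup>2) + \<Phi>def z) \<and>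
        (\<forall>\<alpha>\<in>{1..N}. holo_on (\<sigma> \<alpha>) U \<and> (\<forall>x\<in>U. \<forall>y\<in>U. (cmod (\<sigma> \<alpha> x - \<sigma> \<alpha> y))\<^sup>2 \<le> M2)) \<and>
        Ck_on 2 \<Phi>def U \<and>
        (\<forall>x\<in>U. \<forall>u\<in>Basis. \<forall>v\<in>Basis.
           \<bar>dir_deriv (\<lambda>y. dir_deriv \<Phi>def y u) x v\<bar> \<le> M2))"

definition has_regular_frame ::
  "real \<Rightarrow> nat \<Rightarrow> ('l \<Rightarrow> 'a) \<Rightarrow> ('a set \<times> ('l \<Rightarrow> complex)) set \<Rightarrow> ('l \<Rightarrow> real) \<Rightarrow>
   (complex^'n::finite \<Rightarrow> 'a) \<Rightarrow> (complex^'n) set \<Rightarrow> bool" where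
  "has_regular_frame M2 N \<pi> T h \<Psi> U \<longleftrightarrow>
     (\<exists>e. pullback_frame \<pi> T \<Psi> U e \<and> regular_weight M2 N U (\<lambda>z. - ln (h (e z))))"

text \<open>The constants \<open>r\<close>, \<open>lam\<close>, \<open>mu\<close>, \<open>M2\<close> and the number \<open>N\<close> of holomorphic functions are uniform in
  \<open>p\<close>. The second derivatives in the definition of a regular weight are measured in the constant
  metric that the coordinate space carries, the pullback of \<open>\<omega>(p)\<close>; this is what the clause
  \<open>metric \<omega> c 0 u v = u \<bullet> v\<close> (coordinates unitary at \<open>p\<close>) expresses. Without uniformity of \<open>N\<close>, or
  with coordinates that may be rescaled at will depending on \<open>p\<close>, the bounds \<open>M2\<close> would be void:
  split \<open>\<sigma> \<alpha>\<close> into many small equal pieces, or replace \<open>\<Psi>(z)\<close> by \<open>\<Psi>(z/K)\<close> with \<open>K\<close> large.\<close>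

definition regular_around ::
  "('a::topological_space, 'n::finite) chart set \<Rightarrow> ('a, 'n) form2 \<Rightarrow>
   ('l \<Rightarrow> 'a) \<Rightarrow> ('a set \<times> ('l \<Rightarrow> complex)) set \<Rightarrow> ('l \<Rightarrow> real) \<Rightarrow> 'a set \<Rightarrow> bool" where
  "regular_around M \<omega> \<pi> T h \<Lambda> \<longleftrightarrow>
     (\<exists>r>0. \<exists>lam>0. \<exists>mu>0. \<exists>M2>0. \<exists>N. \<forall>p\<in>\<Lambda>. \<exists>c\<in>M.
        p \<in> fst c \<and> snd c p = 0 \<and>
        (\<forall>u v. metric \<omega> c 0 u v = u \<bullet> v) \<and>
        geoball M \<omega> p r \<subseteq> fst c \<and>
        has_regular_frame M2 N \<pi> T h (chart_inv c) (snd c ` geoball M \<omega> p r) \<and>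
        (\<forall>x \<in> snd c ` geoball M \<omega> p r. \<forall>v.
           mu * tnorm \<omega> c 0 v \<le> tnorm \<omega> c x v \<and> tnorm \<omega> c x v \<le> lam * tnorm \<omega> c 0 v))"

end

theory Submission
  imports Defs "HOL-Complex_Analysis.Cauchy_Integral_Formula"
begin

text \<open>Everything rests on a local estimate (\<open>vanishing_section_estimate\<close>):
  there are \<open>\<epsilon>\<close> and \<open>K\<close> such that, for a section
  \<open>f\<close> of finite norm that vanishes at a point \<open>q\<close> and for \<open>p \<in>
  \<Lambda>\<close> at distance less than \<open>d \<le> \<epsilon>\<close> from \<open>q\<close>,
  the squared norm of \<open>f p\<close> is at most \<open>K * d\<^sup>2\<close> times the
  integral of the squared norm of \<open>f\<close>.

  Given this, separation follows by interpolating well-chosen values. A section with value of norm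
  one at a single \<open>p \<in> \<Lambda>\<close> and zero at the other points of
  \<open>\<Lambda>\<close> shows that \<open>p\<close> has positive distance from the rest of
  \<open>\<Lambda>\<close> (\<open>interpolating_gap\<close>). If \<open>\<Lambda>\<close> is not
  uniformly separated, these gaps allow us to choose pairs \<open>p k\<close>, \<open>q k\<close>
  in \<open>\<Lambda>\<close> at distance less than \<open>\<epsilon> * (1/4) ^ k\<close> and with
  no point \<open>p j\<close> among the others (\<open>disjoint_close_pairs\<close>). The values
  with squared norm \<open>(1/4) ^ k\<close> at \<open>p k\<close> and zero elsewhere are square
  summable, but the local estimate rules out an interpolating section.

  The local estimate is proved in the chart around \<open>p\<close>. By completeness the image of
  the geodesic ball contains a coordinate ball of uniform radius
  (\<open>ball_subset_geoball\<close>). On it the metric is comparable to the flat one, so the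
  coordinate vector of \<open>q\<close> is of the size of the distance
  (\<open>geodist_lower_bound\<close>), and the Riemannian volume dominates a multiple of Lebesgue
  measure (\<open>vol_density_lower_bound\<close>). In the regular frame \<open>f\<close> is a
  holomorphic function \<open>F\<close>, and the weight \<open>\<Phi>\<close> differs from the
  real part of a holomorphic function \<open>H\<close> by a bounded amount
  (\<open>regular_weight_approx_pluriharmonic\<close>). So we may replace \<open>F\<close> with
  the weight \<open>\<Phi>\<close> by the unweighted function \<open>F * exp (- H / 2)\<close>. It
  has a zero near the origin, and the sub-mean value inequality on balls together with Cauchy's
  inequality on a complex line bounds its value at the origin
  (\<open>weighted_value_bound_near_zero\<close>).\<close>

section \<open>Lebesgue measure and orthogonal maps\<close>

lemma orthogonal_transformation_vimage_ball:
  assumes "orthogonal_transformation f"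
  shows "f x \<in> ball 0 s \<longleftrightarrow> x \<in> ball 0 s"
  using assms by (simp add: orthogonal_transformation)

lemma nn_integral_lborel_translate:
  fixes f :: "'a::euclidean_space \<Rightarrow> ennreal"
  assumes [measurable]: "f \<in> borel_measurable borel"
  shows "(\<integral>\<^sup>+x. f (t + x) \<partial>lborel) = (\<integral>\<^sup>+x. f x \<partial>lborel)"
proof -
  have "(\<integral>\<^sup>+x. f x \<partial>lborel) = (\<integral>\<^sup>+x. f x \<partial>distr lborel borel ((+) t))"
    by (simp add: lborel_distr_plus)
  then show ?thesis by (simp add: nn_integral_distr)
qed

lemma nn_integral_lborel_reflect:
  fixes f :: "'a::euclidean_space \<Rightarrow> ennreal"
  assumes [measurable]: "f \<in> borel_measurable borel"
  shows "(\<integral>\<^sup>+x. f (t - x) \<partial>lborel) = (\<integral>\<^sup>+x. f x \<partial>lborel)"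
proof -
  have "(lborel::'a measure) = distr lborel borel (\<lambda>x. t - x)"
    using lborel_affine[of "-1" t] by (simp add: density_1)
  then have "(\<integral>\<^sup>+x. f x \<partial>lborel) = (\<integral>\<^sup>+x. f x \<partial>distr lborel borel (\<lambda>x. t - x))"
    by simp
  then show ?thesis by (simp add: nn_integral_distr)
qed

text \<open>The image of Lebesgue measure under \<open>f\<close> is again translation invariant,
  and two such measures are proportional: integrate \<open>indicator A (f x) * indicator B (f x +
  y)\<close> over both variables in the two possible orders. The factor is \<open>1\<close>
  because \<open>f\<close> preserves the unit ball, which is the set \<open>B\<close>
  used.\<close>

lemma distr_lborel_orthogonal_transformation:
  fixes f :: "'a::euclidean_space \<Rightarrow> 'a"
  assumes f: "orthogonal_transformation f"
  shows "distr lborel borel f = lborel"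
proof (rule measure_eqI)
  fix A assume "A \<in> sets (distr lborel borel f)"
  then have A [measurable]: "A \<in> sets borel" by simp
  have lin: "linear f" using f by (rule orthogonal_transformation_linear)
  have fm [measurable]: "f \<in> borel_measurable borel"
    using lin by (intro borel_measurable_continuous_onI) (simp add: linear_continuous_on linear_conv_bounded_linear)
  define g where "g = inv f"
  have fg: "f (g y) = y" for y
    unfolding g_def using orthogonal_transformation_surj[OF f] by (simp add: surj_f_inv_f)
  define B where "B = (ball 0 1 :: 'a set)"
  have B [measurable]: "B \<in> sets borel" unfolding B_def by simp
  have fB: "indicator B (f x) = (indicator B x :: ennreal)" for x
    unfolding B_def using orthogonal_transformation_vimage_ball[OF f, of x 1] by (simp add: indicator_def)
  let ?L = "emeasure lborel"
  have b: "?L B \<noteq> 0" "?L B \<noteq> \<infinity>"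
    unfolding B_def by (simp_all add: emeasure_ball unit_ball_vol_pos less_imp_neq[symmetric])
  have "(\<integral>\<^sup>+x. indicator A (f x) * ?L B \<partial>lborel)
      = (\<integral>\<^sup>+x. \<integral>\<^sup>+y. indicator A (f x) * indicator B (f x + y) \<partial>lborel \<partial>lborel)"
    by (simp add: nn_integral_cmult nn_integral_lborel_translate[where f="indicator B"])
  also have "\<dots> = (\<integral>\<^sup>+y. \<integral>\<^sup>+x. indicator A (f x) * indicator B (f x + y) \<partial>lborel \<partial>lborel)"
    by (rule lborel_pair.Fubini') (simp add: case_prod_unfold)
  also have "\<dots> = (\<integral>\<^sup>+y. \<integral>\<^sup>+x. indicator A (f x - y) * indicator B (f x) \<partial>lborel \<partial>lborel)"
  proof (rule nn_integral_cong)
    fix y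
    have "f (g y + x) = f x + y" for x using fg by (simp add: linear_add[OF lin])
    then show "(\<integral>\<^sup>+x. indicator A (f x) * indicator B (f x + y) \<partial>lborel) =
      (\<integral>\<^sup>+x. indicator A (f x - y) * (indicator B (f x)::ennreal) \<partial>lborel)"
      using nn_integral_lborel_translate[of "\<lambda>x. indicator A (f x - y) * indicator B (f x)" "g y"]
      by simp
  qed
  also have "\<dots> = (\<integral>\<^sup>+x. \<integral>\<^sup>+y. indicator A (f x - y) * indicator B (f x) \<partial>lborel \<partial>lborel)"
    by (rule lborel_pair.Fubini'[symmetric]) (simp add: case_prod_unfold)
  also have "\<dots> = (\<integral>\<^sup>+x. ?L A * indicator B (f x) \<partial>lborel)"
    by (simp add: nn_integral_multc nn_integral_lborel_reflect[where f="indicator A"])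
  also have "\<dots> = ?L A * ?L B"
    by (simp add: fB nn_integral_cmult)
  finally have "emeasure (distr lborel borel f) A * ?L B = ?L A * ?L B"
    by (simp add: nn_integral_multc nn_integral_distr flip: nn_integral_indicator)
  then show "emeasure (distr lborel borel f) A = emeasure lborel A"
    using b by (simp add: ennreal_mult_cancel_left mult.commute[of _ "?L B"])
qed simp

lemma norm_vector_scalar_mult: "norm (c *s z) = cmod c * norm (z :: complex^'n)"
  by (simp add: norm_vec_def norm_mult L2_set_right_distrib)

lemma linear_vector_scalar_mult: "linear ((*s) c :: complex^'n \<Rightarrow> complex^'n)"
  by (rule linearI) (simp_all add: vec_eq_iff algebra_simps)

lemma orthogonal_transformation_unit_scalar:
  "cmod c = 1 \<Longrightarrow> orthogonal_transformation ((*s) c :: complex^'n \<Rightarrow> complex^'n)"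
  by (simp add: orthogonal_transformation linear_vector_scalar_mult norm_vector_scalar_mult)

section \<open>Holomorphic functions of several variables\<close>

text \<open>Holomorphy along every complex line. Functions are combined and estimated in this form
  because stability under algebraic operations and Cauchy's inequality are then one-variable
  facts.\<close>

definition holomorphic_on_lines :: "(complex^'n \<Rightarrow> complex) \<Rightarrow> (complex^'n) set \<Rightarrow> bool" where
  "holomorphic_on_lines G S \<longleftrightarrow> (\<forall>w z. (\<lambda>\<zeta>. G (w + \<zeta> *s z)) holomorphic_on {\<zeta>. w + \<zeta> *s z \<in> S})"

text \<open>Cauchy's formula at the centre of the disc, applied to \<open>g\<^sup>2\<close>:
  squaring before integrating makes the triangle inequality for integrals produce square integrals
  directly.\<close>

lemma sub_mean_value_circle:
  assumes "g holomorphic_on cball 0 1"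
  shows "ennreal ((cmod (g 0))\<^sup>2) \<le> (\<integral>\<^sup>+t\<in>{0..1}. ennreal ((cmod (g (cis (2*pi*t))))\<^sup>2) \<partial>lborel)"
proof -
  define q where "q t = (g (cis (2*pi*t)))\<^sup>2" for t :: real
  have "(\<lambda>u. (g u)\<^sup>2) holomorphic_on cball 0 1" using assms by (intro holomorphic_intros)
  from Cauchy_integral_circlepath_simple[OF this, of 0]
  have "((\<lambda>u. (g u)\<^sup>2 / u) has_contour_integral 2 * of_real pi * \<i> * (g 0)\<^sup>2) (circlepath 0 1)"
    by simp
  then have *: "((\<lambda>t. (g (circlepath 0 1 t))\<^sup>2 / circlepath 0 1 t * 
     vector_derivative (circlepath 0 1) (at t within {0..1})) has_integral 2 * of_real pi * \<i> * (g 0)\<^sup>2) {0..1}"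
    unfolding has_contour_integral_def .
  have circ: "circlepath 0 1 t = cis (2*pi*t)" "exp (2 * of_real pi * \<i> * of_real t) = cis (2*pi*t)" for t
    by (simp_all add: circlepath cis_conv_exp algebra_simps)
  note *
  moreover have "(g (circlepath 0 1 t))\<^sup>2 / circlepath 0 1 t * vector_derivative (circlepath 0 1) (at t within {0..1})
     = q t * (2 * of_real pi * \<i>)" if "t \<in> {0..1}" for t
    using that by (simp add: vector_derivative_circlepath01 q_def circ)
  ultimately have "((\<lambda>t. q t * (2 * of_real pi * \<i>)) has_integral 2 * of_real pi * \<i> * (g 0)\<^sup>2) {0..1}"
    using has_integral_cong by (metis (no_types, lifting))
  from has_integral_mult_left[OF this, of "inverse (2 * of_real pi * \<i>)"]
  have q: "(q has_integral (g 0)\<^sup>2) {0..1}" by (simp add: field_simps)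
  have cq: "continuous_on {0..1} q" unfolding q_def
    by (intro continuous_intros continuous_on_compose2[OF holomorphic_on_imp_continuous_on[OF assms]]) auto
  then have cn: "continuous_on {0..1} (\<lambda>t. cmod (q t))" by (intro continuous_intros)
  have "ennreal ((cmod (g 0))\<^sup>2) = ennreal (cmod (integral {0..1} q))"
    using q by (simp add: integral_unique norm_power)
  also have "\<dots> \<le> ennreal (integral {0..1} (\<lambda>t. cmod (q t)))"
    using cq cn by (intro ennreal_leI integral_norm_bound_integral) (auto intro: integrable_continuous_interval)
  also have "\<dots> = (\<integral>\<^sup>+t. ennreal (indicator {0..1} t *\<^sub>R cmod (q t)) \<partial>lborel)"
  proof (rule nn_integral_has_integral_lborel[symmetric])
    show "(\<lambda>t. indicator {0..1} t *\<^sub>R cmod (q t)) \<in> borel_measurable borel"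
      using cn by (intro borel_measurable_continuous_on_indicator) auto
    show "((\<lambda>t. indicator {0..1} t *\<^sub>R cmod (q t)) has_integral integral {0..1} (\<lambda>t. cmod (q t))) UNIV"
      using integrable_integral[OF integrable_continuous_interval[OF cn]]
      by (subst (asm) has_integral_restrict_UNIV[symmetric]) (simp add: indicator_def of_bool_def if_distrib[where f="\<lambda>x. x * _"] cong: if_cong)
  qed (simp)
  also have "\<dots> = (\<integral>\<^sup>+t\<in>{0..1}. ennreal ((cmod (g (cis (2*pi*t))))\<^sup>2) \<partial>lborel)"
    by (intro nn_integral_cong) (auto simp: q_def norm_power indicator_def)
  finally show ?thesis .
qed

text \<open>Scalar multiplication by \<open>e t\<close>, a complex number of modulus
  \<open>1\<close>, preserves the ball and Lebesgue measure. Hence the integral over the ball does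
  not change when the integrand is averaged over these rotations, and the average at each point is
  at least the value at the centre, by the inequality on circles.\<close>

lemma sub_mean_value_ball:
  fixes G :: "complex^'n \<Rightarrow> complex"
  assumes G: "holomorphic_on_lines G S" "continuous_on S G" and S: "open S" "ball w s \<subseteq> S"
  shows "ennreal ((cmod (G w))\<^sup>2) * emeasure lborel (ball (0::complex^'n) s)
    \<le> (\<integral>\<^sup>+z\<in>ball w s. ennreal ((cmod (G z))\<^sup>2) \<partial>lborel)"
proof -
  define u where "u z = ennreal (indicator S z *\<^sub>R (cmod (G z))\<^sup>2)" for z
  have um [measurable]: "u \<in> borel_measurable borel" unfolding u_def
    using S G by (intro measurable_compose[OF _ measurable_ennreal] borel_measurable_continuous_on_indicator continuous_intros) auto
  define e where "e t = cis (2*pi*t)" for t :: real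
  have [simp]: "cmod (e t) = 1" for t unfolding e_def by simp
  define B where "B = ball (0::complex^'n) s"
  have B [measurable]: "B \<in> sets borel" unfolding B_def by simp
  have BS: "w + e t *s z \<in> S" if "z \<in> B" for z t
    using that S unfolding B_def by (auto simp: dist_norm norm_vector_scalar_mult subset_iff)
  have sm: "(\<lambda>(t::real, z). e t *s z) \<in> borel_measurable (borel \<Otimes>\<^sub>M borel)"
    unfolding borel_prod e_def
    by (intro borel_measurable_continuous_onI) (simp add: case_prod_unfold vector_scalar_mult_def, intro continuous_intros)
  have I: "(\<integral>\<^sup>+z\<in>ball w s. ennreal ((cmod (G z))\<^sup>2) \<partial>lborel) = (\<integral>\<^sup>+z. indicator B z * u (w + e t *s z) \<partial>lborel)" for t
  proof -
    have ot: "orthogonal_transformation ((*s) (e t) :: complex^'n \<Rightarrow> complex^'n)"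
      by (rule orthogonal_transformation_unit_scalar) simp
    have [measurable]: "((*s) (e t) :: complex^'n \<Rightarrow> complex^'n) \<in> borel_measurable borel"
      by (intro borel_measurable_continuous_onI linear_continuous_on) (simp add: linear_vector_scalar_mult flip: linear_conv_bounded_linear)
    have "(\<integral>\<^sup>+z\<in>ball w s. ennreal ((cmod (G z))\<^sup>2) \<partial>lborel) = (\<integral>\<^sup>+z. indicator (ball w s) z * u z \<partial>lborel)"
      using S by (intro nn_integral_cong) (auto simp: u_def indicator_def)
    also have "\<dots> = (\<integral>\<^sup>+z. indicator (ball w s) (w + z) * u (w + z) \<partial>lborel)"
      by (rule nn_integral_lborel_translate[symmetric])
         (rule borel_measurable_times_ennreal[OF borel_measurable_indicator um], simp)
    also have "\<dots> = (\<integral>\<^sup>+z. indicator B z * u (w + z) \<partial>lborel)"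
      by (intro nn_integral_cong) (auto simp: B_def indicator_def dist_norm)
    also have "\<dots> = (\<integral>\<^sup>+z. indicator B z * u (w + z) \<partial>distr lborel borel ((*s) (e t)))"
      by (simp add: distr_lborel_orthogonal_transformation[OF ot])
    also have "\<dots> = (\<integral>\<^sup>+z. indicator B (e t *s z) * u (w + e t *s z) \<partial>lborel)"
      by (simp add: nn_integral_distr)
    also have "\<dots> = (\<integral>\<^sup>+z. indicator B z * u (w + e t *s z) \<partial>lborel)"
      by (intro nn_integral_cong) (auto simp: B_def indicator_def norm_vector_scalar_mult)
    finally show ?thesis .
  qed
  have sub: "ennreal ((cmod (G w))\<^sup>2) \<le> (\<integral>\<^sup>+t. indicator {0..1} t * u (w + e t *s z) \<partial>lborel)" if "z \<in> B" for z
  proof -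
    have "norm (\<zeta> *s z) < s" if "\<zeta> \<in> cball 0 1" for \<zeta>
      using that \<open>z \<in> B\<close> unfolding B_def norm_vector_scalar_mult
      by (smt (verit) mem_ball mem_cball dist_0_norm mult_left_le_one_le norm_ge_zero)
    then have "cball 0 1 \<subseteq> {\<zeta>. w + \<zeta> *s z \<in> S}"
      using S by (auto simp: dist_norm subset_iff)
    then have "(\<lambda>\<zeta>. G (w + \<zeta> *s z)) holomorphic_on cball 0 1"
      using G(1) unfolding holomorphic_on_lines_def by (blast intro: holomorphic_on_subset)
    from sub_mean_value_circle[OF this]
    have "ennreal ((cmod (G w))\<^sup>2) \<le> (\<integral>\<^sup>+t\<in>{0..1}. ennreal ((cmod (G (w + e t *s z)))\<^sup>2) \<partial>lborel)"
      by (simp add: e_def)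
    also have "\<dots> = (\<integral>\<^sup>+t. indicator {0..1} t * u (w + e t *s z) \<partial>lborel)"
      using BS[OF that] by (intro nn_integral_cong) (auto simp: u_def indicator_def)
    finally show ?thesis .
  qed
  have "ennreal ((cmod (G w))\<^sup>2) * emeasure lborel B = (\<integral>\<^sup>+z. indicator B z * ennreal ((cmod (G w))\<^sup>2) \<partial>lborel)"
    by (simp add: nn_integral_multc mult.commute)
  also have "\<dots> \<le> (\<integral>\<^sup>+z. indicator B z * (\<integral>\<^sup>+t. indicator {0..1} t * u (w + e t *s z) \<partial>lborel) \<partial>lborel)"
    using sub by (intro nn_integral_mono) (auto simp: indicator_def)
  also have "\<dots> = (\<integral>\<^sup>+z. \<integral>\<^sup>+t. indicator {0..1} t * (indicator B z * u (w + e t *s z)) \<partial>lborel \<partial>lborel)"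
    by (intro nn_integral_cong) (auto simp: indicator_def)
  also have "\<dots> = (\<integral>\<^sup>+t. \<integral>\<^sup>+z. indicator {0..1} t * (indicator B z * u (w + e t *s z)) \<partial>lborel \<partial>lborel)"
  proof (rule lborel_pair.Fubini')
    have [measurable]: "(\<lambda>p. u (w + e (fst p) *s (snd p))) \<in> borel_measurable (borel \<Otimes>\<^sub>M borel)"
    proof -
      have "(\<lambda>p. w + e (fst p) *s snd p) \<in> borel_measurable (borel \<Otimes>\<^sub>M borel)"
        using sm by (intro borel_measurable_add) (auto simp: case_prod_unfold)
      from measurable_compose[OF this um] show ?thesis .
    qed
    show "(\<lambda>(t, z). indicator {0..1} t * (indicator B z * u (w + e t *s z))) \<in> borel_measurable (lborel \<Otimes>\<^sub>M lborel)"
      unfolding case_prod_unfold by measurable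
  qed
  also have "\<dots> = (\<integral>\<^sup>+t. indicator {0..1::real} t * (\<integral>\<^sup>+z\<in>ball w s. ennreal ((cmod (G z))\<^sup>2) \<partial>lborel) \<partial>lborel)"
    by (intro nn_integral_cong) (simp add: I[symmetric] split: split_indicator)
  also have "\<dots> = (\<integral>\<^sup>+z\<in>ball w s. ennreal ((cmod (G z))\<^sup>2) \<partial>lborel)"
    by (simp add: nn_integral_multc)
  finally show ?thesis unfolding B_def .
qed

text \<open>By Cauchy's inequality the derivative of \<open>g\<close> is at most \<open>4 * S /
  R\<close> on the closed unit disc, as discs of radius \<open>R / 4\<close> around its points
  stay inside the large disc. Later \<open>R\<close> is the inverse of a small distance, and this
  lemma is what makes that distance appear as a factor.\<close>

lemma value_bound_of_zero_at_1:
  assumes g: "g holomorphic_on ball 0 R" "R \<ge> 2" and S: "\<And>\<zeta>. \<zeta> \<in> ball 0 R \<Longrightarrow> cmod (g \<zeta>) \<le> S" and "g 1 = 0"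
  shows "cmod (g 0) \<le> 4 * S / R"
proof -
  have S0: "0 \<le> S" using S[of 0] g(2) by (smt (verit) centre_in_ball norm_ge_zero)
  have d: "cmod (deriv g \<zeta>) \<le> 4 * S / R" if "\<zeta> \<in> cball 0 1" for \<zeta>
  proof -
    have sub: "cball \<zeta> (R/4) \<subseteq> ball 0 R"
    proof
      fix x assume "x \<in> cball \<zeta> (R/4)"
      then have "norm x \<le> norm \<zeta> + R/4" by (metis dist_norm mem_cball norm_minus_commute norm_triangle_sub order_trans add_left_mono)
      then show "x \<in> ball 0 R" using that g(2) by simp
    qed
    have "norm ((deriv ^^ 1) g \<zeta>) \<le> fact 1 * S / (R/4)^1"
    proof (rule Cauchy_inequality)
      show "g holomorphic_on ball \<zeta> (R/4)" using sub g(1) by (meson ball_subset_cball holomorphic_on_subset subset_trans)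
      show "continuous_on (cball \<zeta> (R/4)) g" using sub g(1) by (meson continuous_on_subset holomorphic_on_imp_continuous_on)
      show "0 < R/4" using g(2) by simp
      fix x assume "norm (\<zeta> - x) = R/4"
      then show "norm (g x) \<le> S" using sub by (intro S) (auto simp: dist_norm)
    qed
    then show ?thesis by (simp add: field_simps)
  qed
  have "norm (g 0 - g 1) \<le> (4 * S / R) * norm (0 - 1 :: complex)"
  proof (rule field_differentiable_bound[where S="cball 0 1" and f'="deriv g"])
    fix z :: complex assume z: "z \<in> cball 0 1"
    then have "z \<in> ball 0 R" using g(2) by auto
    then have "g field_differentiable at z" using g(1) holomorphic_on_imp_differentiable_at open_ball by blast
    then show "(g has_field_derivative deriv g z) (at z within cball 0 1)"
      using DERIV_deriv_iff_field_differentiable has_field_derivative_at_within by blast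
  qed (use d in auto)
  then show ?thesis using \<open>g 1 = 0\<close> by simp
qed

lemma scaleR_eq_vector_scalar_mult: "a *\<^sub>R z = complex_of_real a *s (z :: complex^'n)"
  by (simp add: vec_eq_iff) (simp add: scaleR_conv_of_real)

lemma has_derivative_vec_componentwise:
  fixes f :: "'b::real_normed_vector \<Rightarrow> complex^'n"
  assumes "\<And>i. ((\<lambda>x. f x $ i) has_derivative (\<lambda>v. f' v $ i)) (at x)"
  shows "(f has_derivative f') (at x)"
proof (subst has_derivative_componentwise_within, intro ballI)
  fix b :: "complex^'n" assume "b \<in> Basis"
  then obtain i u where b: "b = axis i u" by (auto simp: Basis_vec_def)
  show "((\<lambda>x. f x \<bullet> b) has_derivative (\<lambda>x. f' x \<bullet> b)) (at x)"
    unfolding b inner_axis by (intro has_derivative_inner_left assms)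
qed

lemma holo_on_imp_holomorphic_on_lines:
  assumes "holo_on f S" shows "holomorphic_on_lines f S"
  unfolding holomorphic_on_lines_def holomorphic_on_def
proof (intro allI ballI)
  fix w z :: "complex^'a" and \<zeta> assume "\<zeta> \<in> {\<zeta>. w + \<zeta> *s z \<in> S}"
  then obtain f' where f': "(f has_derivative f') (at (w + \<zeta> *s z))" "\<And>c v. f' (c *s v) = c * f' v"
    using assms unfolding holo_on_def by blast
  have "((\<lambda>\<zeta>. w + \<zeta> *s z) has_derivative (\<lambda>h. h *s z)) (at \<zeta>)"
    by (rule has_derivative_vec_componentwise) (auto intro!: derivative_eq_intros)
  from has_derivative_compose[OF this f'(1)]
  have "((\<lambda>\<zeta>. f (w + \<zeta> *s z)) has_derivative (\<lambda>h. f' z * h)) (at \<zeta>)"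
    by (simp add: f'(2) mult.commute)
  then have "((\<lambda>\<zeta>. f (w + \<zeta> *s z)) has_field_derivative f' z) (at \<zeta>)"
    by (simp add: has_field_derivative_def)
  then show "(\<lambda>\<zeta>. f (w + \<zeta> *s z)) field_differentiable at \<zeta> within {\<zeta>. w + \<zeta> *s z \<in> S}"
    using field_differentiable_at_within field_differentiable_def by blast
qed

lemma holo_on_imp_continuous_on: "holo_on f S \<Longrightarrow> continuous_on S f"
  unfolding holo_on_def
  by (meson continuous_at_imp_continuous_on has_derivative_continuous)

section \<open>Determinants of coercive matrices\<close>

lemma continuous_on_det:
  fixes A :: "'b::topological_space \<Rightarrow> real^'k^'k"
  assumes "\<And>i j. continuous_on S (\<lambda>x. A x $ i $ j)"
  shows "continuous_on S (\<lambda>x. det (A x))"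
  unfolding det_def by (intro assms continuous_on_sum continuous_on_mult continuous_on_const continuous_on_prod)

text \<open>The segment from the identity to \<open>A\<close> consists of coercive, hence
  invertible, matrices, so the determinant cannot change its sign along it.\<close>

lemma det_pos_of_coercive:
  fixes A :: "real^'k^'k"
  assumes A: "\<And>v. v \<noteq> 0 \<Longrightarrow> v \<bullet> (A *v v) > 0"
  shows "det A > 0"
proof (rule ccontr)
  assume neg: "\<not> det A > 0"
  define P where "P t = (1 - t) *\<^sub>R mat 1 + t *\<^sub>R A" for t :: real
  have ent: "P t $ i $ j = (1 - t) * (mat 1 :: real^'k^'k) $ i $ j + t * A $ i $ j" for t i j
    by (simp add: P_def)
  have "continuous_on {0..1} (\<lambda>t. det (P t))"
    by (intro continuous_on_det) (simp add: ent, intro continuous_intros)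
  moreover have "det (P 0) = 1" "det (P 1) = det A" by (simp_all add: P_def)
  ultimately obtain t where t: "0 \<le> t" "t \<le> 1" "det (P t) = 0"
    using IVT2'[of "\<lambda>t. det (P t)" 1 0 0] neg by auto
  then have "\<not> invertible (P t)" by (simp add: invertible_det_nz)
  then obtain v where v: "P t *v v = 0" "v \<noteq> 0"
    using matrix_left_invertible_ker[of "P t"] invertible_left_inverse by blast
  have "v \<bullet> (P t *v v) = (1 - t) * (v \<bullet> v) + t * (v \<bullet> (A *v v))"
    by (simp add: P_def matrix_vector_mult_add_rdistrib inner_add_right flip: scaleR_matrix_vector_assoc)
  moreover have "\<dots> > 0"
  proof (cases "t = 0")
    case False
    then have "t * (v \<bullet> (A *v v)) > 0" using A[OF v(2)] t by simp
    moreover have "(1 - t) * (v \<bullet> v) \<ge> 0" using t by simp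
    ultimately show ?thesis by linarith
  qed (use v in simp)
  ultimately show False using v by simp
qed

text \<open>The matrices in question form a compact set on which the determinant is positive. The
  minimum depends on \<open>m\<close> and \<open>L\<close> alone, which is what uniformity in the
  point requires.\<close>

lemma det_lower_bound_of_coercive:
  fixes m L :: real
  assumes m: "m > 0"
  obtains \<kappa> where "\<kappa> > 0" "\<And>A :: real^'k^'k. (\<And>i j. \<bar>A $ i $ j\<bar> \<le> L) \<Longrightarrow>
     (\<And>v. m * (norm v)\<^sup>2 \<le> v \<bullet> (A *v v)) \<Longrightarrow> \<kappa> \<le> det A"
proof -
  define K where "K = {A :: real^'k^'k. (\<forall>i j. \<bar>A $ i $ j\<bar> \<le> L) \<and> (\<forall>v. m * (norm v)\<^sup>2 \<le> v \<bullet> (A *v v))}"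
  have "bounded K" unfolding bounded_iff
  proof (intro exI ballI)
    fix A assume A: "A \<in> K"
    have "norm A \<le> (\<Sum>i\<in>UNIV. norm (A $ i))" unfolding norm_vec_def by (rule L2_set_le_sum) simp
    also have "\<dots> \<le> (\<Sum>i\<in>UNIV. \<Sum>j\<in>UNIV. \<bar>A $ i $ j\<bar>)"
      by (intro sum_mono) (simp add: norm_le_l1_cart)
    also have "\<dots> \<le> (\<Sum>i\<in>(UNIV::'k set). \<Sum>j\<in>(UNIV::'k set). L)"
      using A unfolding K_def by (intro sum_mono) auto
    finally show "norm A \<le> (\<Sum>i\<in>(UNIV::'k set). \<Sum>j\<in>(UNIV::'k set). L)" .
  qed
  moreover have "closed K" unfolding K_def matrix_vector_mult_def inner_vec_def
    by (intro closed_Collect_conj closed_Collect_all closed_Collect_le continuous_intros)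
  ultimately have K: "compact K" by (simp add: compact_eq_bounded_closed)
  show thesis
  proof (cases "K = {}")
    case True
    then show thesis by (intro that[of 1]) (auto simp: K_def)
  next
    case False
    have "continuous_on K det" by (intro continuous_on_det continuous_intros)
    from continuous_attains_inf[OF K False this] obtain A where A: "A \<in> K" "\<And>B. B \<in> K \<Longrightarrow> det A \<le> det B" by blast
    have "v \<bullet> (A *v v) > 0" if "v \<noteq> 0" for v
    proof -
      have "0 < m * (norm v)\<^sup>2" using m that by simp
      also have "\<dots> \<le> v \<bullet> (A *v v)" using A(1) unfolding K_def by blast
      finally show ?thesis .
    qed
    then have "det A > 0" by (rule det_pos_of_coercive)
    then show thesis using A(2) by (intro that[of "det A"]) (auto simp: K_def)
  qed
qed

lemma norm_real_frame: "norm (real_frame a) = 1"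
  by (cases a) (simp_all add: real_frame_def)

lemma real_frame_sum:
  fixes v :: "real^('n::finite + 'n)"
  shows "(\<Sum>a\<in>UNIV. v $ a *\<^sub>R real_frame a) = (\<chi> i. Complex (v $ Inl i) (v $ Inr i))"
proof -
  have "(\<Sum>a\<in>UNIV. v $ a *\<^sub>R (real_frame a :: complex^'n)) =
     (\<Sum>i\<in>UNIV. v $ Inl i *\<^sub>R axis i 1) + (\<Sum>i\<in>UNIV. v $ Inr i *\<^sub>R axis i \<i>)"
    unfolding UNIV_Plus_UNIV[symmetric] by (subst sum.Plus) (simp_all add: real_frame_def)
  also have "\<dots> = (\<chi> i. Complex (v $ Inl i) (v $ Inr i))"
    by (simp add: vec_eq_iff sum.distrib axis_def complex_eq_iff if_distrib[of "scaleR _"] if_distrib[of Re] if_distrib[of Im] sum.If_cases cong: if_cong)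
  finally show ?thesis .
qed

lemma norm_real_frame_sum:
  fixes v :: "real^('n::finite + 'n)"
  shows "norm (\<Sum>a\<in>UNIV. v $ a *\<^sub>R (real_frame a :: complex^'n)) = norm v"
proof -
  have "(norm (\<Sum>a\<in>UNIV. v $ a *\<^sub>R (real_frame a :: complex^'n)))\<^sup>2 = (\<Sum>i\<in>UNIV. (v $ Inl i)\<^sup>2 + (v $ Inr i)\<^sup>2)"
    unfolding real_frame_sum norm_vec_def L2_set_def by (simp add: sum_nonneg cmod_power2)
  also have "\<dots> = (\<Sum>a\<in>UNIV. (v $ a)\<^sup>2)"
    unfolding UNIV_Plus_UNIV[symmetric] by (subst sum.Plus) (simp_all add: sum.distrib)
  also have "\<dots> = (norm v)\<^sup>2" unfolding norm_vec_def L2_set_def by (simp add: sum_nonneg)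
  finally show ?thesis by simp
qed

section \<open>Weights\<close>

lemma lipschitz_of_partials_bound:
  fixes k :: "'b::euclidean_space \<Rightarrow> real" and B :: real
  assumes S: "convex S" "\<And>x. x \<in> S \<Longrightarrow> k differentiable (at x)"
    and B: "\<And>x b. x \<in> S \<Longrightarrow> b \<in> Basis \<Longrightarrow> \<bar>dir_deriv k x b\<bar> \<le> B" "0 \<le> B"
    and xy: "x \<in> S" "y \<in> S"
  shows "\<bar>k x - k y\<bar> \<le> B * DIM('b) * norm (x - y)"
proof -
  define k' where "k' x = frechet_derivative k (at x)" for x
  have k': "(k has_derivative k' x) (at x)" if "x \<in> S" for x
    unfolding k'_def using S(2)[OF that] frechet_derivative_works by blast
  have "norm (k x - k y) \<le> (B * DIM('b)) * norm (x - y)"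
  proof (rule differentiable_bound[OF S(1) _ _ xy])
    show "(k has_derivative k' x) (at x within S)" if "x \<in> S" for x
      using k'[OF that] has_derivative_at_withinI by blast
    show "onorm (k' x) \<le> B * DIM('b)" if x: "x \<in> S" for x
    proof (rule onorm_le)
      fix v
      have lin: "linear (k' x)" using k'[OF x] has_derivative_linear by blast
      have "k' x v = k' x (\<Sum>b\<in>Basis. (v \<bullet> b) *\<^sub>R b)" by (simp add: euclidean_representation)
      also have "\<dots> = (\<Sum>b\<in>Basis. (v \<bullet> b) * k' x b)"
        by (simp add: linear_sum[OF lin] linear_scale[OF lin])
      finally have "norm (k' x v) \<le> (\<Sum>b\<in>Basis. norm ((v \<bullet> b) * k' x b))" using norm_sum by metis
      also have "\<dots> \<le> (\<Sum>b\<in>(Basis::'b set). norm v * B)"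
        using B(1)[OF x] Basis_le_norm[of _ v] unfolding k'_def dir_deriv_def
        by (intro sum_mono) (simp add: abs_mult mult_mono)
      also have "\<dots> = B * DIM('b) * norm v" by simp
      finally show "norm (k' x v) \<le> B * DIM('b) * norm v" .
    qed
  qed
  then show ?thesis by simp
qed

text \<open>The mean value inequality used twice: for the first derivatives of \<open>f\<close>,
  and then for \<open>f\<close> minus its linearization at \<open>0\<close>.\<close>

lemma second_order_taylor_bound:
  fixes f :: "'b::euclidean_space \<Rightarrow> real" and B \<rho> :: real
  assumes f: "Ck_on 2 f S" and S: "convex S" "0 \<in> S" "z \<in> S" "\<And>x. x \<in> S \<Longrightarrow> norm x \<le> \<rho>" and "0 \<le> B"
    and B: "\<And>x u v. x \<in> S \<Longrightarrow> u \<in> Basis \<Longrightarrow> v \<in> Basis \<Longrightarrow> \<bar>dir_deriv (\<lambda>y. dir_deriv f y u) x v\<bar> \<le> B"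
  shows "\<bar>f z - f 0 - frechet_derivative f (at 0) z\<bar> \<le> B * (DIM('b) * \<rho>)\<^sup>2"
proof -
  have f1: "f differentiable (at x)" if "x \<in> S" for x
    using f that by (simp add: numeral_2_eq_2)
  have f2: "(\<lambda>y. dir_deriv f y u) differentiable (at x)" if "x \<in> S" for x u
    using f that by (simp add: numeral_2_eq_2 dir_deriv_def)
  define l where "l = frechet_derivative f (at 0)"
  have l: "(l has_derivative l) (at x)" for x
    using f1[OF S(2)] unfolding l_def
    by (metis frechet_derivative_works bounded_linear_imp_has_derivative has_derivative_bounded_linear)
  have rho: "0 \<le> \<rho>" using S(4)[OF S(2)] by simp
  have d1: "\<bar>dir_deriv f x u - dir_deriv f 0 u\<bar> \<le> B * DIM('b) * \<rho>" if "x \<in> S" "u \<in> Basis" for x u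
  proof -
    have "\<bar>dir_deriv f x u - dir_deriv f 0 u\<bar> \<le> B * DIM('b) * norm (x - 0)"
      using B[OF _ that(2)] f2 S that \<open>0 \<le> B\<close> by (intro lipschitz_of_partials_bound[of S]) auto
    also have "\<dots> \<le> B * DIM('b) * \<rho>" using S(4)[OF that(1)] \<open>0 \<le> B\<close> by (intro mult_left_mono) auto
    finally show ?thesis .
  qed
  have der: "((\<lambda>x. f x - l x) has_derivative (\<lambda>v. frechet_derivative f (at x) v - l v)) (at x)" if "x \<in> S" for x
    using f1[OF that] l by (intro has_derivative_diff) (auto simp: frechet_derivative_works)
  have "\<bar>(f z - l z) - (f 0 - l 0)\<bar> \<le> (B * DIM('b) * \<rho>) * DIM('b) * norm (z - 0)"
  proof (rule lipschitz_of_partials_bound[OF S(1)])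
    show "(\<lambda>x. f x - l x) differentiable (at x)" if "x \<in> S" for x
      using der[OF that] differentiableI by blast
    show "\<bar>dir_deriv (\<lambda>x. f x - l x) x b\<bar> \<le> B * DIM('b) * \<rho>" if "x \<in> S" "b \<in> Basis" for x b
    proof -
      have "dir_deriv (\<lambda>x. f x - l x) x b = frechet_derivative f (at x) b - l b"
        unfolding dir_deriv_def using frechet_derivative_at[OF der[OF that(1)]] by metis
      then show ?thesis using d1[OF that] by (simp add: dir_deriv_def l_def)
    qed
  qed (use S rho \<open>0 \<le> B\<close> in auto)
  also have "\<dots> \<le> (B * DIM('b) * \<rho>) * DIM('b) * \<rho>"
    using S rho \<open>0 \<le> B\<close> by (intro mult_left_mono) auto
  also have "l 0 = 0" using l[of 0] by (metis has_derivative_bounded_linear linear_simps(3))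
  ultimately show ?thesis unfolding l_def[symmetric] by (simp add: power2_eq_square algebra_simps)
qed

lemma holomorphic_on_lines_subset: "holomorphic_on_lines f S \<Longrightarrow> R \<subseteq> S \<Longrightarrow> holomorphic_on_lines f R"
  unfolding holomorphic_on_lines_def by (meson Collect_mono holomorphic_on_subset subsetD)

text \<open>For each \<open>\<sigma> \<alpha>\<close>, the function \<open>(cmod (\<sigma>
  \<alpha> z))\<^sup>2 - (cmod (\<sigma> \<alpha> 0))\<^sup>2\<close> is the real part of the
  holomorphic function \<open>2 * cnj (\<sigma> \<alpha> 0) * (\<sigma> \<alpha> z - \<sigma>
  \<alpha> 0)\<close> plus \<open>(cmod (\<sigma> \<alpha> z - \<sigma> \<alpha> 0))\<^sup>2 \<le>
  M2\<close>; so large values of \<open>\<sigma> \<alpha>\<close> do no harm, only its oscillation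
  matters. For \<open>\<Phi>d\<close>, the remainder with bounded second derivatives, the
  holomorphic function is the complex linear function whose real part is the linearization at
  \<open>0\<close>.\<close>

lemma regular_weight_approx_pluriharmonic:
  fixes \<Phi> :: "complex^'n \<Rightarrow> real" and M2 \<rho> :: real
  assumes reg: "regular_weight M2 N U \<Phi>" and U: "ball 0 \<rho> \<subseteq> U" and "0 \<le> M2" "0 < \<rho>"
  obtains H where "holomorphic_on_lines H (ball 0 \<rho>)" "continuous_on (ball 0 \<rho>) H" "H 0 = 0"
    "\<And>z. z \<in> ball 0 \<rho> \<Longrightarrow> \<bar>\<Phi> z - \<Phi> 0 - Re (H z)\<bar> \<le> real N * M2 + M2 * (DIM(complex^'n) * \<rho>)\<^sup>2"
proof -
  obtain \<sigma> \<Phi>d where \<Phi>: "\<And>z. z \<in> U \<Longrightarrow> \<Phi> z = (\<Sum>\<alpha>=1..N. (cmod (\<sigma> \<alpha> z))\<^sup>2) + \<Phi>d z"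
    and \<sigma>: "\<And>\<alpha>. \<alpha> \<in> {1..N} \<Longrightarrow> holo_on (\<sigma> \<alpha>) U"
      "\<And>\<alpha> x y. \<alpha> \<in> {1..N} \<Longrightarrow> x \<in> U \<Longrightarrow> y \<in> U \<Longrightarrow> (cmod (\<sigma> \<alpha> x - \<sigma> \<alpha> y))\<^sup>2 \<le> M2"
    and \<Phi>d: "Ck_on 2 \<Phi>d U"
      "\<And>x u v. x \<in> U \<Longrightarrow> u \<in> Basis \<Longrightarrow> v \<in> Basis \<Longrightarrow> \<bar>dir_deriv (\<lambda>y. dir_deriv \<Phi>d y u) x v\<bar> \<le> M2"
    using reg unfolding regular_weight_def by fast
  have U0: "0 \<in> U" using U \<open>0 < \<rho>\<close> by auto
  define l where "l = frechet_derivative \<Phi>d (at 0)"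
  have bl: "bounded_linear l"
    using \<Phi>d(1) U0 unfolding l_def by (auto simp: numeral_2_eq_2 frechet_derivative_works has_derivative_bounded_linear)
  then have lin: "linear l" by (rule bounded_linear.linear)
  define L where "L z = Complex (l z) (- l (\<i> *s z))" for z
  have L: "L (w + \<zeta> *s z) = L w + \<zeta> * L z" for w z \<zeta>
  proof -
    have 1: "\<zeta> *s z = Re \<zeta> *\<^sub>R z + Im \<zeta> *\<^sub>R (\<i> *s z)" for \<zeta> and z :: "complex^'n"
      by (simp add: vec_eq_iff complex_eq_iff)
    have 2: "\<i> *s (\<zeta> *s z) = Re \<zeta> *\<^sub>R (\<i> *s z) - Im \<zeta> *\<^sub>R z"
      by (simp add: vec_eq_iff complex_eq_iff)
    have 3: "\<i> *s (w + \<zeta> *s z) = \<i> *s w + \<i> *s (\<zeta> *s z)" by (simp add: vec_eq_iff algebra_simps)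
    show ?thesis unfolding L_def 3 2 unfolding 1[of \<zeta> z]
      by (simp add: linear_add[OF lin] linear_diff[OF lin] linear_scale[OF lin] complex_eq_iff algebra_simps)
  qed
  have cL: "continuous_on UNIV L"
  proof -
    have "continuous_on UNIV (\<lambda>z. l (\<i> *s z))"
      using bounded_linear_compose[OF bl linear_vector_scalar_mult[of \<i>, unfolded linear_conv_bounded_linear]]
      by (rule linear_continuous_on)
    moreover have "continuous_on UNIV l" using bl by (rule linear_continuous_on)
    ultimately show ?thesis unfolding L_def by (intro continuous_intros)
  qed
  define H where "H z = (\<Sum>\<alpha>=1..N. 2 * cnj (\<sigma> \<alpha> 0) * (\<sigma> \<alpha> z - \<sigma> \<alpha> 0)) + L z" for z
  show thesis
  proof
    have s: "holomorphic_on_lines (\<sigma> \<alpha>) (ball 0 \<rho>)" "continuous_on (ball 0 \<rho>) (\<sigma> \<alpha>)" if "\<alpha> \<in> {1..N}" for \<alpha>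
      using \<sigma>(1)[OF that] U holo_on_imp_holomorphic_on_lines holomorphic_on_lines_subset holo_on_imp_continuous_on continuous_on_subset
      by (blast, blast)
    show "holomorphic_on_lines H (ball 0 \<rho>)"
      using s(1) unfolding holomorphic_on_lines_def H_def L by (auto intro!: holomorphic_intros)
    show "continuous_on (ball 0 \<rho>) H" unfolding H_def
      using s(2) by (intro continuous_intros continuous_on_subset[OF cL]) auto
    have "l 0 = 0" using lin by (rule linear_0)
    moreover have "\<i> *s (0::complex^'n) = 0" by (simp add: vec_eq_iff)
    ultimately show "H 0 = 0" by (simp add: H_def L_def complex_eq_iff)
    fix z :: "complex^'n" assume z: "z \<in> ball 0 \<rho>"
    then have zU: "z \<in> U" using U by auto
    have sq: "(cmod a)\<^sup>2 - (cmod b)\<^sup>2 - Re (2 * cnj b * (a - b)) = (cmod (a - b))\<^sup>2" for a b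
      unfolding cmod_power2 by (simp add: power2_eq_square algebra_simps)
    have "\<Phi> z - \<Phi> 0 - Re (H z) = (\<Sum>\<alpha>=1..N. (cmod (\<sigma> \<alpha> z))\<^sup>2 - (cmod (\<sigma> \<alpha> 0))\<^sup>2 - Re (2 * cnj (\<sigma> \<alpha> 0) * (\<sigma> \<alpha> z - \<sigma> \<alpha> 0)))
        + (\<Phi>d z - \<Phi>d 0 - l z)"
      unfolding \<Phi>[OF zU] \<Phi>[OF U0] H_def L_def by (simp add: sum_subtractf)
    also have "\<dots> = (\<Sum>\<alpha>=1..N. (cmod (\<sigma> \<alpha> z - \<sigma> \<alpha> 0))\<^sup>2) + (\<Phi>d z - \<Phi>d 0 - l z)"
      unfolding sq ..
    finally have eq: "\<Phi> z - \<Phi> 0 - Re (H z) = (\<Sum>\<alpha>=1..N. (cmod (\<sigma> \<alpha> z - \<sigma> \<alpha> 0))\<^sup>2) + (\<Phi>d z - \<Phi>d 0 - l z)" .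
    have "0 \<le> (\<Sum>\<alpha>=1..N. (cmod (\<sigma> \<alpha> z - \<sigma> \<alpha> 0))\<^sup>2)" by (intro sum_nonneg) auto
    moreover have "(\<Sum>\<alpha>=1..N. (cmod (\<sigma> \<alpha> z - \<sigma> \<alpha> 0))\<^sup>2) \<le> (\<Sum>\<alpha>=1..N. M2)"
      using \<sigma>(2) zU U0 by (intro sum_mono) auto
    moreover have "\<bar>\<Phi>d z - \<Phi>d 0 - l z\<bar> \<le> M2 * (DIM(complex^'n) * \<rho>)\<^sup>2" unfolding l_def
    proof (rule second_order_taylor_bound[where S = "ball 0 \<rho>"])
      have mono: "Ck_on k f A \<Longrightarrow> B \<subseteq> A \<Longrightarrow> Ck_on k f B" for k A B and f :: "complex^'n \<Rightarrow> real"
        by (induction k arbitrary: f) (auto intro: continuous_on_subset)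
      show "Ck_on 2 \<Phi>d (ball 0 \<rho>)" using mono[OF \<Phi>d(1) U] .
    qed (use z U \<Phi>d(2) \<open>0 \<le> M2\<close> \<open>0 < \<rho>\<close> in auto)
    ultimately show "\<bar>\<Phi> z - \<Phi> 0 - Re (H z)\<bar> \<le> real N * M2 + M2 * (DIM(complex^'n) * \<rho>)\<^sup>2"
      unfolding eq by simp
  qed
qed

lemma regular_weight_continuous_on:
  assumes "regular_weight M2 N U \<Phi>" shows "continuous_on U \<Phi>"
proof -
  obtain \<sigma> \<Phi>d where \<Phi>: "\<forall>z\<in>U. \<Phi> z = (\<Sum>\<alpha>=1..N. (cmod (\<sigma> \<alpha> z))\<^sup>2) + \<Phi>d z"
    and \<sigma>: "\<forall>\<alpha>\<in>{1..N}. holo_on (\<sigma> \<alpha>) U" and \<Phi>d: "Ck_on 2 \<Phi>d U"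
    using assms unfolding regular_weight_def by blast
  have "continuous_on U \<Phi>d"
    using \<Phi>d by (auto simp: numeral_2_eq_2 intro!: continuous_at_imp_continuous_on differentiable_imp_continuous_within)
  then have "continuous_on U (\<lambda>z. (\<Sum>\<alpha>=1..N. (cmod (\<sigma> \<alpha> z))\<^sup>2) + \<Phi>d z)"
    using \<sigma> by (intro continuous_intros holo_on_imp_continuous_on) auto
  then show ?thesis by (rule continuous_on_eq) (use \<Phi> in simp)
qed

text \<open>By the previous approximation \<open>(cmod (F x))\<^sup>2 * exp (- \<Phi> x)\<close>
  is comparable to the squared modulus of the holomorphic function \<open>G = F * exp (- H /
  2)\<close>, with constants depending only on \<open>M2\<close>, \<open>N\<close> and
  \<open>\<rho>\<close>. The sub-mean value inequality bounds \<open>G\<close> on the ball of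
  radius \<open>\<rho> / 2\<close> by its integral norm. On the complex line through
  \<open>0\<close> and the zero \<open>z\<close>, parametrized so that \<open>z\<close>
  corresponds to \<open>1\<close>, this ball is a disc of radius \<open>\<rho> / (2 * norm
  z)\<close>, which yields the factor \<open>(norm z)\<^sup>2\<close>.\<close>

lemma weighted_value_bound_near_zero:
  fixes M2 \<rho> :: real and N :: nat
  assumes "0 \<le> M2" "0 < \<rho>"
  obtains K where "K > 0"
    "\<forall>\<Phi> F U (z::complex^'n). regular_weight M2 N U \<Phi> \<longrightarrow> ball 0 \<rho> \<subseteq> U \<longrightarrow> holo_on F (ball 0 \<rho>) \<longrightarrow>
       norm z \<le> \<rho> / 4 \<longrightarrow> F z = 0 \<longrightarrow>
       ennreal ((cmod (F 0))\<^sup>2 * exp (- \<Phi> 0)) \<le>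
         ennreal (K * (norm z)\<^sup>2) * (\<integral>\<^sup>+x\<in>ball 0 \<rho>. ennreal ((cmod (F x))\<^sup>2 * exp (- \<Phi> x)) \<partial>lborel)"
proof -
  define C where "C = real N * M2 + M2 * (DIM(complex^'n) * \<rho>)\<^sup>2"
  define V where "V = measure lborel (ball (0::complex^'n) (\<rho>/2))"
  have V: "V > 0" "emeasure lborel (ball (0::complex^'n) (\<rho>/2)) = ennreal V"
    using assms emeasure_lborel_ball_finite[of "0::complex^'n" "\<rho>/2"]
    by (simp add: V_def content_ball_pos, unfold V_def, intro emeasure_eq_ennreal_measure) auto
  \<comment> \<open>The factor \<open>64\<close> is \<open>(4 * 2)\<^sup>2\<close>: the bound at
    \<open>0\<close> is \<open>4 * S / R\<close> with \<open>R = \<rho> / (2 * norm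
    z)\<close>.\<close>
  define K where "K = 64 * exp C / (\<rho>\<^sup>2 * V)"
  show thesis
  proof
    show K0: "K > 0" unfolding K_def using V assms by simp
    show "\<forall>\<Phi> F U (z::complex^'n). regular_weight M2 N U \<Phi> \<longrightarrow> ball 0 \<rho> \<subseteq> U \<longrightarrow> holo_on F (ball 0 \<rho>) \<longrightarrow>
       norm z \<le> \<rho> / 4 \<longrightarrow> F z = 0 \<longrightarrow>
       ennreal ((cmod (F 0))\<^sup>2 * exp (- \<Phi> 0)) \<le>
         ennreal (K * (norm z)\<^sup>2) * (\<integral>\<^sup>+x\<in>ball 0 \<rho>. ennreal ((cmod (F x))\<^sup>2 * exp (- \<Phi> x)) \<partial>lborel)"
    proof (intro allI impI)
    fix \<Phi> :: "complex^'n \<Rightarrow> real" and F :: "complex^'n \<Rightarrow> complex" and U and z :: "complex^'n"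
    assume reg: "regular_weight M2 N U \<Phi>" "ball 0 \<rho> \<subseteq> U" and F: "holo_on F (ball 0 \<rho>)"
      and z: "norm z \<le> \<rho> / 4" "F z = 0"
    obtain H where H: "holomorphic_on_lines H (ball 0 \<rho>)" "continuous_on (ball 0 \<rho>) H" "H 0 = 0"
      "\<And>x. x \<in> ball 0 \<rho> \<Longrightarrow> \<bar>\<Phi> x - \<Phi> 0 - Re (H x)\<bar> \<le> C"
      using regular_weight_approx_pluriharmonic[OF reg assms] unfolding C_def by blast
    define G where "G x = F x * exp (- (H x) / 2)" for x
    have Gh: "holomorphic_on_lines G (ball 0 \<rho>)"
      using holo_on_imp_holomorphic_on_lines[OF F] H(1) unfolding G_def holomorphic_on_lines_def
      by (auto intro!: holomorphic_intros)
    have Gc: "continuous_on (ball 0 \<rho>) G"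
      unfolding G_def by (intro continuous_intros holo_on_imp_continuous_on[OF F] H(2)) auto
    have G2: "(cmod (G x))\<^sup>2 = (cmod (F x))\<^sup>2 * exp (- Re (H x))" for x
    proof -
      have "(cmod (exp (- (H x) / 2)))\<^sup>2 = exp (- Re (H x))"
        by (simp add: norm_exp_eq_Re power2_eq_square flip: exp_add)
      then show ?thesis unfolding G_def by (simp add: norm_mult power_mult_distrib)
    qed
    have G2le: "(cmod (G x))\<^sup>2 \<le> exp (C + \<Phi> 0) * ((cmod (F x))\<^sup>2 * exp (- \<Phi> x))" if "x \<in> ball 0 \<rho>" for x
    proof -
      have "- Re (H x) \<le> (C + \<Phi> 0) + - \<Phi> x" using H(4)[OF that] by linarith
      then have "exp (- Re (H x)) \<le> exp (C + \<Phi> 0) * exp (- \<Phi> x)" by (simp flip: exp_add)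
      then have "(cmod (F x))\<^sup>2 * exp (- Re (H x)) \<le> (cmod (F x))\<^sup>2 * (exp (C + \<Phi> 0) * exp (- \<Phi> x))"
        by (rule mult_left_mono) simp
      then show ?thesis unfolding G2 by (simp only: mult.left_commute)
    qed
    define I where "I = (\<integral>\<^sup>+x\<in>ball 0 \<rho>. ennreal ((cmod (F x))\<^sup>2 * exp (- \<Phi> x)) \<partial>lborel)"
    have Im: "(\<lambda>x. ennreal ((cmod (F x))\<^sup>2 * exp (- \<Phi> x)) * indicator (ball 0 \<rho>) x) \<in> borel_measurable borel"
    proof -
      have "continuous_on (ball 0 \<rho>) (\<lambda>x. (cmod (F x))\<^sup>2 * exp (- \<Phi> x))"
        by (intro continuous_intros holo_on_imp_continuous_on[OF F] continuous_on_subset[OF regular_weight_continuous_on[OF reg(1)] reg(2)])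
      then have "(\<lambda>x. indicator (ball 0 \<rho>) x *\<^sub>R ((cmod (F x))\<^sup>2 * exp (- \<Phi> x))) \<in> borel_measurable borel"
        by (intro borel_measurable_continuous_on_indicator) auto
      then have "(\<lambda>x. ennreal (indicator (ball 0 \<rho>) x *\<^sub>R ((cmod (F x))\<^sup>2 * exp (- \<Phi> x)))) \<in> borel_measurable borel"
        by (rule measurable_compose[OF _ measurable_ennreal])
      moreover have "ennreal (indicator (ball 0 \<rho>) x *\<^sub>R ((cmod (F x))\<^sup>2 * exp (- \<Phi> x))) =
          ennreal ((cmod (F x))\<^sup>2 * exp (- \<Phi> x)) * indicator (ball 0 \<rho>) x" for x
        by (simp add: indicator_def)
      ultimately show ?thesis by (simp only:)
    qed
    have "ennreal ((cmod (F 0))\<^sup>2 * exp (- \<Phi> 0)) \<le> ennreal (K * (norm z)\<^sup>2) * I"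
    proof (cases "z = 0")
      case True
      then show ?thesis using z by simp
    next
      case z0: False
      show ?thesis
      proof (cases I)
        case top
        then show ?thesis using K0 z0 by (simp add: ennreal_mult_top)
      next
        case (real J)
        define S where "S = sqrt (exp (C + \<Phi> 0) * J / V)"
        have GS: "cmod (G w) \<le> S" if w: "norm w < \<rho> / 2" for w
        proof -
          have sub: "ball w (\<rho>/2) \<subseteq> ball 0 \<rho>"
          proof
            fix x assume "x \<in> ball w (\<rho>/2)"
            then have "norm (x - w) < \<rho>/2" by (simp add: dist_norm norm_minus_commute)
            then have "norm x < \<rho>" using w norm_triangle_ineq[of "x - w" w] by simp
            then show "x \<in> ball 0 \<rho>" by simp
          qed
          have "ennreal ((cmod (G w))\<^sup>2) * ennreal V \<le> (\<integral>\<^sup>+x\<in>ball w (\<rho>/2). ennreal ((cmod (G x))\<^sup>2) \<partial>lborel)"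
            using sub_mean_value_ball[OF Gh Gc open_ball sub] V by simp
          also have "\<dots> \<le> (\<integral>\<^sup>+x. ennreal (exp (C + \<Phi> 0)) * (ennreal ((cmod (F x))\<^sup>2 * exp (- \<Phi> x)) * indicator (ball 0 \<rho>) x) \<partial>lborel)"
            using G2le sub
            by (intro nn_integral_mono) (auto simp: indicator_def simp flip: ennreal_mult intro!: ennreal_leI)
          also have "\<dots> = ennreal (exp (C + \<Phi> 0)) * I" unfolding I_def
            by (rule nn_integral_cmult) (use Im in simp)
          finally have "(cmod (G w))\<^sup>2 * V \<le> exp (C + \<Phi> 0) * J"
            using real V by (simp add: ennreal_mult[symmetric] ennreal_le_iff)
          then show ?thesis unfolding S_def using V by (intro real_le_rsqrt) (simp add: pos_le_divide_eq)
        qed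
        \<comment> \<open>\<open>R\<close> is the radius, in the parameter of the line through
          \<open>0\<close> and \<open>z\<close>, of the ball on which \<open>G\<close> is bounded
          by \<open>S\<close>.\<close>
        define R where "R = \<rho> / (2 * norm z)"
        have R: "R \<ge> 2" "R * norm z = \<rho> / 2" unfolding R_def using z0 z by (auto simp: field_simps)
        have in_half: "norm (\<zeta> *s z) < \<rho> / 2" if "\<zeta> \<in> ball 0 R" for \<zeta>
        proof -
          have "cmod \<zeta> * norm z < R * norm z" using that z0 by (intro mult_strict_right_mono) auto
          then show ?thesis unfolding norm_vector_scalar_mult R(2) .
        qed
        have "cmod (G (0 *s z)) \<le> 4 * S / R"
        proof (rule value_bound_of_zero_at_1[OF _ R(1)])
          have "(\<lambda>\<zeta>. G (0 + \<zeta> *s z)) holomorphic_on {\<zeta>. 0 + \<zeta> *s z \<in> ball 0 \<rho>}"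
            using Gh unfolding holomorphic_on_lines_def by blast
          moreover have "ball 0 R \<subseteq> {\<zeta>. 0 + \<zeta> *s z \<in> ball 0 \<rho>}"
            using in_half assms by fastforce
          ultimately show "(\<lambda>\<zeta>. G (\<zeta> *s z)) holomorphic_on ball 0 R"
            using holomorphic_on_subset by fastforce
          show "cmod (G (\<zeta> *s z)) \<le> S" if "\<zeta> \<in> ball 0 R" for \<zeta> using GS[OF in_half[OF that]] .
          show "G (1 *s z) = 0" using z by (simp add: G_def)
        qed
        then have "(cmod (G 0))\<^sup>2 \<le> (4 * S / R)\<^sup>2" by (intro power_mono) auto
        also have "\<dots> = 16 * S\<^sup>2 / R\<^sup>2" by (simp add: power_divide power_mult_distrib)
        also have "S\<^sup>2 = exp (C + \<Phi> 0) * J / V" unfolding S_def using real V by simp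
        also have "16 * (exp (C + \<Phi> 0) * J / V) / R\<^sup>2 = exp (\<Phi> 0) * (K * (norm z)\<^sup>2 * J)"
          unfolding R_def K_def exp_add using z0 V assms by (simp add: field_simps power2_eq_square)
        finally have "(cmod (F 0))\<^sup>2 * exp (- \<Phi> 0) \<le> exp (\<Phi> 0) * (K * (norm z)\<^sup>2 * J) * exp (- \<Phi> 0)"
          unfolding G2 H(3) by (intro mult_right_mono) auto
        also have "\<dots> = K * (norm z)\<^sup>2 * J" by (simp add: exp_minus)
        finally show ?thesis using real K0 by (simp add: ennreal_leI flip: ennreal_mult)
      qed
    qed
    then show "ennreal ((cmod (F 0))\<^sup>2 * exp (- \<Phi> 0)) \<le>
         ennreal (K * (norm z)\<^sup>2) * (\<integral>\<^sup>+x\<in>ball 0 \<rho>. ennreal ((cmod (F x))\<^sup>2 * exp (- \<Phi> x)) \<partial>lborel)"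
      unfolding I_def .
    qed
  qed
qed

section \<open>Charts, metric and speed of curves\<close>

locale kaehler_manifold =
  fixes M :: "('a::{t2_space,second_countable_topology}, 'n::finite) chart set"
    and \<omega> :: "('a, 'n) form2"
  assumes complex_structure: "complex_structure M"
    and kaehler_form: "kaehler_form M \<omega>"
begin

lemma chart_at: obtains c where "c \<in> M" "p \<in> fst c"
  using complex_structure unfolding complex_structure_def by blast

context
  fixes c assumes c: "c \<in> M"
begin

lemma is_chart: "is_chart c"
  using c complex_structure unfolding complex_structure_def by blast

lemma open_chart_dom: "open (fst c)" and open_chart_img: "open (chart_img c)"
  and continuous_on_chart: "continuous_on (fst c) (snd c)"
  and continuous_on_chart_inv: "continuous_on (chart_img c) (chart_inv c)"
  using is_chart unfolding is_chart_def homeomorphism_def by auto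

lemma chart_inv_chart: "p \<in> fst c \<Longrightarrow> chart_inv c (snd c p) = p"
  using is_chart unfolding is_chart_def homeomorphism_def by auto

lemma chart_in_img: "p \<in> fst c \<Longrightarrow> snd c p \<in> chart_img c"
  unfolding chart_img_def by auto

lemma chart_chart_inv: "z \<in> chart_img c \<Longrightarrow> snd c (chart_inv c z) = z"
  using is_chart unfolding is_chart_def homeomorphism_def by auto

lemma chart_inv_in_dom: "z \<in> chart_img c \<Longrightarrow> chart_inv c z \<in> fst c"
  using is_chart unfolding is_chart_def homeomorphism_def by auto

lemma chart_image_Int: "snd c ` (fst c \<inter> W) = chart_img c \<inter> chart_inv c -` W"
  using chart_inv_chart chart_in_img chart_chart_inv chart_inv_in_dom
  by (auto simp: image_iff) (metis IntI)

lemma open_chart_image: "open W \<Longrightarrow> open (snd c ` (fst c \<inter> W))"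
  unfolding chart_image_Int
  using continuous_open_preimage[OF continuous_on_chart_inv open_chart_img] by blast

lemma open_chart_inv_image: "open B \<Longrightarrow> B \<subseteq> chart_img c \<Longrightarrow> open (chart_inv c ` B)"
proof -
  assume B: "open B" "B \<subseteq> chart_img c"
  have "chart_inv c ` B = fst c \<inter> snd c -` B"
    using B chart_inv_chart chart_in_img chart_chart_inv chart_inv_in_dom
    by (auto simp: image_iff subset_iff) metis+
  then show ?thesis using continuous_open_preimage[OF continuous_on_chart open_chart_dom B(1)] by simp
qed

lemma bilinear_form: "x \<in> chart_img c \<Longrightarrow> bilinear (\<omega> c x)"
  using kaehler_form c unfolding kaehler_form_def by blast

lemma bilinear_metric: assumes "x \<in> chart_img c" shows "bilinear (metric \<omega> c x)"
proof -
  have b: "bilinear (\<omega> c x)" by (rule bilinear_form[OF assms])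
  have i: "linear (\<lambda>v. \<i> *s v :: complex^'n)" by (rule linear_vector_scalar_mult)
  show ?thesis
    unfolding bilinear_def metric_def
    using b linear_compose[OF i] unfolding bilinear_def by (auto simp: o_def)
qed

text \<open>The metric is symmetric because \<open>\<omega>\<close> is alternating and invariant
  under multiplication by \<open>\<i>\<close>.\<close>

lemma metric_sym: assumes "x \<in> chart_img c" shows "metric \<omega> c x u v = metric \<omega> c x v u"
proof -
  have b: "bilinear (\<omega> c x)" by (rule bilinear_form[OF assms])
  have J: "\<omega> c x (\<i> *s u) (\<i> *s (\<i> *s v)) = \<omega> c x u (\<i> *s v)"
    and a: "\<omega> c x (\<i> *s u) v = - \<omega> c x v (\<i> *s u)"
    using kaehler_form c assms unfolding kaehler_form_def by blast+
  have "\<i> *s (\<i> *s v) = - v" by (simp add: vec_eq_iff flip: mult.assoc)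
  then show ?thesis
    using J a bilinear_rneg[OF b] unfolding metric_def by simp
qed

lemma metric_pos: "x \<in> chart_img c \<Longrightarrow> u \<noteq> 0 \<Longrightarrow> metric \<omega> c x u u > 0"
  using kaehler_form c unfolding kaehler_form_def metric_def by blast

lemma metric_nonneg: "x \<in> chart_img c \<Longrightarrow> metric \<omega> c x u u \<ge> 0"
  using metric_pos[of x u] bilinear_rzero[OF bilinear_metric, of x u] by (cases "u = 0") (auto simp: less_imp_le)

lemma tnorm_nonneg: "x \<in> chart_img c \<Longrightarrow> tnorm \<omega> c x u \<ge> 0"
  unfolding tnorm_def using metric_nonneg by simp

lemma tnorm_scaleR: assumes "x \<in> chart_img c" shows "tnorm \<omega> c x (a *\<^sub>R u) = \<bar>a\<bar> * tnorm \<omega> c x u"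
proof -
  have "metric \<omega> c x (a *\<^sub>R u) (a *\<^sub>R u) = a\<^sup>2 * metric \<omega> c x u u"
    using bilinear_metric[OF assms] by (simp add: bilinear_lmul bilinear_rmul power2_eq_square)
  then show ?thesis unfolding tnorm_def by (simp add: real_sqrt_mult)
qed

lemma continuous_on_form: "continuous_on (chart_img c) (\<lambda>x. \<omega> c x u v)"
proof -
  have "smooth_on (\<lambda>x. \<omega> c x u v) (chart_img c)"
    using kaehler_form c unfolding kaehler_form_def by blast
  then have "Ck_on 0 (\<lambda>x. \<omega> c x u v) (chart_img c)" unfolding smooth_on_def by blast
  then show ?thesis by simp
qed

lemma continuous_on_metric: "continuous_on (chart_img c) (\<lambda>x. metric \<omega> c x u v)"
  unfolding metric_def by (rule continuous_on_form)

lemma continuous_on_tnorm: "continuous_on (chart_img c) (\<lambda>x. tnorm \<omega> c x v)"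
  unfolding tnorm_def by (intro continuous_intros continuous_on_metric)

lemma metric_expand:
  assumes "x \<in> chart_img c"
  shows "metric \<omega> c x u v = (\<Sum>a\<in>Basis. \<Sum>b\<in>Basis. (u \<bullet> a) * (v \<bullet> b) * metric \<omega> c x a b)"
proof -
  note b = bilinear_metric[OF assms]
  have "metric \<omega> c x u v = metric \<omega> c x (\<Sum>a\<in>Basis. (u \<bullet> a) *\<^sub>R a) (\<Sum>b\<in>Basis. (v \<bullet> b) *\<^sub>R b)"
    by (simp add: euclidean_representation)
  also have "\<dots> = (\<Sum>(a,b)\<in>Basis \<times> Basis. metric \<omega> c x ((u \<bullet> a) *\<^sub>R a) ((v \<bullet> b) *\<^sub>R b))"
    by (simp add: bilinear_sum[OF b])
  also have "\<dots> = (\<Sum>a\<in>Basis. \<Sum>b\<in>Basis. (u \<bullet> a) * (v \<bullet> b) * metric \<omega> c x a b)"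
    by (simp add: sum.cartesian_product bilinear_lmul[OF b] bilinear_rmul[OF b] mult_ac)
  finally show ?thesis .
qed

lemma continuous_on_metric_joint:
  "continuous_on (chart_img c \<times> UNIV) (\<lambda>(x, v). metric \<omega> c x v v)"
proof -
  have "continuous_on (chart_img c \<times> (UNIV :: (complex^'n) set))
     (\<lambda>p. \<Sum>a\<in>Basis. \<Sum>b\<in>Basis. (snd p \<bullet> a) * (snd p \<bullet> b) * metric \<omega> c (fst p) a b)"
    by (intro continuous_intros continuous_on_compose2[OF continuous_on_metric]) auto
  then show ?thesis
    by (rule continuous_on_eq) (auto simp: metric_expand[symmetric])
qed

text \<open>Compactness of a small closed ball times the unit sphere. This comparison with the
  flat metric near an arbitrary point is what turns convergence in the geodesic distance into
  convergence in the topology of the manifold.\<close>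

lemma local_lower_bound:
  assumes y: "y \<in> chart_img c"
  obtains \<delta> m where "\<delta> > 0" "m > 0" "ball y \<delta> \<subseteq> chart_img c"
    "\<And>z v. z \<in> ball y \<delta> \<Longrightarrow> m * norm v \<le> tnorm \<omega> c z v"
proof -
  obtain \<delta> where \<delta>: "\<delta> > 0" "cball y \<delta> \<subseteq> chart_img c"
    using open_chart_img y open_contains_cball by blast
  define K where "K = cball y \<delta> \<times> sphere (0::complex^'n) 1"
  have "compact K" unfolding K_def by (intro compact_Times) auto
  obtain b :: "complex^'n" where "b \<in> Basis" using nonempty_Basis by blast
  then have "(y, b) \<in> K" unfolding K_def using \<delta> by simp
  then have "K \<noteq> {}" by blast
  have "continuous_on K (\<lambda>(x, v). metric \<omega> c x v v)"
    by (rule continuous_on_subset[OF continuous_on_metric_joint]) (use \<delta> in \<open>auto simp: K_def\<close>)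
  from continuous_attains_inf[OF \<open>compact K\<close> \<open>K \<noteq> {}\<close> this]
  obtain x0 v0 where x0: "(x0, v0) \<in> K" "\<And>x v. (x, v) \<in> K \<Longrightarrow> metric \<omega> c x0 v0 v0 \<le> metric \<omega> c x v v"
    by fastforce
  define m where "m = sqrt (metric \<omega> c x0 v0 v0)"
  have "m > 0" unfolding m_def using x0(1) \<delta>(2) metric_pos[of x0 v0] by (force simp: K_def)
  show thesis
  proof
    show "\<delta> > 0" "m > 0" "ball y \<delta> \<subseteq> chart_img c" using \<delta> \<open>m > 0\<close> by (auto simp: subset_iff)
    fix z v assume z: "z \<in> ball y \<delta>"
    then have zi: "z \<in> chart_img c" using \<delta> by auto
    show "m * norm v \<le> tnorm \<omega> c z v"
    proof (cases "v = 0")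
      case True
      then show ?thesis using tnorm_nonneg[OF zi] by simp
    next
      case False
      then have "m \<le> tnorm \<omega> c z ((1 / norm v) *\<^sub>R v)"
        unfolding m_def tnorm_def using z x0(2) by (auto simp: K_def)
      then show ?thesis using False by (simp add: tnorm_scaleR[OF zi] field_simps)
    qed
  qed
qed

end

text \<open>The derivative \<open>A\<close> of a change of charts commutes with
  \<open>\<i>\<close>, so it transforms not only \<open>\<omega>\<close> but also the
  metric.\<close>

lemma transition_derivative:
  assumes c: "c \<in> M" and d: "d \<in> M" and p: "p \<in> fst c" "p \<in> fst d"
  obtains A where "((\<lambda>x. snd d (chart_inv c x)) has_derivative A) (at (snd c p))"
    "\<And>k v. A (k *s v) = k *s A v"
    "\<And>u v. \<omega> c (snd c p) u v = \<omega> d (snd d p) (A u) (A v)"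
proof -
  have "holo_transition c d" using c d complex_structure unfolding complex_structure_def by blast
  then have "\<forall>i. \<exists>f'. ((\<lambda>x. snd d (chart_inv c x) $ i) has_derivative f') (at (snd c p)) \<and> (\<forall>k v. f' (k *s v) = k * f' v)"
    unfolding holo_transition_def holo_on_def using p by blast
  then obtain F where F: "\<And>i. ((\<lambda>x. snd d (chart_inv c x) $ i) has_derivative F i) (at (snd c p))"
     "\<And>i k v. F i (k *s v) = k * F i v" by metis
  define A where "A v = (\<chi> i. F i v)" for v
  have A: "((\<lambda>x. snd d (chart_inv c x)) has_derivative A) (at (snd c p))"
    by (rule has_derivative_vec_componentwise) (simp add: A_def F)
  have A2: "\<And>k v. A (k *s v) = k *s A v" by (simp add: A_def F vec_eq_iff)
  have "dir_deriv (\<lambda>x. snd d (chart_inv c x)) (snd c p) = A"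
    using frechet_derivative_at[OF A] by (simp add: dir_deriv_def fun_eq_iff)
  moreover
  have *: "\<forall>c\<in>M. \<forall>d\<in>M. \<forall>p \<in> fst c \<inter> fst d. \<forall>u v. \<omega> c (snd c p) u v =
        (let A = dir_deriv (\<lambda>x. snd d (chart_inv c x)) (snd c p) in \<omega> d (snd d p) (A u) (A v))"
    using kaehler_form unfolding kaehler_form_def by (elim conjE)
  ultimately have "\<omega> c (snd c p) u v = \<omega> d (snd d p) (A u) (A v)" for u v
    using *[rule_format, OF c d, of p u v] p by (simp add: Let_def)
  with A A2 show thesis by (rule that)
qed

lemma path_eventually_in:
  assumes "path \<gamma>" "t \<in> {0<..<1}" "open W" "\<gamma> t \<in> W"
  shows "eventually (\<lambda>s. \<gamma> s \<in> W) (nhds t)"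
proof -
  have "continuous_on {0<..<1} \<gamma>" using assms(1) unfolding path_def by (rule continuous_on_subset) auto
  then have "open ({0<..<1} \<inter> \<gamma> -` W)"
    using assms(3) by (intro continuous_open_preimage) auto
  then show ?thesis using assms by (auto simp: eventually_nhds)
qed

text \<open>The definition of the speed picks an unspecified chart at each time; by the
  transformation rule any chart gives the same value.\<close>

lemma speed_in_chart:
  assumes c: "c \<in> M" and \<gamma>: "path \<gamma>" and t: "t \<in> {0<..<1}" "\<gamma> t \<in> fst c"
    and D: "((snd c \<circ> \<gamma>) has_vector_derivative D) (at t)"
  shows "speed M \<omega> \<gamma> t = tnorm \<omega> c (snd c (\<gamma> t)) D"
proof -
  define d where "d = (SOME d. d \<in> M \<and> \<gamma> t \<in> fst d)"
  have "\<exists>d. d \<in> M \<and> \<gamma> t \<in> fst d" using chart_at by metis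
  from someI_ex[OF this] have d: "d \<in> M" "\<gamma> t \<in> fst d" unfolding d_def by auto
  obtain A where A: "((\<lambda>x. snd d (chart_inv c x)) has_derivative A) (at (snd c (\<gamma> t)))"
    "\<And>k v. A (k *s v) = k *s A v"
    "\<And>u v. \<omega> c (snd c (\<gamma> t)) u v = \<omega> d (snd d (\<gamma> t)) (A u) (A v)"
    using transition_derivative[OF c d(1) t(2) d(2)] by metis
  have "((\<lambda>x. snd d (chart_inv c ((snd c \<circ> \<gamma>) x))) has_derivative (\<lambda>h. A (h *\<^sub>R D))) (at t)"
    using has_derivative_compose[OF D[unfolded has_vector_derivative_def], of "\<lambda>x. snd d (chart_inv c x)" A] A(1) by simp
  moreover have "A (h *\<^sub>R D) = h *\<^sub>R A D" for h
    using A(2) by (simp add: scaleR_eq_vector_scalar_mult)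
  ultimately have "((\<lambda>x. snd d (chart_inv c ((snd c \<circ> \<gamma>) x))) has_vector_derivative A D) (at t)"
    by (simp add: has_vector_derivative_def)
  moreover have "eventually (\<lambda>s. snd d (chart_inv c ((snd c \<circ> \<gamma>) s)) = (snd d \<circ> \<gamma>) s) (nhds t)"
    using path_eventually_in[OF \<gamma> t(1) open_chart_dom[OF c] t(2)]
    by eventually_elim (simp add: chart_inv_chart[OF c])
  ultimately have "((snd d \<circ> \<gamma>) has_vector_derivative A D) (at t)"
    by (subst (asm) has_vector_derivative_cong_ev[OF eventually_mono]) (auto dest: eventually_nhds_x_imp_x)
  then have "vector_derivative (snd d \<circ> \<gamma>) (at t) = A D" by (rule vector_derivative_at)
  then show ?thesis
    unfolding speed_def Let_def d_def[symmetric] tnorm_def metric_def by (simp add: A(3) A(2))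
qed

section \<open>Comparison of geodesic and coordinate distance\<close>

text \<open>Length of a curve that is a straight segment in a chart. The end points of
  \<open>\<gamma>\<close> are only constrained by continuity: in the completeness argument the
  final point is a limit which is not yet known to lie in the chart. Seen in another chart the
  segment is still continuously differentiable, because a holomorphic transition function
  restricted to a complex line has a holomorphic, hence continuous, derivative.\<close>

lemma geodist_line_le:
  assumes c: "c \<in> M" and \<gamma>: "path \<gamma>"
    and ln: "\<And>t. t \<in> {0<..<1} \<Longrightarrow> z0 + t *\<^sub>R w \<in> chart_img c"
            "\<And>t. t \<in> {0<..<1} \<Longrightarrow> \<gamma> t = chart_inv c (z0 + t *\<^sub>R w)"
    and B: "\<And>t. t \<in> {0<..<1} \<Longrightarrow> tnorm \<omega> c (z0 + t *\<^sub>R w) w \<le> B"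
  shows "geodist M \<omega> (\<gamma> 0) (\<gamma> 1) \<le> ennreal B"
proof -
  have C1: "(snd d \<circ> \<gamma>) C1_differentiable_on ({t \<in> {0..1}. \<gamma> t \<in> fst d} - {0,1})" if d: "d \<in> M" for d
  proof -
    define S where "S = {t \<in> {0..1}. \<gamma> t \<in> fst d} - {0,1}"
    define Q where "Q = {\<zeta>. z0 + \<zeta> *s w \<in> snd c ` (fst c \<inter> fst d)}"
    define g where "g i \<zeta> = snd d (chart_inv c (z0 + \<zeta> *s w)) $ i" for i \<zeta>
    have "holo_transition c d" using c d complex_structure unfolding complex_structure_def by blast
    then have hol: "g i holomorphic_on Q" for i
      using holo_on_imp_holomorphic_on_lines unfolding holo_transition_def holomorphic_on_lines_def Q_def g_def by blast
    have cont: "continuous_on UNIV (\<lambda>\<zeta>. z0 + \<zeta> *s w)"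
      unfolding vector_scalar_mult_def by (intro continuous_intros)
    have Q: "open Q"
      using open_vimage[OF open_chart_image[OF c open_chart_dom[OF d]] cont]
      unfolding Q_def vimage_def .
    have SQ: "t \<in> {0<..<1}" "of_real t \<in> Q" if "t \<in> S" for t
    proof -
      show t: "t \<in> {0<..<1}" using that unfolding S_def by auto
      show "of_real t \<in> Q"
        using that ln[OF t] chart_chart_inv[OF c] chart_inv_in_dom[OF c] unfolding S_def Q_def
        by (simp add: scaleR_eq_vector_scalar_mult) (metis IntI image_eqI)
    qed
    define D where "D t = (\<chi> i. deriv (g i) (of_real t))" for t :: real
    have "((snd d \<circ> \<gamma>) has_vector_derivative D t) (at t)" if "t \<in> S" for t
    proof (rule has_vector_derivative_transform_within_open[of "\<lambda>s. snd d (chart_inv c (z0 + of_real s *s w))" _ _ "{0<..<1}"])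
      show "((\<lambda>s. snd d (chart_inv c (z0 + of_real s *s w))) has_vector_derivative D t) (at t)"
        unfolding has_vector_derivative_def
      proof (rule has_derivative_vec_componentwise)
        fix i
        have "(g i has_field_derivative deriv (g i) (of_real t)) (at (of_real t))"
          using hol[of i] Q SQ(2)[OF that] by (simp add: holomorphic_derivI)
        from has_vector_derivative_real_field[OF this]
        show "((\<lambda>x. snd d (chart_inv c (z0 + of_real x *s w)) $ i) has_derivative (\<lambda>v. (v *\<^sub>R D t) $ i)) (at t)"
          by (simp add: has_vector_derivative_def D_def g_def)
      qed
    qed (use SQ[OF that] ln in \<open>auto simp: scaleR_eq_vector_scalar_mult\<close>)
    moreover have "continuous_on S D"
      unfolding D_def
      by (intro continuous_on_vec_lambda continuous_on_compose2[OF holomorphic_on_imp_continuous_on[OF holomorphic_deriv[OF hol Q]]] continuous_intros)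
         (use SQ in auto)
    ultimately show ?thesis unfolding C1_differentiable_on_def S_def[symmetric] by blast
  qed
  have pw: "pw_C1_curve M \<gamma>"
    unfolding pw_C1_curve_def using C1 \<gamma> by (intro conjI exI[of _ "{0,1}"]) auto
  have sp: "speed M \<omega> \<gamma> t \<le> B" if t: "t \<in> {0<..<1}" for t
  proof -
    have "((snd c \<circ> \<gamma>) has_vector_derivative w) (at t)"
    proof (rule has_vector_derivative_transform_within_open[of "\<lambda>s. z0 + s *\<^sub>R w" _ _ "{0<..<1}"])
      show "((\<lambda>s. z0 + s *\<^sub>R w) has_vector_derivative w) (at t)"
        by (auto intro!: derivative_eq_intros)
    qed (use t ln chart_chart_inv[OF c] in auto)
    from speed_in_chart[OF c \<gamma> t _ this] show ?thesis
      using ln[OF t] B[OF t] chart_chart_inv[OF c] chart_inv_in_dom[OF c] by simp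
  qed
  have "AE t in lborel. t \<noteq> (0::real)" "AE t in lborel. t \<noteq> (1::real)" by (rule AE_lborel_singleton)+
  then have "AE t in lborel. ennreal (speed M \<omega> \<gamma> t) * indicator {0..1} t \<le> ennreal B * indicator {0..1} t"
  proof eventually_elim
    case (elim t)
    then show ?case using sp[of t] by (auto simp: indicator_def ennreal_leI)
  qed
  then have "curve_length M \<omega> \<gamma> \<le> (\<integral>\<^sup>+t. ennreal B * indicator {0..1::real} t \<partial>lborel)"
    unfolding curve_length_def by (rule nn_integral_mono_AE)
  also have "\<dots> = ennreal B" by (simp add: nn_integral_cmult)
  finally show ?thesis
    unfolding geodist_def using pw
    by (intro INF_lower2[of \<gamma>]) (auto simp: pathstart_def pathfinish_def)
qed

text \<open>The fundamental theorem of calculus, applied to the coordinates of the curve off the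
  finitely many exceptional parameters.\<close>

lemma curve_segment_bound:
  assumes c: "c \<in> M" and \<gamma>: "pw_C1_curve M \<gamma>" and uv: "0 \<le> u" "u \<le> v" "v \<le> 1"
    and dom: "\<And>t. t \<in> {u..v} \<Longrightarrow> \<gamma> t \<in> fst c"
    and low: "\<And>t w. t \<in> {u..v} \<Longrightarrow> m * norm w \<le> tnorm \<omega> c (snd c (\<gamma> t)) w" and m: "m > 0"
  shows "ennreal (m * norm (snd c (\<gamma> v) - snd c (\<gamma> u))) \<le> curve_length M \<omega> \<gamma>"
proof -
  have path: "path \<gamma>" using \<gamma> unfolding pw_C1_curve_def by blast
  obtain T where T: "finite T" "(snd c \<circ> \<gamma>) C1_differentiable_on ({t \<in> {0..1}. \<gamma> t \<in> fst c} - T)"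
    using \<gamma> c unfolding pw_C1_curve_def by blast
  from T(2) obtain D where D: "\<And>t. t \<in> {t \<in> {0..1}. \<gamma> t \<in> fst c} - T \<Longrightarrow> ((snd c \<circ> \<gamma>) has_vector_derivative D t) (at t)"
    "continuous_on ({t \<in> {0..1}. \<gamma> t \<in> fst c} - T) D"
    unfolding C1_differentiable_on_def by blast
  define K where "K = {u..v} - (T \<union> {0,1})"
  have K: "t \<in> {0<..<1}" "t \<in> {t \<in> {0..1}. \<gamma> t \<in> fst c} - T" "t \<in> {u..v}" if "t \<in> K" for t
    using that uv dom unfolding K_def by auto
  have Kb [measurable]: "K \<in> sets borel" unfolding K_def using T(1)
    by (intro sets.Diff) (auto intro!: borel_closed finite_imp_closed)
  define g where "g t = indicator K t *\<^sub>R D t" for t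
  have gm [measurable]: "g \<in> borel_measurable borel"
    unfolding g_def using K(2)
    by (intro borel_measurable_continuous_on_indicator continuous_on_subset[OF D(2)]) auto
  have le: "(\<integral>\<^sup>+t. ennreal (m * norm (g t)) \<partial>lborel) \<le> curve_length M \<omega> \<gamma>"
    unfolding curve_length_def
  proof (rule nn_integral_mono)
    fix t
    show "ennreal (m * norm (g t)) \<le> ennreal (speed M \<omega> \<gamma> t) * indicator {0..1} t"
    proof (cases "t \<in> K")
      case True
      have "speed M \<omega> \<gamma> t = tnorm \<omega> c (snd c (\<gamma> t)) (D t)"
        using K[OF True] D(1) by (intro speed_in_chart[OF c path]) auto
      then show ?thesis using True K[OF True] low[of t "D t"] by (simp add: g_def ennreal_leI)
    qed (simp add: g_def)
  qed
  \<comment> \<open>If the length is infinite there is nothing to show; if it is finite, the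
    derivative is integrable.\<close>
  show ?thesis
  proof (cases "curve_length M \<omega> \<gamma> = \<infinity>")
    case False
    have mg: "(\<integral>\<^sup>+t. ennreal (m * norm (g t)) \<partial>lborel) = ennreal m * (\<integral>\<^sup>+t. ennreal (norm (g t)) \<partial>lborel)"
      using m by (simp add: nn_integral_cmult ennreal_mult)
    have "ennreal m * (\<integral>\<^sup>+t. ennreal (norm (g t)) \<partial>lborel) < top"
      using le False unfolding mg by (simp add: less_top order.strict_trans1)
    then have "(\<integral>\<^sup>+t. ennreal (norm (g t)) \<partial>lborel) < \<infinity>"
      using m by (auto simp: ennreal_mult_less_top)
    then have int: "integrable lborel g" by (intro integrableI_bounded) auto
    then have "(g has_integral integral\<^sup>L lborel g) UNIV" by (rule has_integral_integral_lborel)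
    moreover have "(g has_integral (snd c \<circ> \<gamma>) v - (snd c \<circ> \<gamma>) u) UNIV"
    proof -
      have "(D has_integral (snd c \<circ> \<gamma>) v - (snd c \<circ> \<gamma>) u) {u..v}"
      proof (rule fundamental_theorem_of_calculus_interior_strong[OF T(1) uv(2)])
        show "((snd c \<circ> \<gamma>) has_vector_derivative D x) (at x)" if "x \<in> {u<..<v} - T" for x
          using that uv dom by (intro D(1)) auto
        have "continuous_on {u..v} \<gamma>"
          using path uv unfolding path_def by (auto intro: continuous_on_subset)
        then show "continuous_on {u..v} (snd c \<circ> \<gamma>)"
          using dom by (intro continuous_on_compose continuous_on_subset[OF continuous_on_chart[OF c]]) auto
      qed
      then have "((\<lambda>t. if t \<in> {u..v} then D t else 0) has_integral (snd c \<circ> \<gamma>) v - (snd c \<circ> \<gamma>) u) UNIV"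
        by (simp only: has_integral_restrict_UNIV)
      then show ?thesis
        by (rule has_integral_spike_finite[rotated 2, of _ _ _ "T \<union> {0,1}"]) (use T in \<open>auto simp: g_def K_def\<close>)
    qed
    ultimately have "integral\<^sup>L lborel g = snd c (\<gamma> v) - snd c (\<gamma> u)"
      by (simp add: has_integral_unique)
    then have "ennreal (norm (snd c (\<gamma> v) - snd c (\<gamma> u))) \<le> (\<integral>\<^sup>+t. ennreal (norm (g t)) \<partial>lborel)"
      using integral_norm_bound_ennreal[OF int] by simp
    then have "ennreal m * ennreal (norm (snd c (\<gamma> v) - snd c (\<gamma> u))) \<le> ennreal m * (\<integral>\<^sup>+t. ennreal (norm (g t)) \<partial>lborel)"
      by (rule mult_left_mono) simp
    then show ?thesis using le m unfolding mg by (simp add: ennreal_mult)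
  qed simp
qed

text \<open>A path starting in a coordinate ball cannot leave it if, as long as it stays inside,
  it stays in a smaller closed ball: that closed ball is compact, hence closed in the manifold, so
  it also contains the point at the first exit time.\<close>

lemma path_trapped:
  assumes c: "c \<in> M" and V: "ball y \<delta> \<subseteq> chart_img c" and \<gamma>: "path \<gamma>" and "\<gamma> 0 \<in> chart_inv c ` ball y \<delta>"
    and R: "R < \<delta>" and bd: "\<And>t. t \<in> {0..1} \<Longrightarrow> (\<And>s. s \<in> {0..t} \<Longrightarrow> \<gamma> s \<in> chart_inv c ` ball y \<delta>) \<Longrightarrow>
       norm (snd c (\<gamma> t) - y) \<le> R"
    and that: "t \<in> {0..1}"
  shows "\<gamma> t \<in> chart_inv c ` ball y \<delta>"
proof (rule ccontr)
  assume nt: "\<gamma> t \<notin> chart_inv c ` ball y \<delta>"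
  let ?V = "chart_inv c ` ball y \<delta>"
  have cont: "continuous_on {0..1} \<gamma>" using \<gamma> unfolding path_def .
  have K: "closed (chart_inv c ` cball y R)" "chart_inv c ` cball y R \<subseteq> ?V"
    using R V by (auto intro!: compact_imp_closed compact_continuous_image continuous_on_subset[OF continuous_on_chart_inv[OF c]])
  define A where "A = {0..1} \<inter> \<gamma> -` (- ?V)"
  have "closed A" unfolding A_def
    using open_chart_inv_image[OF c _ V] cont by (intro continuous_closed_preimage) auto
  moreover have "A \<subseteq> {0..1}" unfolding A_def by auto
  ultimately have "compact A" by (metis compact_Int_closed compact_Icc inf.absorb_iff2)
  moreover have "A \<noteq> {}" using nt that unfolding A_def by auto
  ultimately obtain t1 where t1: "t1 \<in> A" "\<And>s. s \<in> A \<Longrightarrow> t1 \<le> s"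
    using compact_attains_inf by metis
  have t1': "t1 \<in> {0..1}" "\<gamma> t1 \<notin> ?V" using t1 unfolding A_def by auto
  have "t1 \<noteq> 0" using t1' assms(4) by auto
  have inV: "\<gamma> s \<in> ?V" if "0 \<le> s" "s < t1" for s
    using t1(2)[of s] that t1' unfolding A_def by auto
  have inK: "\<gamma> s \<in> chart_inv c ` cball y R" if s: "s \<in> {0..<t1}" for s
  proof -
    have "\<gamma> s \<in> ?V" using s inV by auto
    then have "chart_inv c (snd c (\<gamma> s)) = \<gamma> s" 
      using V chart_inv_in_dom[OF c] by (intro chart_inv_chart[OF c]) auto
    moreover have "norm (snd c (\<gamma> s) - y) \<le> R"
      using s t1' inV by (intro bd) auto
    ultimately show ?thesis by (metis dist_commute dist_norm image_eqI mem_cball)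
  qed
  have "closed ({0..1} \<inter> \<gamma> -` (chart_inv c ` cball y R))"
    using cont K by (intro continuous_closed_preimage) auto
  moreover have "{0..<t1} \<subseteq> {0..1} \<inter> \<gamma> -` (chart_inv c ` cball y R)"
    using inK t1' by auto
  ultimately have "closure {0..<t1} \<subseteq> {0..1} \<inter> \<gamma> -` (chart_inv c ` cball y R)"
    by (rule closure_minimal[rotated])
  moreover have "t1 \<in> closure {0..<t1}" using \<open>t1 \<noteq> 0\<close> t1' by simp
  ultimately have "\<gamma> t1 \<in> chart_inv c ` cball y R" by blast
  then show False using K(2) t1'(2) by blast
qed

context
  fixes c y \<delta> m
  assumes c: "c \<in> M" and V: "ball y \<delta> \<subseteq> chart_img c" and \<delta>: "\<delta> > 0" and m: "m > 0"
    and low: "\<And>z w. z \<in> ball y \<delta> \<Longrightarrow> m * norm w \<le> tnorm \<omega> c z w"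
begin

text \<open>The chart centre may be the start (\<open>a = 0\<close>) or the end (\<open>a =
  1\<close>) of the curve: geodesic balls measure distances from their centre, whereas
  completeness provides distances to the limit point.\<close>

lemma curve_lower_bound:
  assumes \<gamma>: "pw_C1_curve M \<gamma>" and ends: "\<gamma> a = chart_inv c y" "a = 0 \<and> b = 1 \<or> a = 1 \<and> b = 0"
    and len: "curve_length M \<omega> \<gamma> < ennreal (m * \<delta>)"
  shows "\<gamma> b \<in> chart_inv c ` ball y \<delta>" "ennreal (m * norm (snd c (\<gamma> b) - y)) \<le> curve_length M \<omega> \<gamma>"
proof -
  let ?V = "chart_inv c ` ball y \<delta>"
  have path: "path \<gamma>" using \<gamma> unfolding pw_C1_curve_def by blast
  obtain l where l: "curve_length M \<omega> \<gamma> = ennreal l" "0 \<le> l" "l < m * \<delta>"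
    using len m \<delta> by (cases "curve_length M \<omega> \<gamma>" rule: ennreal_cases) (auto simp: ennreal_less_iff)
  have "y \<in> chart_img c" using V \<delta> by auto
  then have y: "snd c (\<gamma> a) = y" "\<gamma> a \<in> ?V" using \<delta> ends(1) chart_chart_inv[OF c] by auto
  have Vd: "x \<in> fst c" "snd c x \<in> ball y \<delta>" if "x \<in> ?V" for x
    using that V chart_inv_in_dom[OF c] chart_chart_inv[OF c] by auto
  have seg: "m * norm (snd c (\<gamma> v) - snd c (\<gamma> u)) \<le> l"
    if "0 \<le> u" "u \<le> v" "v \<le> 1" "\<And>t. t \<in> {u..v} \<Longrightarrow> \<gamma> t \<in> ?V" for u v
  proof -
    have "ennreal (m * norm (snd c (\<gamma> v) - snd c (\<gamma> u))) \<le> curve_length M \<omega> \<gamma>"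
      using that Vd low by (intro curve_segment_bound[OF c \<gamma> _ _ _ _ _ m]) auto
    then show ?thesis using l m by (simp add: ennreal_le_iff)
  qed
  have all: "\<gamma> t \<in> ?V" if "t \<in> {0..1}" for t
    using ends(2)
  proof
    assume ab: "a = 0 \<and> b = 1"
    show ?thesis
    proof (rule path_trapped[OF c V path _ _ _ that, of "l / m"])
      show "norm (snd c (\<gamma> t) - y) \<le> l / m" if "t \<in> {0..1}" "\<And>s. s \<in> {0..t} \<Longrightarrow> \<gamma> s \<in> ?V" for t
        using seg[of 0 t] that y ab m by (simp add: field_simps)
    qed (use y ab l m in \<open>auto simp: field_simps\<close>)
  next
    assume ab: "a = 1 \<and> b = 0"
    have "reversepath \<gamma> (1 - t) \<in> ?V"
    proof (rule path_trapped[OF c V, of _ "l / m"])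
      show "path (reversepath \<gamma>)" using path by simp
      show "norm (snd c (reversepath \<gamma> t) - y) \<le> l / m" if t: "t \<in> {0..1}" "\<And>s. s \<in> {0..t} \<Longrightarrow> reversepath \<gamma> s \<in> ?V" for t
      proof -
        have "\<gamma> s \<in> ?V" if "s \<in> {1-t..1}" for s
          using t(2)[of "1 - s"] that by (simp add: reversepath_def)
        then show ?thesis
          using seg[of "1 - t" 1] t(1) y ab m by (simp add: field_simps reversepath_def norm_minus_commute)
      qed
    qed (use y ab l m that in \<open>auto simp: field_simps reversepath_def\<close>)
    then show ?thesis by (simp add: reversepath_def)
  qed
  show "\<gamma> b \<in> ?V" using all ends(2) by auto
  have "m * norm (snd c (\<gamma> b) - snd c (\<gamma> a)) \<le> l"
    using seg[of 0 1] all ends(2) by (auto simp: norm_minus_commute)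
  then show "ennreal (m * norm (snd c (\<gamma> b) - y)) \<le> curve_length M \<omega> \<gamma>"
    using y l by (simp add: ennreal_leI)
qed

lemma geodist_lower_bound:
  assumes d: "d = geodist M \<omega> (chart_inv c y) q \<or> d = geodist M \<omega> q (chart_inv c y)" "d < ennreal (m * \<delta>)"
  shows "q \<in> fst c" "snd c q \<in> ball y \<delta>" "ennreal (m * norm (snd c q - y)) \<le> d"
proof -
  obtain a b :: real where ab: "a = 0 \<and> b = 1 \<or> a = 1 \<and> b = 0"
    "d = (INF \<gamma>\<in>{\<gamma>. pw_C1_curve M \<gamma> \<and> \<gamma> a = chart_inv c y \<and> \<gamma> b = q}. curve_length M \<omega> \<gamma>)"
    using d(1)
  proof
    assume "d = geodist M \<omega> (chart_inv c y) q"
    then show thesis using that[of 0 1] unfolding geodist_def pathstart_def pathfinish_def by simp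
  next
    assume "d = geodist M \<omega> q (chart_inv c y)"
    then show thesis using that[of 1 0] unfolding geodist_def pathstart_def pathfinish_def by (simp add: conj_commute)
  qed
  then obtain \<gamma> where \<gamma>: "pw_C1_curve M \<gamma>" "\<gamma> a = chart_inv c y" "\<gamma> b = q" "curve_length M \<omega> \<gamma> < ennreal (m * \<delta>)"
    using d(2) by (auto simp: INF_less_iff)
  have q: "q \<in> chart_inv c ` ball y \<delta>" using curve_lower_bound(1)[OF \<gamma>(1,2) ab(1) \<gamma>(4)] \<gamma>(3) by simp
  then show "q \<in> fst c" and qb: "snd c q \<in> ball y \<delta>"
    using V chart_inv_in_dom[OF c] chart_chart_inv[OF c] by auto
  show "ennreal (m * norm (snd c q - y)) \<le> d"
    unfolding ab(2)
  proof (rule INF_greatest)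
    fix \<gamma> assume "\<gamma> \<in> {\<gamma>. pw_C1_curve M \<gamma> \<and> \<gamma> a = chart_inv c y \<and> \<gamma> b = q}"
    then have \<gamma>: "pw_C1_curve M \<gamma>" "\<gamma> a = chart_inv c y" "\<gamma> b = q" by auto
    show "ennreal (m * norm (snd c q - y)) \<le> curve_length M \<omega> \<gamma>"
    proof (cases "curve_length M \<omega> \<gamma> < ennreal (m * \<delta>)")
      case True
      then show ?thesis using curve_lower_bound(2)[OF \<gamma>(1,2) ab(1)] \<gamma>(3) by simp
    next
      case False
      have "m * norm (snd c q - y) \<le> m * \<delta>" using qb m by (simp add: dist_norm norm_minus_commute)
      then show ?thesis using False by (meson ennreal_leI linorder_not_less order_trans)
    qed
  qed
qed

end

section \<open>Completeness\<close>

text \<open>A priori the image of the chart could be small or have holes. Follow the ray \<open>t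
  *\<^sub>R z\<close> from the origin. As long as it stays in the image of the geodesic ball, its
  length is at most \<open>L * t * norm z\<close>. So as \<open>t\<close> approaches the end of
  the interval the points form a Cauchy sequence, and completeness gives a limit \<open>x\<close>.
  The ray extended by \<open>x\<close> is still a curve of length less than \<open>r\<close>,
  hence \<open>x\<close> lies in the geodesic ball and therefore in the chart
  (\<open>closed_step\<close>). Beyond that point the ray continues for a while inside the
  geodesic ball by continuity of the metric (\<open>open_step\<close>).\<close>

lemma ball_subset_geoball:
  assumes complete: "complete_metric M \<omega>" and c: "c \<in> M" and p: "p \<in> fst c" "snd c p = 0"
    and r: "r > 0" "L > 0" and gb: "geoball M \<omega> p r \<subseteq> fst c"
    and upper: "\<And>x v. x \<in> snd c ` geoball M \<omega> p r \<Longrightarrow> tnorm \<omega> c x v \<le> L * norm v"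
  shows "ball 0 (r / L) \<subseteq> snd c ` geoball M \<omega> p r"
proof
  fix z :: "complex^'n" assume "z \<in> ball 0 (r / L)"
  then have z: "L * norm z < r" using r by (simp add: field_simps)
  define P where "P t \<longleftrightarrow> t *\<^sub>R z \<in> snd c ` geoball M \<omega> p r" for t
  have img: "x \<in> chart_img c" if "x \<in> snd c ` geoball M \<omega> p r" for x
    using that gb unfolding chart_img_def by auto
  have 0: "0 \<in> chart_img c" "chart_inv c 0 = p" using p chart_in_img[OF c] chart_inv_chart[OF c] by (metis, metis)
  have geo: "geodist M \<omega> (chart_inv c (a *\<^sub>R z)) (chart_inv c (b *\<^sub>R z)) \<le> ennreal (\<bar>b - a\<bar> * B)"
    if ab: "\<And>s. s \<in> closed_segment a b \<Longrightarrow> s *\<^sub>R z \<in> chart_img c \<and> tnorm \<omega> c (s *\<^sub>R z) z \<le> B" for a b B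
  proof -
    define \<gamma> where "\<gamma> u = chart_inv c (a *\<^sub>R z + u *\<^sub>R ((b - a) *\<^sub>R z))" for u :: real
    have seg: "a *\<^sub>R z + u *\<^sub>R ((b - a) *\<^sub>R z) = (a + u * (b - a)) *\<^sub>R z" "a + u * (b - a) \<in> closed_segment a b"
      if "u \<in> {0..1}" for u
      using that by (auto simp: algebra_simps closed_segment_def intro!: exI[of _ u])
    have "path \<gamma>" unfolding path_def \<gamma>_def
      by (intro continuous_on_compose2[OF continuous_on_chart_inv[OF c]] continuous_intros) (use seg ab in auto)
    then have "geodist M \<omega> (\<gamma> 0) (\<gamma> 1) \<le> ennreal (\<bar>b - a\<bar> * B)"
    proof (rule geodist_line_le[OF c])
      fix u :: real assume "u \<in> {0<..<1}"
      then have u: "u \<in> {0..1}" by auto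
      show "a *\<^sub>R z + u *\<^sub>R ((b - a) *\<^sub>R z) \<in> chart_img c" using seg[OF u] ab by simp
      then show "tnorm \<omega> c (a *\<^sub>R z + u *\<^sub>R (b - a) *\<^sub>R z) ((b - a) *\<^sub>R z) \<le> \<bar>b - a\<bar> * B"
        using ab seg[OF u] by (simp add: tnorm_scaleR[OF c] mult_left_mono)
    qed (simp add: \<gamma>_def)
    then show ?thesis unfolding \<gamma>_def by (simp add: algebra_simps)
  qed
  have closed_step: "P t" if t: "0 \<le> t" "t \<le> 1" and lt: "\<And>s. 0 \<le> s \<Longrightarrow> s < t \<Longrightarrow> P s" for t
  proof (cases "t = 0")
    case True
    have "geodist M \<omega> p p \<le> ennreal 0"
      using geodist_line_le[OF c, of "\<lambda>_. p" 0 0 0] 0 tnorm_scaleR[OF c 0(1), of 0] by (simp add: path_def)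
    then have "p \<in> geoball M \<omega> p r" unfolding geoball_def using r by (simp add: ennreal_less_zero_iff)
    then have "0 \<in> snd c ` geoball M \<omega> p r" using p(2) by (metis image_eqI)
    then show ?thesis using True by (simp add: P_def)
  next
    case False
    then have t0: "t > 0" using t by simp
    have in_img: "s *\<^sub>R z \<in> chart_img c" "tnorm \<omega> c (s *\<^sub>R z) z \<le> L * norm z" if "0 \<le> s" "s < t" for s
      using lt[OF that] img upper unfolding P_def by auto
    have dist: "geodist M \<omega> (chart_inv c (a *\<^sub>R z)) (chart_inv c (b *\<^sub>R z)) \<le> ennreal (\<bar>b - a\<bar> * (L * norm z))"
      if "0 \<le> a" "a < t" "0 \<le> b" "b < t" for a b
    proof (rule geo)
      fix s assume "s \<in> closed_segment a b"
      then have "0 \<le> s" "s < t" using that by (auto simp: closed_segment_eq_real_ivl split: if_splits)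
      then show "s *\<^sub>R z \<in> chart_img c \<and> tnorm \<omega> c (s *\<^sub>R z) z \<le> L * norm z" using in_img by blast
    qed
    define s where "s i = t * (1 - inverse (real (Suc i)))" for i
    have s: "0 \<le> s i" "s i < t" for i
      using t0 by (auto simp: s_def field_simps)
    have "(\<lambda>i. t * (1 - inverse (real (Suc i)))) \<longlonglongrightarrow> t * (1 - 0)"
      by (intro tendsto_intros LIMSEQ_inverse_real_of_nat)
    then have slim: "s \<longlonglongrightarrow> t" unfolding s_def by simp
    define q where "q i = chart_inv c (s i *\<^sub>R z)" for i
    have Lz: "0 \<le> L * norm z" using r by simp
    have "\<exists>N. \<forall>i\<ge>N. \<forall>j\<ge>N. geodist M \<omega> (q i) (q j) < e" if e: "e > 0" for e
    proof -
      obtain e' where e': "0 < e'" "ennreal e' \<le> e"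
      proof (cases e)
        case (real r)
        then show ?thesis using e that[of r] by auto
      next
        case top
        then show ?thesis using that[of 1] by simp
      qed
      have "Cauchy s" using slim by (rule LIMSEQ_imp_Cauchy)
      then obtain N where N: "\<And>i j. i \<ge> N \<Longrightarrow> j \<ge> N \<Longrightarrow> dist (s i) (s j) < e' / (L * norm z + 1)"
        unfolding Cauchy_def using e' Lz by (meson add_nonneg_pos divide_pos_pos zero_less_one)
      have "geodist M \<omega> (q i) (q j) < e" if ij: "i \<ge> N" "j \<ge> N" for i j
      proof -
        have "geodist M \<omega> (q i) (q j) \<le> ennreal (\<bar>s j - s i\<bar> * (L * norm z))"
          unfolding q_def by (rule dist) (rule s)+
        also have "\<bar>s j - s i\<bar> * (L * norm z) < e'"
        proof -
          have "\<bar>s j - s i\<bar> * (L * norm z) \<le> \<bar>s j - s i\<bar> * (L * norm z + 1)"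
            by (intro mult_left_mono) auto
          also have "\<dots> < e'" using N[OF ij(2,1)] Lz by (simp add: dist_real_def pos_less_divide_eq)
          finally show ?thesis .
        qed
        then have "ennreal (\<bar>s j - s i\<bar> * (L * norm z)) < ennreal e'" using Lz e' by (intro ennreal_lessI) auto
        finally show ?thesis using e'(2) by (rule less_le_trans)
      qed
      then show ?thesis by blast
    qed
    then obtain x where x: "(\<lambda>i. geodist M \<omega> (q i) x) \<longlonglongrightarrow> 0"
      using complete unfolding complete_metric_def by blast
    obtain d where d: "d \<in> M" "x \<in> fst d" using chart_at by blast
    define y where "y = snd d x"
    have y: "y \<in> chart_img d" "chart_inv d y = x" unfolding y_def using d chart_in_img chart_inv_chart by auto
    obtain \<delta> m where \<delta>: "\<delta> > 0" "m > 0" "ball y \<delta> \<subseteq> chart_img d"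
      and low: "\<And>z v. z \<in> ball y \<delta> \<Longrightarrow> m * norm v \<le> tnorm \<omega> d z v"
      using local_lower_bound[OF d(1) y(1)] by blast
    \<comment> \<open>The topological limit is needed along the whole ray, not only along the
      sequence \<open>q\<close>. From some \<open>q i\<close> on, which is close to
      \<open>x\<close>, the rest of the ray is so short that it cannot leave a small ball.\<close>
    have near: "\<exists>a\<in>{0..<t}. \<forall>u\<in>{a..<t}. chart_inv c (u *\<^sub>R z) \<in> fst d \<and> dist (snd d (chart_inv c (u *\<^sub>R z))) y < e"
      if e: "0 < e" "e \<le> \<delta>" for e
    proof -
      have "0 < ennreal (m * (e / 2))" using e \<delta> by (simp add: ennreal_less_zero_iff)
      then have "eventually (\<lambda>i. geodist M \<omega> (q i) x < ennreal (m * (e / 2))) sequentially"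
        using x by (rule order_tendstoD(2)[rotated])
      moreover have "eventually (\<lambda>i. t - m * (e/2) / (L * norm z + 1) < s i) sequentially"
        using e \<delta> Lz by (intro order_tendstoD(1)[OF slim]) (simp add: add_nonneg_pos)
      ultimately have "eventually (\<lambda>i. geodist M \<omega> (q i) x < ennreal (m * (e / 2)) \<and> t - m * (e/2) / (L * norm z + 1) < s i) sequentially"
        by (rule eventually_conj)
      then obtain i where i: "geodist M \<omega> (q i) x < ennreal (m * (e / 2))" "t - m * (e/2) / (L * norm z + 1) < s i"
        using eventually_happens'[OF sequentially_bot] by blast
      have sub0: "ball y (e/2) \<subseteq> ball y \<delta>" using e by (intro subset_ball) simp
      have gi: "geodist M \<omega> (q i) x = geodist M \<omega> (chart_inv d y) (q i) \<or> geodist M \<omega> (q i) x = geodist M \<omega> (q i) (chart_inv d y)"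
        unfolding y(2) by simp
      have "q i \<in> fst d \<and> snd d (q i) \<in> ball y (e/2)"
        by (intro conjI geodist_lower_bound(1,2)[OF d(1), of y "e/2" m, OF _ _ _ _ gi i(1)]) (use sub0 \<delta> e low in auto)
      then have qi: "q i \<in> fst d" "snd d (q i) \<in> ball y (e/2)" by auto
      define y' where "y' = snd d (q i)"
      have y': "chart_inv d y' = q i" "dist y' y < e/2" unfolding y'_def using qi chart_inv_chart[OF d(1)] by (auto simp: dist_commute)
      have sub: "ball y' (e/2) \<subseteq> ball y \<delta>"
      proof
        fix x assume "x \<in> ball y' (e/2)"
        then have "dist y x < e" using y'(2) dist_triangle_half_r[of y' y e x] by (simp add: dist_commute)
        then show "x \<in> ball y \<delta>" using e by simp
      qed
      have "chart_inv c (u *\<^sub>R z) \<in> fst d \<and> dist (snd d (chart_inv c (u *\<^sub>R z))) y < e" if u: "u \<in> {s i..<t}" for u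
      proof -
        have "geodist M \<omega> (q i) (chart_inv c (u *\<^sub>R z)) \<le> ennreal (\<bar>u - s i\<bar> * (L * norm z))"
          unfolding q_def using u s[of i] by (intro dist) auto
        also have "\<bar>u - s i\<bar> * (L * norm z) < m * (e/2)"
        proof -
          have "\<bar>u - s i\<bar> * (L * norm z) \<le> (t - s i) * (L * norm z + 1)"
            using u Lz by (intro mult_mono) auto
          also have "\<dots> < m * (e/2)"
          proof -
            have "t - s i < m * (e/2) / (L * norm z + 1)" using i(2) by linarith
            then show ?thesis using Lz by (subst (asm) pos_less_divide_eq) auto
          qed
          finally show ?thesis .
        qed
        then have "ennreal (\<bar>u - s i\<bar> * (L * norm z)) < ennreal (m * (e/2))" using Lz e \<delta> by (intro ennreal_lessI) auto
        finally have lt': "geodist M \<omega> (chart_inv d y') (chart_inv c (u *\<^sub>R z)) < ennreal (m * (e/2))" unfolding y' .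
        have "chart_inv c (u *\<^sub>R z) \<in> fst d \<and> snd d (chart_inv c (u *\<^sub>R z)) \<in> ball y' (e/2)"
          by (intro conjI geodist_lower_bound(1,2)[OF d(1), of y' "e/2" m, OF _ _ _ _ disjI1[OF refl] lt']) (use sub \<delta> e low in auto)
        then show ?thesis using y'(2) dist_triangle_half_r[of y' y e "snd d (chart_inv c (u *\<^sub>R z))"] by (simp add: dist_commute)
      qed
      then show ?thesis using s[of i] by (intro bexI[of _ "s i"]) auto
    qed
    have ev: "eventually (\<lambda>u. chart_inv c (u *\<^sub>R z) \<in> fst d \<and> dist (snd d (chart_inv c (u *\<^sub>R z))) y < e) (at_left t)"
      if e: "0 < e" for e
    proof -
      obtain a where a: "a \<in> {0..<t}" "\<forall>u\<in>{a..<t}. chart_inv c (u *\<^sub>R z) \<in> fst d \<and> dist (snd d (chart_inv c (u *\<^sub>R z))) y < min e \<delta>"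
        using near[of "min e \<delta>"] e \<delta> by auto
      then have "eventually (\<lambda>u. u \<in> {a<..<t}) (at_left t)" by (intro eventually_at_left_real) auto
      then show ?thesis by (rule eventually_mono) (use a(2) in auto)
    qed
    have "((\<lambda>u. snd d (chart_inv c (u *\<^sub>R z))) \<longlongrightarrow> y) (at_left t)"
    proof (rule tendstoI)
      fix e :: real assume "0 < e"
      from ev[OF this] show "eventually (\<lambda>u. dist (snd d (chart_inv c (u *\<^sub>R z))) y < e) (at_left t)"
        by eventually_elim simp
    qed
    moreover have "isCont (chart_inv d) y"
      using continuous_on_chart_inv[OF d(1)] continuous_on_eq_continuous_at[OF open_chart_img[OF d(1)]] y(1) by blast
    ultimately have "((\<lambda>u. chart_inv d (snd d (chart_inv c (u *\<^sub>R z)))) \<longlongrightarrow> chart_inv d y) (at_left t)"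
      by (rule isCont_tendsto_compose[rotated])
    moreover have "eventually (\<lambda>u. chart_inv d (snd d (chart_inv c (u *\<^sub>R z))) = chart_inv c (u *\<^sub>R z)) (at_left t)"
      using ev[OF zero_less_one] by eventually_elim (simp add: chart_inv_chart[OF d(1)])
    ultimately have lim: "((\<lambda>u. chart_inv c (u *\<^sub>R z)) \<longlongrightarrow> x) (at_left t)"
      using y(2) by (simp add: tendsto_cong)
    define \<gamma> where "\<gamma> u = (if u < t then chart_inv c (u *\<^sub>R z) else x)" for u
    have cont: "continuous_on {0..t} \<gamma>"
    proof (rule continuous_on_IccI)
      have on: "continuous_on {0..<t} (\<lambda>u. chart_inv c (u *\<^sub>R z))"
        by (intro continuous_on_compose2[OF continuous_on_chart_inv[OF c]] continuous_intros) (use in_img in auto)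
      have ev\<gamma>: "eventually (\<lambda>s. \<gamma> s = chart_inv c (s *\<^sub>R z)) (at u within S)" if "u < t" for u S
      proof -
        have "eventually (\<lambda>s. s < t) (at u within S)"
          using that by (intro order_tendstoD(2)[OF tendsto_ident_at])
        then show ?thesis by eventually_elim (simp add: \<gamma>_def)
      qed
      show "(\<gamma> \<longlongrightarrow> \<gamma> t) (at_left t)"
      proof -
        have "eventually (\<lambda>s. \<gamma> s = chart_inv c (s *\<^sub>R z)) (at_left t)"
          using eventually_at_left_real[OF t0] by eventually_elim (simp add: \<gamma>_def)
        then show ?thesis using lim by (simp add: tendsto_cong \<gamma>_def)
      qed
      show "(\<gamma> \<longlongrightarrow> \<gamma> 0) (at_right 0)"
      proof -
        have "((\<lambda>u. chart_inv c (u *\<^sub>R z)) \<longlongrightarrow> chart_inv c (0 *\<^sub>R z)) (at 0 within {0..<t})"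
          using on t0 unfolding continuous_on_def by fastforce
        moreover have "at 0 within {0..<t} = at_right (0::real)"
          using t0 by (intro at_within_nhd[of _ "{..<t}"]) auto
        ultimately show ?thesis using t0 by (subst tendsto_cong[OF ev\<gamma>[OF t0]]) (simp add: \<gamma>_def)
      qed
      show "\<gamma> \<midarrow>u\<rightarrow> \<gamma> u" if "0 < u" "u < t" for u
      proof -
        have "((\<lambda>u. chart_inv c (u *\<^sub>R z)) \<longlongrightarrow> chart_inv c (u *\<^sub>R z)) (at u within {0..<t})"
          using on that unfolding continuous_on_def by auto
        moreover have "at u within {0..<t} = at u"
          using that by (intro at_within_interior) (simp add: interior_atLeastLessThan)
        ultimately show ?thesis using ev\<gamma>[of u UNIV] that by (simp add: tendsto_cong \<gamma>_def)
      qed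
    qed (rule t0)
    define \<eta> where "\<eta> u = \<gamma> (t * u)" for u
    have "path \<eta>" unfolding path_def \<eta>_def
      using t0 by (intro continuous_on_compose2[OF cont] continuous_intros) (auto simp: mult_left_le)
    then have "geodist M \<omega> (\<eta> 0) (\<eta> 1) \<le> ennreal (t * (L * norm z))"
    proof (rule geodist_line_le[OF c, of _ 0 "t *\<^sub>R z"])
      fix u :: real assume "u \<in> {0<..<1}"
      then have u: "0 \<le> t * u" "t * u < t" using t0 by auto
      show "0 + u *\<^sub>R t *\<^sub>R z \<in> chart_img c" using in_img[OF u] by (simp add: mult.commute)
      then show "tnorm \<omega> c (0 + u *\<^sub>R t *\<^sub>R z) (t *\<^sub>R z) \<le> t * (L * norm z)"
        using in_img[OF u] t0 by (simp add: tnorm_scaleR[OF c] mult.commute mult_left_mono)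
      show "\<eta> u = chart_inv c (0 + u *\<^sub>R t *\<^sub>R z)" using u by (simp add: \<eta>_def \<gamma>_def mult.commute)
    qed
    moreover have "\<eta> 0 = p" "\<eta> 1 = x" using t0 0 by (auto simp: \<eta>_def \<gamma>_def)
    moreover have "t * (L * norm z) < r" using z t Lz by (meson mult_left_le_one_le order.strict_trans1)
    then have "ennreal (t * (L * norm z)) < ennreal r" using r by (intro ennreal_lessI)
    ultimately have xg: "x \<in> geoball M \<omega> p r" unfolding geoball_def by auto
    then have xc: "x \<in> fst c" using gb by blast
    then have "isCont (snd c) x"
      using continuous_on_chart[OF c] continuous_on_eq_continuous_at[OF open_chart_dom[OF c]] by blast
    then have "((\<lambda>u. snd c (chart_inv c (u *\<^sub>R z))) \<longlongrightarrow> snd c x) (at_left t)"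
      using lim by (rule isCont_tendsto_compose)
    moreover have "eventually (\<lambda>u. snd c (chart_inv c (u *\<^sub>R z)) = u *\<^sub>R z) (at_left t)"
      using eventually_at_left_real[OF t0] by eventually_elim (simp add: chart_chart_inv[OF c] in_img)
    ultimately have "((\<lambda>u. u *\<^sub>R z) \<longlongrightarrow> snd c x) (at_left t)" by (simp add: tendsto_cong)
    moreover have "((\<lambda>u. u *\<^sub>R z) \<longlongrightarrow> t *\<^sub>R z) (at_left t)" by (intro tendsto_intros)
    ultimately have "t *\<^sub>R z = snd c x" using tendsto_unique trivial_limit_at_left_real by blast
    then show ?thesis using xg unfolding P_def by auto
  qed
  have open_step: "\<exists>\<eta>>0. \<forall>s\<in>{t..t+\<eta>}. s \<le> 1 \<longrightarrow> P s"
    if t: "0 \<le> t" "t \<le> 1" and le: "\<And>s. 0 \<le> s \<Longrightarrow> s \<le> t \<Longrightarrow> P s" for t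
  proof -
    \<comment> \<open>Strictly between the bound on the ray and the radius, so that it survives a
      small continuation.\<close>
    define r' where "r' = (L * norm z + r) / 2"
    have r': "L * norm z < r'" "r' < r" "0 < r'" using z r by (auto simp: r'_def add_nonneg_pos)
    have in_img: "s *\<^sub>R z \<in> chart_img c" "tnorm \<omega> c (s *\<^sub>R z) z \<le> L * norm z" if "0 \<le> s" "s \<le> t" for s
      using le[OF that] img upper unfolding P_def by auto
    have "open (chart_img c \<inter> (\<lambda>x. tnorm \<omega> c x z) -` {..<r'})"
      by (rule continuous_open_preimage[OF continuous_on_tnorm[OF c] open_chart_img[OF c]]) simp
    then have "open ((\<lambda>s. s *\<^sub>R z) -` (chart_img c \<inter> (\<lambda>x. tnorm \<omega> c x z) -` {..<r'}))"
      by (rule open_vimage) (intro continuous_intros)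
    then have "open {s. s *\<^sub>R z \<in> chart_img c \<and> tnorm \<omega> c (s *\<^sub>R z) z < r'}"
      by (simp add: vimage_def)
    moreover have "t \<in> {s. s *\<^sub>R z \<in> chart_img c \<and> tnorm \<omega> c (s *\<^sub>R z) z < r'}"
      using in_img[of t] t r' by auto
    ultimately obtain \<eta> where \<eta>: "\<eta> > 0" "cball t \<eta> \<subseteq> {s. s *\<^sub>R z \<in> chart_img c \<and> tnorm \<omega> c (s *\<^sub>R z) z < r'}"
      using open_contains_cball by blast
    have "P s" if s: "s \<in> {t..t+\<eta>}" "s \<le> 1" for s
    proof -
      have bd: "u *\<^sub>R z \<in> chart_img c \<and> tnorm \<omega> c (u *\<^sub>R z) z \<le> r'" if "u \<in> closed_segment 0 s" for u
      proof (cases "u \<le> t")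
        case True
        then show ?thesis using in_img[of u] that s t r' by (auto simp: closed_segment_eq_real_ivl)
      next
        case False
        then have "u \<in> cball t \<eta>" using that s t by (auto simp: closed_segment_eq_real_ivl dist_real_def)
        then show ?thesis using \<eta>(2) by fastforce
      qed
      have "geodist M \<omega> p (chart_inv c (s *\<^sub>R z)) \<le> ennreal (\<bar>s - 0\<bar> * r')"
        using geo[of 0 s r', OF bd] 0(2) by simp
      also have "\<bar>s - 0\<bar> * r' < r"
      proof -
        have "s * r' \<le> r'" using s t r' by (intro mult_left_le_one_le) auto
        then show ?thesis using s t r' by (metis abs_of_nonneg diff_zero order.strict_trans1 order_trans atLeastAtMost_iff)
      qed
      then have "ennreal (\<bar>s - 0\<bar> * r') < ennreal r" using r by (intro ennreal_lessI)
      finally have "chart_inv c (s *\<^sub>R z) \<in> geoball M \<omega> p r" unfolding geoball_def by simp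
      moreover have "snd c (chart_inv c (s *\<^sub>R z)) = s *\<^sub>R z" using bd[of s] chart_chart_inv[OF c] by simp
      ultimately show ?thesis unfolding P_def by (metis image_eqI)
    qed
    then show ?thesis using \<eta>(1) by blast
  qed
  have "P 1"
  proof (rule ccontr)
    assume "\<not> P 1"
    define A where "A = {t \<in> {0..1}. \<not> P t}"
    have A: "1 \<in> A" "bdd_below A" using \<open>\<not> P 1\<close> unfolding A_def by auto
    define t where "t = Inf A"
    have t: "0 \<le> t" "t \<le> 1" unfolding t_def using A cInf_lower[OF A]
      by (auto intro!: cInf_greatest simp: A_def)
    have lt: "P s" if "0 \<le> s" "s < t" for s
      using cInf_lower[of s A] A(2) that t unfolding A_def t_def by force
    then have "P t" using closed_step[OF t] by blast
    then have le: "P s" if "0 \<le> s" "s \<le> t" for s using lt that by (cases "s = t") auto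
    obtain \<eta> where \<eta>: "\<eta> > 0" "\<And>s. s \<in> {t..t+\<eta>} \<Longrightarrow> s \<le> 1 \<Longrightarrow> P s" using open_step[OF t] le by blast
    have "t + \<eta> \<le> Inf A"
    proof (rule cInf_greatest)
      show "A \<noteq> {}" using A by auto
      fix s assume "s \<in> A"
      then show "t + \<eta> \<le> s" using le[of s] \<eta>(2)[of s] unfolding A_def by force
    qed
    then show False using \<eta>(1) unfolding t_def by simp
  qed
  then show "z \<in> snd c ` geoball M \<omega> p r" unfolding P_def by simp
qed

section \<open>Riemannian volume\<close>

text \<open>The uniform two-sided bound on the metric translates into a uniformly coercive and
  uniformly bounded Gram matrix. The constant is the same for all charts and all points.\<close>

lemma vol_density_lower_bound:
  fixes m L :: real
  assumes m: "m > 0"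
  obtains \<kappa> where "\<kappa> > 0" "\<And>c x. c \<in> M \<Longrightarrow> x \<in> chart_img c \<Longrightarrow>
    (\<And>v. m * norm v \<le> tnorm \<omega> c x v \<and> tnorm \<omega> c x v \<le> L * norm v) \<Longrightarrow> \<kappa> \<le> vol_density \<omega> c x"
proof -
  obtain \<kappa> where \<kappa>: "\<kappa> > 0" "\<And>A :: real^('n+'n)^('n+'n). (\<And>i j. \<bar>A $ i $ j\<bar> \<le> L\<^sup>2) \<Longrightarrow>
     (\<And>v. m\<^sup>2 * (norm v)\<^sup>2 \<le> v \<bullet> (A *v v)) \<Longrightarrow> \<kappa> \<le> det A"
    using det_lower_bound_of_coercive[where m = "m\<^sup>2" and L = "L\<^sup>2"] m by (metis zero_less_power)
  show thesis
  proof
    show "sqrt \<kappa> > 0" using \<kappa> by simp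
    fix c x assume c: "c \<in> M" and x: "x \<in> chart_img c"
      and bd: "\<And>v. m * norm v \<le> tnorm \<omega> c x v \<and> tnorm \<omega> c x v \<le> L * norm v"
    note b = bilinear_metric[OF c x]
    define A :: "real^('n+'n)^('n+'n)" where "A = (\<chi> a b. metric \<omega> c x (real_frame a) (real_frame b))"
    have up: "metric \<omega> c x v v \<le> L\<^sup>2 * (norm v)\<^sup>2" for v
    proof -
      have "(tnorm \<omega> c x v)\<^sup>2 \<le> (L * norm v)\<^sup>2"
        using bd tnorm_nonneg[OF c x] by (intro power_mono) auto
      then show ?thesis unfolding tnorm_def using metric_nonneg[OF c x] by (simp add: power_mult_distrib)
    qed
    have "\<kappa> \<le> det A"
    proof (rule \<kappa>(2))
      fix i j
      \<comment> \<open>Polarization: the diagonal bounds and the positivity of the metric at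
        \<open>u + w\<close> and \<open>u - w\<close> bound the off-diagonal entries.\<close>
      define u w where "u = (real_frame i :: complex^'n)" and "w = (real_frame j :: complex^'n)"
      have exp: "metric \<omega> c x (u + s *\<^sub>R w) (u + s *\<^sub>R w) = metric \<omega> c x u u + 2 * s * metric \<omega> c x u w + s\<^sup>2 * metric \<omega> c x w w" for s
        using metric_sym[OF c x, of w u]
        by (simp add: bilinear_ladd[OF b] bilinear_radd[OF b] bilinear_lmul[OF b] bilinear_rmul[OF b] algebra_simps power2_eq_square)
      have 1: "metric \<omega> c x u u \<le> L\<^sup>2" "metric \<omega> c x w w \<le> L\<^sup>2"
        using up[of u] up[of w] by (simp_all add: u_def w_def norm_real_frame)
      have 2: "0 \<le> metric \<omega> c x (u + s *\<^sub>R w) (u + s *\<^sub>R w)" for s using metric_nonneg[OF c x] .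
      have "\<bar>metric \<omega> c x u w\<bar> \<le> L\<^sup>2" using 1 2[of 1] 2[of "-1"] unfolding exp by simp
      then show "\<bar>A $ i $ j\<bar> \<le> L\<^sup>2" by (simp add: A_def u_def w_def)
    next
      fix v :: "real^('n+'n)"
      define w where "w = (\<Sum>a\<in>UNIV. v $ a *\<^sub>R (real_frame a :: complex^'n))"
      have "v \<bullet> (A *v v) = (\<Sum>a\<in>UNIV. \<Sum>b\<in>UNIV. v $ a * (v $ b * metric \<omega> c x (real_frame a) (real_frame b)))"
        unfolding inner_vec_def matrix_vector_mult_def by (simp add: A_def sum_distrib_left mult_ac)
      also have "\<dots> = metric \<omega> c x w w"
        unfolding w_def by (subst bilinear_sum[OF b]) (simp_all add: bilinear_lmul[OF b] bilinear_rmul[OF b] sum.cartesian_product mult_ac)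
      also have "\<dots> = (tnorm \<omega> c x w)\<^sup>2" unfolding tnorm_def using metric_nonneg[OF c x] by simp
      also have "\<dots> \<ge> (m * norm w)\<^sup>2" using bd m by (intro power_mono) auto
      finally show "m\<^sup>2 * (norm v)\<^sup>2 \<le> v \<bullet> (A *v v)"
        unfolding w_def norm_real_frame_sum by (simp add: power_mult_distrib)
    qed
    then show "sqrt \<kappa> \<le> vol_density \<omega> c x" unfolding vol_density_def A_def by simp
  qed
qed

lemma continuous_on_vol_density: "c \<in> M \<Longrightarrow> continuous_on (chart_img c) (vol_density \<omega> c)"
  unfolding vol_density_def
  by (intro continuous_intros continuous_on_det) (simp add: continuous_on_metric)

lemma chart_volume_le_volume: assumes c: "c \<in> M" shows "chart_volume \<omega> c \<le> volume M \<omega>" "sets (volume M \<omega>) = sets borel"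
proof -
  show "chart_volume \<omega> c \<le> volume M \<omega>" unfolding volume_def using c by (rule SUP_upper)
  show "sets (volume M \<omega>) = sets borel" unfolding volume_def
    using c by (intro sets_SUP) (auto simp: chart_volume_def)
qed

text \<open>The Riemannian measure is a least upper bound in the lattice of measures, so it
  dominates the volume measured in each single chart.\<close>

lemma nn_integral_volume_ge:
  assumes c: "c \<in> M" and U: "open U" "U \<subseteq> chart_img c" and u: "u \<in> borel_measurable borel"
    and \<kappa>: "\<And>x. x \<in> U \<Longrightarrow> \<kappa> \<le> vol_density \<omega> c x"
  shows "ennreal \<kappa> * (\<integral>\<^sup>+x\<in>U. u (chart_inv c x) \<partial>lborel) \<le> (\<integral>\<^sup>+x. u x \<partial>volume M \<omega>)"
proof -
  let ?R = "restrict_space lborel (chart_img c)"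
  have sR: "sets ?R = sets (restrict_space borel (chart_img c))" by (rule sets_restrict_space_cong) simp
  have img [measurable]: "chart_img c \<in> sets borel" using open_chart_img[OF c] by simp
  have [measurable]: "chart_inv c \<in> ?R \<rightarrow>\<^sub>M borel"
    using borel_measurable_continuous_on_restrict[OF continuous_on_chart_inv[OF c]] measurable_cong_sets[OF sR refl] by blast
  have [measurable]: "vol_density \<omega> c \<in> ?R \<rightarrow>\<^sub>M borel"
    using borel_measurable_continuous_on_restrict[OF continuous_on_vol_density[OF c]] measurable_cong_sets[OF sR refl] by blast
  have uR: "(\<lambda>x. u (chart_inv c x)) \<in> borel_measurable ?R"
    by (rule measurable_compose[OF _ u]) measurable
  note u [measurable]
  have [measurable]: "(\<lambda>x. u (chart_inv c x) * indicator U x) \<in> borel_measurable borel"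
  proof -
    have q: "(\<lambda>x. u (chart_inv c x) * indicator (chart_img c) x) \<in> borel_measurable borel"
      using uR borel_measurable_restrict_space_iff_ennreal[of "chart_img c" lborel "\<lambda>x. u (chart_inv c x)"] img by simp
    have "(\<lambda>x. u (chart_inv c x) * indicator (chart_img c) x * indicator U x) \<in> borel_measurable borel"
      using U(1) by (intro borel_measurable_times_ennreal[OF q borel_measurable_indicator]) auto
    moreover have "(\<lambda>x. u (chart_inv c x) * indicator (chart_img c) x * indicator U x) = (\<lambda>x. u (chart_inv c x) * indicator U x)"
      using U(2) by (auto simp: indicator_def fun_eq_iff)
    ultimately show ?thesis by simp
  qed
  have "ennreal \<kappa> * (\<integral>\<^sup>+x\<in>U. u (chart_inv c x) \<partial>lborel) = (\<integral>\<^sup>+x. ennreal \<kappa> * (u (chart_inv c x) * indicator U x) \<partial>lborel)"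
    by (simp add: nn_integral_cmult)
  also have "\<dots> \<le> (\<integral>\<^sup>+x. (ennreal (vol_density \<omega> c x) * u (chart_inv c x)) * indicator (chart_img c) x \<partial>lborel)"
    using U \<kappa> by (intro nn_integral_mono) (auto simp: indicator_def intro!: mult_right_mono ennreal_leI)
  also have "\<dots> = (\<integral>\<^sup>+x. ennreal (vol_density \<omega> c x) * u (chart_inv c x) \<partial>?R)"
    by (subst nn_integral_restrict_space) auto
  also have "\<dots> = (\<integral>\<^sup>+x. u (chart_inv c x) \<partial>density ?R (\<lambda>x. ennreal (vol_density \<omega> c x)))"
    by (subst nn_integral_density) (auto intro: uR)
  also have "\<dots> = (\<integral>\<^sup>+x. u x \<partial>chart_volume \<omega> c)"
    unfolding chart_volume_def by (subst nn_integral_distr) auto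
  also have "\<dots> \<le> (\<integral>\<^sup>+x. u x \<partial>volume M \<omega>)"
  proof (rule nn_integral_mono_measure)
    show "sets (chart_volume \<omega> c) = sets (volume M \<omega>)"
      using chart_volume_le_volume(2)[OF c] by (simp add: chart_volume_def)
  qed (rule chart_volume_le_volume(1)[OF c])
  finally show ?thesis .
qed

end

section \<open>Hermitian line bundles\<close>

locale hermitian_line_bundle = kaehler_manifold M \<omega>
  for M :: "('a::{t2_space,second_countable_topology}, 'n::finite) chart set"
    and \<omega> :: "('a, 'n) form2" +
  fixes \<pi> :: "'l \<Rightarrow> 'a" and T :: "('a set \<times> ('l \<Rightarrow> complex)) set" and h :: "'l \<Rightarrow> real"
  assumes line_bundle: "holo_line_bundle M \<pi> T" and hermitian: "hermitian_metric M \<pi> T h"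
begin

lemma trivialization_at:
  obtains W \<tau> where "(W, \<tau>) \<in> T" "p \<in> W"
proof -
  have "(\<Union>(W, \<tau>)\<in>T. W) = UNIV"
    using line_bundle unfolding holo_line_bundle_def by (elim conjE)
  then have "p \<in> (\<Union>(W, \<tau>)\<in>T. W)" by simp
  then show thesis using that by auto
qed

lemma trivialization:
  assumes "(W, \<tau>) \<in> T"
  shows "open W" "p \<in> W \<Longrightarrow> bij_betw \<tau> {v. \<pi> v = p} UNIV"
proof -
  have "\<forall>(W, \<tau>)\<in>T. open W \<and> (\<forall>p\<in>W. bij_betw \<tau> {v. \<pi> v = p} UNIV)"
    using line_bundle unfolding holo_line_bundle_def by (elim conjE)
  from bspec[OF this assms, unfolded prod.case]
  show "open W" "p \<in> W \<Longrightarrow> bij_betw \<tau> {v. \<pi> v = p} UNIV" by blast+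
qed

lemma hermitian_weight:
  assumes "(W, \<tau>) \<in> T"
  obtains \<phi> where "\<And>c. c \<in> M \<Longrightarrow> continuous_on (snd c ` (fst c \<inter> W)) (\<lambda>x. \<phi> (chart_inv c x))"
    "\<And>v. \<pi> v \<in> W \<Longrightarrow> h v = (cmod (\<tau> v))\<^sup>2 * exp (- \<phi> (\<pi> v))"
proof -
  obtain \<phi> where \<phi>: "\<forall>c\<in>M. smooth_on (\<lambda>x. \<phi> (chart_inv c x)) (snd c ` (fst c \<inter> W))"
    "\<forall>v. \<pi> v \<in> W \<longrightarrow> h v = (cmod (\<tau> v))\<^sup>2 * exp (- \<phi> (\<pi> v))"
    using bspec[OF hermitian[unfolded hermitian_metric_def] assms, unfolded prod.case] by blast
  have "continuous_on (snd c ` (fst c \<inter> W)) (\<lambda>x. \<phi> (chart_inv c x))" if "c \<in> M" for c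
  proof -
    have "Ck_on 0 (\<lambda>x. \<phi> (chart_inv c x)) (snd c ` (fst c \<inter> W))"
      using \<phi>(1) that unfolding smooth_on_def by blast
    then show ?thesis by simp
  qed
  with \<phi>(2) show thesis by (intro that[of \<phi>]) auto
qed

lemma norm_on_fibre:
  assumes "(W, \<tau>) \<in> T" "p \<in> W"
  obtains k where "k > 0" "\<And>v. \<pi> v = p \<Longrightarrow> h v = (cmod (\<tau> v))\<^sup>2 * k"
proof (rule hermitian_weight[OF assms(1)])
  fix \<phi> assume "\<And>v. \<pi> v \<in> W \<Longrightarrow> h v = (cmod (\<tau> v))\<^sup>2 * exp (- \<phi> (\<pi> v))"
  then show thesis using assms(2) by (intro that[of "exp (- \<phi> p)"]) auto
qed

lemma fibre_element_of_norm:
  assumes "s \<ge> 0" obtains v where "\<pi> v = p" "h v = s"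
proof -
  obtain W \<tau> where W: "(W, \<tau>) \<in> T" "p \<in> W" using trivialization_at .
  obtain k where k: "k > 0" "\<And>v. \<pi> v = p \<Longrightarrow> h v = (cmod (\<tau> v))\<^sup>2 * k"
    using norm_on_fibre[OF W] by blast
  have "\<tau> ` {v. \<pi> v = p} = UNIV" using trivialization(2)[OF W] by (simp add: bij_betw_def)
  then have "of_real (sqrt (s / k)) \<in> \<tau> ` {v. \<pi> v = p}" by simp
  then obtain v where v: "\<pi> v = p" "\<tau> v = of_real (sqrt (s / k))" by auto
  have "h v = s" using k(2)[OF v(1)] v(2) k(1) assms by simp
  with v(1) show thesis by (rule that)
qed

lemma quotient_indep_of_trivialization:
  assumes "(W, \<tau>) \<in> T" "(W', \<tau>') \<in> T" "\<pi> u \<in> W \<inter> W'" "\<pi> v = \<pi> u"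
  shows "\<tau>' v / \<tau>' u = \<tau> v / \<tau> u"
proof -
  have "\<forall>(W, \<tau>)\<in>T. \<forall>(W', \<tau>')\<in>T. \<exists>k. manifold_holo_on M k (W \<inter> W') \<and> (\<forall>p \<in> W \<inter> W'. k p \<noteq> 0) \<and>
        (\<forall>v. \<pi> v \<in> W \<inter> W' \<longrightarrow> \<tau>' v = k (\<pi> v) * \<tau> v)"
    using line_bundle unfolding holo_line_bundle_def by (elim conjE)
  from bspec[OF bspec[OF this assms(1), unfolded prod.case] assms(2), unfolded prod.case]
  obtain k where k: "\<And>p. p \<in> W \<inter> W' \<Longrightarrow> k p \<noteq> 0" "\<And>v. \<pi> v \<in> W \<inter> W' \<Longrightarrow> \<tau>' v = k (\<pi> v) * \<tau> v"
    by blast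
  have "\<pi> v \<in> W \<inter> W'" using assms(3,4) by simp
  then show ?thesis using k(1)[OF assms(3)] k(2)[OF assms(3)] k(2)[of v] assms(4) by simp
qed

lemma continuous_on_norm_section:
  assumes f: "holo_section M \<pi> T f"
  shows "continuous_on UNIV (\<lambda>p. h (f p))"
proof (rule continuous_at_imp_continuous_on, rule ballI)
  fix p
  obtain W \<tau> where W: "(W, \<tau>) \<in> T" "p \<in> W" using trivialization_at .
  obtain c where c: "c \<in> M" "p \<in> fst c" using chart_at .
  obtain \<phi> where "\<And>c. c \<in> M \<Longrightarrow> continuous_on (snd c ` (fst c \<inter> W)) (\<lambda>x. \<phi> (chart_inv c x))"
    and \<phi>2: "\<And>v. \<pi> v \<in> W \<Longrightarrow> h v = (cmod (\<tau> v))\<^sup>2 * exp (- \<phi> (\<pi> v))"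
    using hermitian_weight[OF W(1)] by blast
  note \<phi> = this(1)[OF c(1)] \<phi>2
  have \<pi>f: "\<pi> (f q) = q" for q using f unfolding holo_section_def by blast
  have "manifold_holo_on M (\<lambda>p. \<tau> (f p)) W" using f W(1) unfolding holo_section_def by blast
  then have "continuous_on (snd c ` (fst c \<inter> W)) (\<lambda>x. \<tau> (f (chart_inv c x)))"
    using c(1) unfolding manifold_holo_on_def by (blast intro: holo_on_imp_continuous_on)
  then have "continuous_on (snd c ` (fst c \<inter> W))
      (\<lambda>x. (cmod (\<tau> (f (chart_inv c x))))\<^sup>2 * exp (- \<phi> (chart_inv c x)))"
    by (intro continuous_intros \<phi>(1))
  then have "continuous_on (fst c \<inter> W) (\<lambda>q. (cmod (\<tau> (f (chart_inv c (snd c q)))))\<^sup>2 * exp (- \<phi> (chart_inv c (snd c q))))"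
    by (rule continuous_on_compose2) (auto intro: continuous_on_subset[OF continuous_on_chart[OF c(1)]])
  then have "continuous_on (fst c \<inter> W) (\<lambda>q. h (f q))"
    by (rule continuous_on_eq) (auto simp: chart_inv_chart[OF c(1)] \<phi>(2) \<pi>f)
  moreover have "open (fst c \<inter> W)" using open_chart_dom[OF c(1)] trivialization(1)[OF W(1)] by blast
  ultimately show "isCont (\<lambda>q. h (f q)) p" using c(2) W(2) continuous_on_eq_continuous_at by blast
qed

text \<open>The coefficient of \<open>f\<close> with respect to the frame \<open>e\<close>. Fibres
  carry no linear structure of their own, so it is a quotient of fibre coordinates, taken in any
  trivialization.\<close>

lemma section_coefficient:
  assumes c: "c \<in> M" and f: "holo_section M \<pi> T f" and B: "open B" "B \<subseteq> U" "B \<subseteq> chart_img c"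
    and e: "pullback_frame \<pi> T (chart_inv c) U e"
  obtains F where "holo_on F B"
    "\<And>z. z \<in> B \<Longrightarrow> h (f (chart_inv c z)) = (cmod (F z))\<^sup>2 * h (e z)"
    "\<And>z. z \<in> B \<Longrightarrow> h (e z) > 0"
proof -
  have \<pi>f: "\<pi> (f q) = q" for q using f unfolding holo_section_def by blast
  have \<pi>e: "\<pi> (e z) = chart_inv c z" if "z \<in> B" for z
    using e that B(2) unfolding pullback_frame_def by blast
  define F where "F z = (let (W, \<tau>) = (SOME (W, \<tau>). (W, \<tau>) \<in> T \<and> chart_inv c z \<in> W) in \<tau> (f (chart_inv c z)) / \<tau> (e z))" for z
  have F: "F z = \<tau> (f (chart_inv c z)) / \<tau> (e z)" if "z \<in> B" "(W, \<tau>) \<in> T" "chart_inv c z \<in> W" for z W \<tau>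
  proof -
    obtain W' \<tau>' where S: "(SOME (W, \<tau>). (W, \<tau>) \<in> T \<and> chart_inv c z \<in> W) = (W', \<tau>')" by fastforce
    have "\<exists>x. case x of (W, \<tau>) \<Rightarrow> (W, \<tau>) \<in> T \<and> chart_inv c z \<in> W" using that by auto
    from someI_ex[OF this] have "(W', \<tau>') \<in> T" "chart_inv c z \<in> W'" unfolding S by auto
    then show ?thesis unfolding F_def S
      using quotient_indep_of_trivialization[of W \<tau> W' \<tau>' "e z" "f (chart_inv c z)"] that \<pi>e \<pi>f by simp
  qed
  have nz: "\<tau> (e z) \<noteq> 0" if "z \<in> B" "(W, \<tau>) \<in> T" "chart_inv c z \<in> W" for z W \<tau>
    using e that B(2) unfolding pullback_frame_def by blast
  show thesis
  proof
    fix z assume z: "z \<in> B"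
    obtain W \<tau> where W: "(W, \<tau>) \<in> T" "chart_inv c z \<in> W" using trivialization_at .
    obtain k where k: "k > 0" "\<And>v. \<pi> v = chart_inv c z \<Longrightarrow> h v = (cmod (\<tau> v))\<^sup>2 * k"
      using norm_on_fibre[OF W] by blast
    show "h (f (chart_inv c z)) = (cmod (F z))\<^sup>2 * h (e z)"
      unfolding k(2)[OF \<pi>f] k(2)[OF \<pi>e[OF z]] F[OF z W] using nz[OF z W]
      by (simp add: norm_divide power_divide)
    show "h (e z) > 0" unfolding k(2)[OF \<pi>e[OF z]] using nz[OF z W] k(1) by simp
  next
    show "holo_on F B" unfolding holo_on_def
    proof
      fix z assume z: "z \<in> B"
      obtain W \<tau> where W: "(W, \<tau>) \<in> T" "chart_inv c z \<in> W" using trivialization_at .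
      define B' where "B' = B \<inter> snd c ` (fst c \<inter> W)"
      have B': "open B'" "\<And>x. x \<in> B' \<Longrightarrow> x \<in> B \<and> chart_inv c x \<in> W" "z \<in> B'"
        using open_chart_image[OF c trivialization(1)[OF W(1)]] B(1,3) z W(2)
        unfolding B'_def chart_image_Int[OF c] by auto
      have "holo_on (\<lambda>x. \<tau> (f (chart_inv c x))) (snd c ` (fst c \<inter> W))"
        using f W(1) c unfolding holo_section_def manifold_holo_on_def by blast
      then obtain a' where a': "((\<lambda>x. \<tau> (f (chart_inv c x))) has_derivative a') (at z)" "\<And>k v. a' (k *s v) = k * a' v"
        using B'(3) unfolding holo_on_def B'_def by blast
      have "holo_on (\<lambda>x. \<tau> (e x)) {x\<in>U. chart_inv c x \<in> W}"
        using e W(1) unfolding pullback_frame_def by blast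
      then obtain b' where b': "((\<lambda>x. \<tau> (e x)) has_derivative b') (at z)" "\<And>k v. b' (k *s v) = k * b' v"
        using z B(2) W(2) unfolding holo_on_def by blast
      let ?F' = "\<lambda>v. - \<tau> (f (chart_inv c z)) * (inverse (\<tau> (e z)) * b' v * inverse (\<tau> (e z))) + a' v / \<tau> (e z)"
      have "((\<lambda>x. \<tau> (f (chart_inv c x)) / \<tau> (e x)) has_derivative ?F') (at z)"
        by (rule has_derivative_divide[OF a'(1) b'(1) nz[OF z W]])
      then have "(F has_derivative ?F') (at z)"
        by (rule has_derivative_transform_within_open[OF _ B'(1,3)]) (use B'(2) F W(1) in auto)
      moreover have "?F' (k *s v) = k * ?F' v" for k v
        by (simp add: a'(2) b'(2) algebra_simps)
      ultimately show "\<exists>f'. (F has_derivative f') (at z) \<and> (\<forall>k v. f' (k *s v) = k * f' v)" by blast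
    qed
  qed
qed

section \<open>Sections with a zero near a point of the set\<close>

text \<open>The local estimate behind the theorem, with constants that do not depend on
  \<open>p\<close>. In the chart around \<open>p\<close> the flat estimate for a holomorphic
  function with a zero near the origin applies on the ball of radius \<open>r / lam\<close>, which
  the chart contains by completeness; the coordinates of \<open>q\<close> are at most \<open>d /
  mu\<close>, and Lebesgue measure is dominated by the Riemannian volume. The choice of close
  pairs in \<open>\<Lambda>\<close> puts a given point in either position, so both orders of the
  points in the distance are admitted.\<close>

lemma vanishing_section_estimate:
  assumes complete: "complete_metric M \<omega>" and reg: "regular_around M \<omega> \<pi> T h \<Lambda>"
  obtains \<epsilon> K where "\<epsilon> > 0" "K > 0"
    "\<And>f p q d. f \<in> fock_space M \<omega> \<pi> T h \<Longrightarrow> p \<in> \<Lambda> \<Longrightarrow> h (f q) = 0 \<Longrightarrow> 0 < d \<Longrightarrow> d \<le> \<epsilon> \<Longrightarrow>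
      geodist M \<omega> p q < ennreal d \<or> geodist M \<omega> q p < ennreal d \<Longrightarrow>
      ennreal (h (f p)) \<le> ennreal (K * d\<^sup>2) * (\<integral>\<^sup>+x. ennreal (h (f x)) \<partial>volume M \<omega>)"
proof -
  obtain r lam mu M2 N where pos: "r > 0" "lam > 0" "mu > 0" "M2 > 0"
    and chart: "\<forall>p\<in>\<Lambda>. \<exists>c\<in>M. p \<in> fst c \<and> snd c p = 0 \<and> (\<forall>u v. metric \<omega> c 0 u v = u \<bullet> v) \<and>
        geoball M \<omega> p r \<subseteq> fst c \<and>
        has_regular_frame M2 N \<pi> T h (chart_inv c) (snd c ` geoball M \<omega> p r) \<and>
        (\<forall>x \<in> snd c ` geoball M \<omega> p r. \<forall>v.
           mu * tnorm \<omega> c 0 v \<le> tnorm \<omega> c x v \<and> tnorm \<omega> c x v \<le> lam * tnorm \<omega> c 0 v)"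
    using reg unfolding regular_around_def by blast
  define \<rho> where "\<rho> = r / lam"
  have \<rho>: "\<rho> > 0" unfolding \<rho>_def using pos by simp
  obtain K0 where K0: "K0 > 0"
    "\<forall>\<Phi> F U (z::complex^'n). regular_weight M2 N U \<Phi> \<longrightarrow> ball 0 \<rho> \<subseteq> U \<longrightarrow> holo_on F (ball 0 \<rho>) \<longrightarrow>
       norm z \<le> \<rho> / 4 \<longrightarrow> F z = 0 \<longrightarrow>
       ennreal ((cmod (F 0))\<^sup>2 * exp (- \<Phi> 0)) \<le>
         ennreal (K0 * (norm z)\<^sup>2) * (\<integral>\<^sup>+x\<in>ball 0 \<rho>. ennreal ((cmod (F x))\<^sup>2 * exp (- \<Phi> x)) \<partial>lborel)"
    using weighted_value_bound_near_zero[OF less_imp_le[OF pos(4)] \<rho>, of N] by blast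
  obtain \<kappa> where \<kappa>: "\<kappa> > 0" "\<And>c x. c \<in> M \<Longrightarrow> x \<in> chart_img c \<Longrightarrow>
    (\<And>v. mu * norm v \<le> tnorm \<omega> c x v \<and> tnorm \<omega> c x v \<le> lam * norm v) \<Longrightarrow> \<kappa> \<le> vol_density \<omega> c x"
    using vol_density_lower_bound[OF pos(3), of lam] by blast
  define K where "K = K0 / (mu\<^sup>2 * \<kappa>)"
  show thesis
  proof
    \<comment> \<open>Points at distance less than \<open>mu * (\<rho> / 4)\<close> have
      coordinates of norm less than \<open>\<rho> / 4\<close>, the range in which the flat
      estimate holds.\<close>
    show "mu * (\<rho> / 4) > 0" "K > 0" using pos \<rho> K0 \<kappa> by (simp_all add: K_def)
    fix f p q d
    assume f: "f \<in> fock_space M \<omega> \<pi> T h" and p: "p \<in> \<Lambda>" and q: "h (f q) = 0" and d: "0 < d" "d \<le> mu * (\<rho> / 4)"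
      and dist: "geodist M \<omega> p q < ennreal d \<or> geodist M \<omega> q p < ennreal d"
    obtain c where c: "c \<in> M" "p \<in> fst c" "snd c p = 0" "\<And>u v. metric \<omega> c 0 u v = u \<bullet> v"
      "geoball M \<omega> p r \<subseteq> fst c" "has_regular_frame M2 N \<pi> T h (chart_inv c) (snd c ` geoball M \<omega> p r)"
      and bd: "\<And>x v. x \<in> snd c ` geoball M \<omega> p r \<Longrightarrow> mu * tnorm \<omega> c 0 v \<le> tnorm \<omega> c x v \<and> tnorm \<omega> c x v \<le> lam * tnorm \<omega> c 0 v"
      using chart p by blast
    have n0: "tnorm \<omega> c 0 v = norm v" for v unfolding tnorm_def c(4) by (simp add: norm_eq_sqrt_inner)
    note bd = bd[unfolded n0]
    define U where "U = snd c ` geoball M \<omega> p r"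
    have U: "ball 0 \<rho> \<subseteq> U" unfolding U_def \<rho>_def
      using ball_subset_geoball[OF complete c(1-3) pos(1,2) c(5)] bd by blast
    have Ui: "U \<subseteq> chart_img c" unfolding U_def chart_img_def using c(5) by blast
    have p0: "chart_inv c 0 = p" using chart_inv_chart[OF c(1,2)] c(3) by simp
    obtain e where e: "pullback_frame \<pi> T (chart_inv c) U e" "regular_weight M2 N U (\<lambda>z. - ln (h (e z)))"
      using c(6) unfolding has_regular_frame_def U_def by blast
    have fs: "holo_section M \<pi> T f" using f unfolding fock_space_def by blast
    have Bi: "ball 0 \<rho> \<subseteq> chart_img c" using U Ui by blast
    obtain F where F: "holo_on F (ball 0 \<rho>)"
      "\<And>z. z \<in> ball 0 \<rho> \<Longrightarrow> h (f (chart_inv c z)) = (cmod (F z))\<^sup>2 * h (e z)"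
      "\<And>z. z \<in> ball 0 \<rho> \<Longrightarrow> h (e z) > 0"
      using section_coefficient[OF c(1) fs open_ball U Bi e(1)] by blast
    have hf: "h (f (chart_inv c z)) = (cmod (F z))\<^sup>2 * exp (- (- ln (h (e z))))" if "z \<in> ball 0 \<rho>" for z
      using F(2,3)[OF that] by simp
    define z where "z = snd c q"
    define g where "g = (if geodist M \<omega> p q < ennreal d then geodist M \<omega> p q else geodist M \<omega> q p)"
    have g: "g = geodist M \<omega> (chart_inv c 0) q \<or> g = geodist M \<omega> q (chart_inv c 0)" "g < ennreal d"
      using dist unfolding g_def p0 by auto
    have gl: "g < ennreal (mu * (\<rho> / 4))" using g(2) d(2) by (meson ennreal_leI order.strict_trans2)
    have sub: "ball 0 (\<rho>/4) \<subseteq> ball (0::complex^'n) \<rho>" using \<rho> by (intro subset_ball) simp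
    have low: "mu * norm w \<le> tnorm \<omega> c x w" if "x \<in> ball 0 (\<rho>/4)" for x w
      using that sub U bd unfolding U_def by blast
    have "\<rho>/4 > 0" using \<rho> by simp
    note lower = geodist_lower_bound[OF c(1) order.trans[OF sub Bi] this pos(3) low g(1) gl]
    have zq: "q \<in> fst c" "norm z \<le> \<rho> / 4" "z \<in> ball 0 \<rho>" "chart_inv c z = q" "mu * norm z < d"
    proof -
      have a: "q \<in> fst c \<and> z \<in> ball 0 (\<rho>/4)" "ennreal (mu * norm (z - 0)) \<le> g"
        unfolding z_def using lower by auto
      show "q \<in> fst c" "norm z \<le> \<rho> / 4" "z \<in> ball 0 \<rho>" using a sub by auto
      show "chart_inv c z = q" unfolding z_def using a chart_inv_chart[OF c(1)] by simp
      have "ennreal (mu * norm z) < ennreal d" using a(2) g(2) by simp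
      then show "mu * norm z < d" using pos by (simp add: ennreal_less_iff)
    qed
    have "F z = 0" using F(2,3)[OF zq(3)] q unfolding zq(4) by auto
    let ?I = "\<integral>\<^sup>+x. ennreal (h (f x)) \<partial>volume M \<omega>"
    let ?J = "\<integral>\<^sup>+x\<in>ball 0 \<rho>. ennreal (h (f (chart_inv c x))) \<partial>lborel"
    have "ennreal (h (f p)) = ennreal ((cmod (F 0))\<^sup>2 * exp (- (- ln (h (e 0)))))"
      using hf[of 0] \<rho> p0 by simp
    also have "\<dots> \<le> ennreal (K0 * (norm z)\<^sup>2) *
        (\<integral>\<^sup>+x\<in>ball 0 \<rho>. ennreal ((cmod (F x))\<^sup>2 * exp (- (- ln (h (e x))))) \<partial>lborel)"
      by (rule K0(2)[rule_format, OF e(2) U F(1) zq(2) \<open>F z = 0\<close>])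
    also have "(\<integral>\<^sup>+x\<in>ball 0 \<rho>. ennreal ((cmod (F x))\<^sup>2 * exp (- (- ln (h (e x))))) \<partial>lborel) = ?J"
    proof (rule nn_integral_cong)
      fix x
      show "ennreal ((cmod (F x))\<^sup>2 * exp (- (- ln (h (e x))))) * indicator (ball 0 \<rho>) x =
        ennreal (h (f (chart_inv c x))) * indicator (ball 0 \<rho>) x"
        by (cases "x \<in> ball 0 \<rho>") (simp only: hf, simp add: indicator_def)
    qed
    also have "ennreal (K0 * (norm z)\<^sup>2) \<le> ennreal (K * d\<^sup>2 * \<kappa>)"
    proof (rule ennreal_leI)
      have "(mu * norm z)\<^sup>2 \<le> d\<^sup>2" using zq(5) pos by (intro power_mono) auto
      then have "K0 * (norm z)\<^sup>2 \<le> K0 / mu\<^sup>2 * d\<^sup>2"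
        using pos K0(1) by (simp add: power_mult_distrib field_simps)
      then show "K0 * (norm z)\<^sup>2 \<le> K * d\<^sup>2 * \<kappa>" unfolding K_def using \<kappa> by simp
    qed
    then have "ennreal (K0 * (norm z)\<^sup>2) * ?J \<le> ennreal (K * d\<^sup>2 * \<kappa>) * ?J" by (rule mult_right_mono) simp
    also have "\<dots> = ennreal (K * d\<^sup>2) * (ennreal \<kappa> * ?J)"
      using \<open>K > 0\<close> \<kappa> by (simp add: ennreal_mult mult.assoc)
    also have "\<dots> \<le> ennreal (K * d\<^sup>2) * ?I"
    proof (rule mult_left_mono)
      show "ennreal \<kappa> * ?J \<le> ?I"
      proof (rule nn_integral_volume_ge[OF c(1) open_ball Bi])
        show "(\<lambda>x. ennreal (h (f x))) \<in> borel_measurable borel"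
          by (rule measurable_compose[OF _ measurable_ennreal])
             (rule borel_measurable_continuous_onI[OF continuous_on_norm_section[OF fs]])
        show "\<kappa> \<le> vol_density \<omega> c x" if "x \<in> ball 0 \<rho>" for x
          using that U bd Bi by (intro \<kappa>(2)[OF c(1)]) (auto simp: U_def subset_iff)
      qed
    qed simp
    finally show "ennreal (h (f p)) \<le> ennreal (K * d\<^sup>2) * ?I" .
  qed
qed

lemma fock_space_norm_finite:
  assumes "f \<in> fock_space M \<omega> \<pi> T h"
  obtains J where "(\<integral>\<^sup>+x. ennreal (h (f x)) \<partial>volume M \<omega>) = ennreal J" "J \<ge> 0"
proof -
  have "(\<integral>\<^sup>+x. ennreal (h (f x)) \<partial>volume M \<omega>) < \<infinity>"
    using assms unfolding fock_space_def by blast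
  then show thesis
    using that by (cases "\<integral>\<^sup>+x. ennreal (h (f x)) \<partial>volume M \<omega>" rule: ennreal_cases) auto
qed

section \<open>Interpolation forces separation\<close>

text \<open>Interpolate the value of norm \<open>1\<close> at \<open>p\<close> and zero elsewhere.
  The local estimate for this one section keeps all other points of \<open>\<Lambda>\<close> away
  from \<open>p\<close>.\<close>

lemma interpolating_gap:
  assumes complete: "complete_metric M \<omega>" and reg: "regular_around M \<omega> \<pi> T h \<Lambda>"
    and int: "interpolating M \<omega> \<pi> T h \<Lambda>" and p: "p \<in> \<Lambda>"
  obtains \<delta> where "\<delta> > 0"
    "\<And>q. q \<in> \<Lambda> \<Longrightarrow> q \<noteq> p \<Longrightarrow> ennreal \<delta> \<le> geodist M \<omega> p q \<and> ennreal \<delta> \<le> geodist M \<omega> q p"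
proof -
  obtain \<epsilon> K where K: "\<epsilon> > 0" "K > 0"
    "\<And>f p q d. f \<in> fock_space M \<omega> \<pi> T h \<Longrightarrow> p \<in> \<Lambda> \<Longrightarrow> h (f q) = 0 \<Longrightarrow> 0 < d \<Longrightarrow> d \<le> \<epsilon> \<Longrightarrow>
      geodist M \<omega> p q < ennreal d \<or> geodist M \<omega> q p < ennreal d \<Longrightarrow>
      ennreal (h (f p)) \<le> ennreal (K * d\<^sup>2) * (\<integral>\<^sup>+x. ennreal (h (f x)) \<partial>volume M \<omega>)"
    using vanishing_section_estimate[OF complete reg] by blast
  have "\<exists>v. \<pi> v = x \<and> h v = (if x = p then 1 else 0)" for x
    using fibre_element_of_norm[of "if x = p then 1 else 0" x] by (metis zero_le_one order_refl)
  then obtain a where a: "\<And>x. \<pi> (a x) = x" "\<And>x. h (a x) = (if x = p then 1 else 0)" by metis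
  have "(\<lambda>x. if x = p then 1 else 0 :: real) summable_on \<Lambda>"
    using summable_on_cong_neutral[of "{p}" \<Lambda> "\<lambda>x. if x = p then 1 else 0 :: real" "\<lambda>x. if x = p then 1 else 0"] p by auto
  then have "a \<in> l2_sections \<pi> h \<Lambda>" unfolding l2_sections_def using a by simp
  then obtain f where f: "f \<in> fock_space M \<omega> \<pi> T h" "\<And>x. x \<in> \<Lambda> \<Longrightarrow> f x = a x"
    using int unfolding interpolating_def by blast
  obtain J where J: "(\<integral>\<^sup>+x. ennreal (h (f x)) \<partial>volume M \<omega>) = ennreal J" "J \<ge> 0"
    using fock_space_norm_finite[OF f(1)] .
  \<comment> \<open>Small enough that \<open>K * \<delta>\<^sup>2 * J < 1\<close>, also when
    \<open>J = 0\<close>.\<close>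
  define \<delta> where "\<delta> = min \<epsilon> (1 / sqrt (2 * (K * (J + 1))))"
  have \<delta>: "\<delta> > 0" "\<delta> \<le> \<epsilon>" using K J by (simp_all add: \<delta>_def)
  have "\<delta>\<^sup>2 \<le> (1 / sqrt (2 * (K * (J + 1))))\<^sup>2" using \<delta> by (intro power_mono) (auto simp: \<delta>_def)
  also have "\<dots> = 1 / (2 * (K * (J + 1)))" using K J by (simp add: power_divide)
  finally have "\<delta>\<^sup>2 * (2 * (K * (J + 1))) \<le> 1"
    using K(2) J(2) by (subst (asm) pos_le_divide_eq) auto
  moreover have "K * \<delta>\<^sup>2 * J \<le> K * \<delta>\<^sup>2 * (J + 1)" using K(2) by (intro mult_left_mono) auto
  ultimately have "K * \<delta>\<^sup>2 * J < 1" by (simp add: algebra_simps)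
  show thesis
  proof
    show "\<delta> > 0" by (rule \<delta>)
    fix q assume q: "q \<in> \<Lambda>" "q \<noteq> p"
    show "ennreal \<delta> \<le> geodist M \<omega> p q \<and> ennreal \<delta> \<le> geodist M \<omega> q p"
    proof (rule ccontr)
      assume "\<not> ?thesis"
      then have "geodist M \<omega> p q < ennreal \<delta> \<or> geodist M \<omega> q p < ennreal \<delta>" by (auto simp: not_le)
      from K(3)[OF f(1) p _ \<delta> this] have "ennreal 1 \<le> ennreal (K * \<delta>\<^sup>2) * ennreal J"
        using f(2) a p q J by simp
      then have "1 \<le> K * \<delta>\<^sup>2 * J" using K J by (simp add: ennreal_le_iff flip: ennreal_mult)
      then show False using \<open>K * \<delta>\<^sup>2 * J < 1\<close> by simp
    qed
  qed
qed

text \<open>Recursive choice of pairs, each closer than the gaps around all points chosen before.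
  A point with a gap larger than the distance of a later pair cannot belong to that pair, so every
  pair consists of new points.\<close>

lemma disjoint_close_pairs:
  fixes g :: "'a \<Rightarrow> real"
  assumes g: "\<And>p. p \<in> \<Lambda> \<Longrightarrow> g p > 0"
    "\<And>p q. p \<in> \<Lambda> \<Longrightarrow> q \<in> \<Lambda> \<Longrightarrow> q \<noteq> p \<Longrightarrow> ennreal (g p) \<le> geodist M \<omega> p q \<and> ennreal (g p) \<le> geodist M \<omega> q p"
    and close: "\<And>\<eta>::real. \<eta> > 0 \<Longrightarrow> \<exists>p\<in>\<Lambda>. \<exists>q\<in>\<Lambda>. p \<noteq> q \<and> geodist M \<omega> p q < ennreal \<eta>"
    and b: "\<And>k. b k > (0::real)"
  obtains p q :: "nat \<Rightarrow> 'a" where "range p \<subseteq> \<Lambda>" "range q \<subseteq> \<Lambda>" "inj p" "\<forall>j k. q k \<noteq> p j"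
    "\<forall>k. geodist M \<omega> (p k) (q k) < ennreal (b k)"
proof -
  define P where "P f k r \<longleftrightarrow> fst r \<in> \<Lambda> \<and> snd r \<in> \<Lambda> \<and> fst r \<noteq> snd r \<and> geodist M \<omega> (fst r) (snd r) < ennreal (b k) \<and>
      (\<forall>j<k. geodist M \<omega> (fst r) (snd r) < ennreal (g (fst (f j))) \<and> geodist M \<omega> (fst r) (snd r) < ennreal (g (snd (f j))))"
    for f :: "nat \<Rightarrow> 'a \<times> 'a" and k r
  have "\<exists>f. \<forall>k. P f k (f k)"
  proof (rule dependent_wellorder_choice)
    show "\<And>r f g x. (\<And>y. y < x \<Longrightarrow> f y = g y) \<Longrightarrow> P f x r = P g x r" by (simp add: P_def)
    fix k and f :: "nat \<Rightarrow> 'a \<times> 'a" assume IH: "\<And>j. j < k \<Longrightarrow> P f j (f j)"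
    define S where "S = insert (b k) ((\<lambda>j. min (g (fst (f j))) (g (snd (f j)))) ` {..<k})"
    have S: "finite S" "S \<noteq> {}" unfolding S_def by auto
    have "x > 0" if "x \<in> S" for x using that b[of k] IH g(1) unfolding S_def P_def by auto
    then have "Min S > 0" using S by simp
    then obtain p q where pq: "p \<in> \<Lambda>" "q \<in> \<Lambda>" "p \<noteq> q" "geodist M \<omega> p q < ennreal (Min S)" using close by blast
    have le: "geodist M \<omega> p q < ennreal x" if "Min S \<le> x" for x
      using pq(4) ennreal_leI[OF that] by (rule order.strict_trans2)
    have "Min S \<le> b k" using S unfolding S_def by simp
    moreover have "Min S \<le> g (fst (f j))" "Min S \<le> g (snd (f j))" if "j < k" for j
    proof -
      have "Min S \<le> min (g (fst (f j))) (g (snd (f j)))" using S(1) that unfolding S_def by (intro Min_le) auto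
      then show "Min S \<le> g (fst (f j))" "Min S \<le> g (snd (f j))" by auto
    qed
    ultimately have "P f k (p, q)" unfolding P_def using pq le by auto
    then show "\<exists>r. P f k r" by blast
  qed
  then obtain f where f: "\<And>k. P f k (f k)" by blast
  define p q where "p k = fst (f k)" and "q k = snd (f k)" for k
  have f1: "p k \<in> \<Lambda>" "q k \<in> \<Lambda>" "p k \<noteq> q k" "geodist M \<omega> (p k) (q k) < ennreal (b k)"
    "j < k \<Longrightarrow> geodist M \<omega> (p k) (q k) < ennreal (g (p j)) \<and> geodist M \<omega> (p k) (q k) < ennreal (g (q j))" for j k
    using f[of k] unfolding P_def p_def q_def by auto
  have fresh: "p k \<noteq> x \<and> q k \<noteq> x" if "x = p j \<or> x = q j" "j < k" for x j k
  proof -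
    have "geodist M \<omega> (p k) (q k) < ennreal (g x)" using f1(5)[OF that(2)] that(1) by auto
    then show ?thesis
      using g(2)[of "p k" "q k"] g(2)[of "q k" "p k"] f1(1-3)[of k] by (metis not_le)
  qed
  show thesis
  proof
    show "range p \<subseteq> \<Lambda>" "range q \<subseteq> \<Lambda>" using f1 by auto
    show "inj p" by (rule linorder_injI) (metis fresh)
    have "q k \<noteq> p j" for j k
      using f1(3) fresh[of "p j" j k] fresh[of "q k" k j] by (metis linorder_neqE_nat)
    then show "\<forall>j k. q k \<noteq> p j" by blast
    show "\<forall>k. geodist M \<omega> (p k) (q k) < ennreal (b k)" using f1(4) by blast
  qed
qed

text \<open>If \<open>\<Lambda>\<close> is not uniformly separated, a single square summable
  \<open>a\<close> that cannot be interpolated is written down: squared norm \<open>(1/4) ^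
  k\<close> at \<open>p k\<close> and zero elsewhere, where \<open>q k\<close> has distance less
  than \<open>\<epsilon> * (1/4) ^ k\<close> from \<open>p k\<close>. The local estimate would
  bound \<open>(1/4) ^ k\<close> by a constant times \<open>(1/16) ^ k\<close> for all
  \<open>k\<close>.\<close>

lemma interpolating_imp_uniformly_separated:
  assumes complete: "complete_metric M \<omega>" and reg: "regular_around M \<omega> \<pi> T h \<Lambda>"
    and int: "interpolating M \<omega> \<pi> T h \<Lambda>"
  shows "uniformly_separated M \<omega> \<Lambda>"
proof (rule ccontr)
  assume ns: "\<not> uniformly_separated M \<omega> \<Lambda>"
  have close: "\<exists>p\<in>\<Lambda>. \<exists>q\<in>\<Lambda>. p \<noteq> q \<and> geodist M \<omega> p q < ennreal \<eta>" if "\<eta> > 0" for \<eta> :: real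
  proof (rule ccontr)
    assume "\<not> ?thesis"
    then have "ennreal \<eta> \<le> (INF (p, q) \<in> {(p, q). p \<in> \<Lambda> \<and> q \<in> \<Lambda> \<and> p \<noteq> q}. geodist M \<omega> p q)"
      by (intro INF_greatest) (auto simp: not_less)
    then have "uniformly_separated M \<omega> \<Lambda>"
      unfolding uniformly_separated_def by (rule order.strict_trans2[rotated]) (use that in simp)
    then show False using ns by contradiction
  qed
  obtain \<epsilon> K where K: "\<epsilon> > 0" "K > 0"
    "\<And>f p q d. f \<in> fock_space M \<omega> \<pi> T h \<Longrightarrow> p \<in> \<Lambda> \<Longrightarrow> h (f q) = 0 \<Longrightarrow> 0 < d \<Longrightarrow> d \<le> \<epsilon> \<Longrightarrow>
      geodist M \<omega> p q < ennreal d \<or> geodist M \<omega> q p < ennreal d \<Longrightarrow>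
      ennreal (h (f p)) \<le> ennreal (K * d\<^sup>2) * (\<integral>\<^sup>+x. ennreal (h (f x)) \<partial>volume M \<omega>)"
    using vanishing_section_estimate[OF complete reg] by blast
  have "\<forall>p\<in>\<Lambda>. \<exists>\<delta>>0. \<forall>q\<in>\<Lambda>. q \<noteq> p \<longrightarrow> ennreal \<delta> \<le> geodist M \<omega> p q \<and> ennreal \<delta> \<le> geodist M \<omega> q p"
    using interpolating_gap[OF assms] by metis
  then obtain g where g: "\<And>p. p \<in> \<Lambda> \<Longrightarrow> g p > 0"
    "\<And>p q. p \<in> \<Lambda> \<Longrightarrow> q \<in> \<Lambda> \<Longrightarrow> q \<noteq> p \<Longrightarrow> ennreal (g p) \<le> geodist M \<omega> p q \<and> ennreal (g p) \<le> geodist M \<omega> q p"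
    by metis
  define b where "b k = \<epsilon> * (1/4) ^ k" for k :: nat
  have b: "b k > 0" "b k \<le> \<epsilon>" for k using K(1) by (simp_all add: b_def mult_left_le power_le_one)
  obtain p q :: "nat \<Rightarrow> 'a" where pq: "range p \<subseteq> \<Lambda>" "range q \<subseteq> \<Lambda>" "inj p" "\<forall>j k. q k \<noteq> p j"
    "\<forall>k. geodist M \<omega> (p k) (q k) < ennreal (b k)"
    by (rule disjoint_close_pairs[of \<Lambda> g b]) (rule g close b(1) that | assumption)+
  define s where "s x = (if x \<in> range p then (1/4) ^ inv p x else 0 :: real)" for x
  have sp: "s (p k) = (1/4) ^ k" for k using pq(3) by (simp add: s_def)
  have sq: "s (q k) = 0" for k using pq(4) unfolding s_def by (metis rangeE)
  have "(\<lambda>k. s (p k)) summable_on UNIV"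
    unfolding sp by (intro norm_summable_imp_summable_on) (simp add: summable_geometric)
  then have "s summable_on range p" using summable_on_reindex[OF pq(3), of s] by (simp add: o_def)
  then have "s summable_on \<Lambda>"
    using summable_on_cong_neutral[of \<Lambda> "range p" s s] pq(1) by (auto simp: s_def)
  moreover have "\<exists>v. \<pi> v = x \<and> h v = s x" for x
    using fibre_element_of_norm[of "s x" x] by (metis s_def zero_le_power order_refl zero_le_divide_1_iff zero_le_numeral)
  then obtain a where a: "\<And>x. \<pi> (a x) = x" "\<And>x. h (a x) = s x" by metis
  ultimately have "a \<in> l2_sections \<pi> h \<Lambda>" unfolding l2_sections_def by simp
  then obtain f where f: "f \<in> fock_space M \<omega> \<pi> T h" "\<And>x. x \<in> \<Lambda> \<Longrightarrow> f x = a x"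
    using int unfolding interpolating_def by blast
  obtain J where J: "(\<integral>\<^sup>+x. ennreal (h (f x)) \<partial>volume M \<omega>) = ennreal J" "J \<ge> 0"
    using fock_space_norm_finite[OF f(1)] .
  have "4 ^ k \<le> K * \<epsilon>\<^sup>2 * J" for k
  proof -
    have \<Lambda>: "p k \<in> \<Lambda>" "q k \<in> \<Lambda>" using pq by auto
    have "ennreal (h (f (p k))) \<le> ennreal (K * (b k)\<^sup>2) * ennreal J"
      unfolding J(1)[symmetric]
      by (rule K(3)[OF f(1) \<Lambda>(1) _ b]) (use f(2)[OF \<Lambda>(2)] a sq spec[OF pq(5), of k] in auto)
    then have "ennreal ((1/4)^k) \<le> ennreal (K * (b k)\<^sup>2 * J)"
      using f(2)[OF \<Lambda>(1)] a sp K(2) J(2) by (simp add: ennreal_mult)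
    then have "(1/4)^k \<le> K * (b k)\<^sup>2 * J" using K(2) J(2) by (subst (asm) ennreal_le_iff) auto
    also have "\<dots> = (K * \<epsilon>\<^sup>2 * J) * ((1/4)^k * (1/4)^k)" by (simp add: b_def power2_eq_square)
    finally have "1 / 4^k \<le> (K * \<epsilon>\<^sup>2 * J) * (1 / 4^k * (1 / 4^k))" by (simp only: power_one_over)
    moreover have "w \<le> X" if "1 / w \<le> X * (1 / w * (1 / w))" "w > 0" for w X :: real
      using that by (simp add: field_simps)
    ultimately show ?thesis by simp
  qed
  moreover obtain n where "K * \<epsilon>\<^sup>2 * J < 4 ^ n" using real_arch_pow[of 4 "K * \<epsilon>\<^sup>2 * J"] by auto
  ultimately show False by (simp add: not_less[symmetric])
qed

end

theorem theorem3:
  fixes M :: "('a::{t2_space,second_countable_topology}, 'n::finite) chart set"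
    and \<omega> :: "('a, 'n) form2"
    and \<pi> :: "'l \<Rightarrow> 'a"
    and T :: "('a set \<times> ('l \<Rightarrow> complex)) set"
    and h :: "'l \<Rightarrow> real"
    and \<Lambda> :: "'a set"
  assumes "kaehler_cartan_hadamard M \<omega>"
    and "discrete \<Lambda>"
    and "holo_line_bundle M \<pi> T"
    and "hermitian_metric M \<pi> T h"
    and "regular_around M \<omega> \<pi> T h \<Lambda>"
    and "interpolating M \<omega> \<pi> T h \<Lambda>"
  shows "uniformly_separated M \<omega> \<Lambda>"
proof -
  have X: "complex_structure M" "kaehler_form M \<omega>" "complete_metric M \<omega>"
    using assms(1) unfolding kaehler_cartan_hadamard_def by blast+
  interpret hermitian_line_bundle M \<omega> \<pi> T h
    using X(1,2) assms(3,4) by unfold_locales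
  show ?thesis
    using X(3) assms(5,6) by (rule interpolating_imp_uniformly_separated)
qed

end
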